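(* Let $0<\alpha_2<\alpha_1<1$, $c_1>0$, $c_2\ge0$, $c_1+c_2=1$. The service times of the mixed time-changed Erlang queue are independent and identically distributed with probability density function $f_X=f_{Y_1}^{*(k)}$ (the $k$-fold convolution of $f_{Y_1}$), where $f_{Y_1}$ is the probability density function of an inter-phase time, given for $t>0$ by $$f_{Y_1}(t)=\frac{k\mu}{c_1}t^{\alpha_1-1}\sum_{r=0}^\infty\Big(-\frac{c_2}{c_1}\Big)^rt^{(\alpha_1-\alpha_2)r}E^{r+1}_{\alpha_1,\alpha_1+(\alpha_1-\alpha_2)r}\Big(-\frac{k\mu\,t^{\alpha_1}}{c_1}\Big).$$ The Laplace transform of $f_X$ is $$\tilde f_X(z)=\Big(\frac{k\mu}{k\mu+c_1z^{\alpha_1}+c_2z^{\alpha_2}}\Big)^k,\quad z>0.$$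
   Context: Parameters: $\lambda>0$, $\mu>0$, $k\in\mathbb N=\{1,2,\dots\}$. Erlang queue: single-server queue with Poisson arrivals of rate $\lambda$, each service consisting of $k$ successive phases, each exponential with parameter $k\mu$, all independent. $\mathcal Q(t)=(\mathcal N(t),\mathcal S(t))$, where $\mathcal N(t)$ is the number of customers in the system and $\mathcal S(t)$ is the phase of the customer being served if $\mathcal N(t)>0$ (phases are counted down: service starts at phase $k$ and ends upon completion of phase $1$), with $\mathcal S(t)=0$ if $\mathcal N(t)=0$. Thus $\mathcal Q$ is the continuous-time Markov chain on $\mathcal H_0=\mathcal H\cup\{(0,0)\}$, $\mathcal H=\{(n,s)\in\mathbb N\times\mathbb N: s\le k\}$, with $\mathcal Q(0)=(0,0)$ and transition rates: $(0,0)\to(1,k)$ at rate $\lambda$; $(n,s)\to(n+1,s)$ at rate $\lambda$; $(n,s)\to(n,s-1)$ at rate $k\mu$ if $s\ge2$; $(n,1)\to(n-1,k)$ at rate $k\mu$ if $n\ge2$; $(1,1)\to(0,0)$ at rate $k\mu$. Inverse mixed stable subordinator: $\{D_{\alpha_1,\alpha_2}(t)\}_{t\ge0}$ is the nondecreasing Lévy process (started at $0$) with $\mathbb E(e^{-zD_{\alpha_1,\alpha_2}(t)})=e^{-t(c_1z^{\alpha_1}+c_2z^{\alpha_2})}$, $z>0$; $Y_{\alpha_1,\alpha_2}(t)=\inf\{s\ge0:D_{\alpha_1,\alpha_2}(s)>t\}$, $t>0$, $Y_{\alpha_1,\alpha_2}(0)=0$. Mixed time-changed Erlang queue: $\mathcal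 Q^{\alpha_1,\alpha_2}(t)=\mathcal Q(Y_{\alpha_1,\alpha_2}(t))$, with $\mathcal Q$ and $Y_{\alpha_1,\alpha_2}$ independent. An inter-phase time is the duration, in $\mathcal Q^{\alpha_1,\alpha_2}$, of a single service phase, from the instant the phase starts being served to the instant it is completed. A service time is the total duration $X=Y_1+\dots+Y_k$ of the $k$ consecutive phases of one customer's service. Three-parameter Mittag-Leffler function: $E^\gamma_{\alpha,\beta}(t)=\sum_{r=0}^\infty\frac{\Gamma(\gamma+r)t^r}{r!\,\Gamma(\gamma)\Gamma(\alpha r+\beta)}$, $t\in\mathbb R$, $\alpha,\beta,\gamma>0$. Convention $0^0=1$. Convolution of functions on $(0,\infty)$: $(f*g)(t)=\int_0^tf(t-u)g(u)\,\mathrm du$, $f^{*(1)}=f$, $f^{*(N+1)}=f*f^{*(N)}$. *)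

theory Defs
  imports "HOL-Probability.Probability"
begin

text \<open>
  Processes are functions \<open>X t \<omega>\<close> with a real time parameter, of which only \<open>t \<ge> 0\<close> is used.
\<close>

section \<open>Continuous-time Markov chains\<close>

text \<open>Right-continuity with left limits on \<open>[0,\<infinity>)\<close>, for the discrete topology on the state space.\<close>

definition cadlag_step_path :: "(real \<Rightarrow> 's) \<Rightarrow> bool" where
  "cadlag_step_path x \<longleftrightarrow>
     (\<forall>t\<ge>0. eventually (\<lambda>u. x u = x t) (at_right t)) \<and>
     (\<forall>t>0. \<exists>l. eventually (\<lambda>u. x u = l) (at_left t))"

text \<open>
  \<open>P h i\<close> is the law of the chain a time \<open>h\<close> after it is in state \<open>i\<close>.  The Markov property is stated
  in product form, so that conditioning events of probability zero need no special treatment.  The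
  values of \<open>q\<close> on the diagonal are not used; the total exit rate from \<open>i\<close> is the sum of the \<open>q i j\<close>,
  \<open>j \<noteq> i\<close>.
\<close>

definition markov_chain_with_rates ::
  "'a measure \<Rightarrow> (real \<Rightarrow> 'a \<Rightarrow> 's) \<Rightarrow> 's set \<Rightarrow> 's \<Rightarrow> ('s \<Rightarrow> 's \<Rightarrow> real) \<Rightarrow> bool" where
  "markov_chain_with_rates M X I i0 q \<longleftrightarrow>
     (\<forall>t\<ge>0. X t \<in> measurable M (count_space I)) \<and>
     (AE \<omega> in M. X 0 \<omega> = i0) \<and>
     (AE \<omega> in M. cadlag_step_path (\<lambda>t. X t \<omega>)) \<and>
     (\<exists>P :: real \<Rightarrow> 's \<Rightarrow> 's pmf.
        (\<forall>h>0. \<forall>i\<in>I. set_pmf (P h i) \<subseteq> I) \<and>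
        (\<forall>(n::nat) (t :: nat \<Rightarrow> real) (i :: nat \<Rightarrow> 's).
           0 \<le> t 0 \<and> (\<forall>m\<le>n. t m < t (Suc m)) \<and> (\<forall>m\<le>Suc n. i m \<in> I) \<longrightarrow>
           measure M {\<omega> \<in> space M. \<forall>m\<le>Suc n. X (t m) \<omega> = i m} =
             measure M {\<omega> \<in> space M. \<forall>m\<le>n. X (t m) \<omega> = i m} *
             pmf (P (t (Suc n) - t n) (i n)) (i (Suc n))) \<and>
        (\<forall>i\<in>I. \<forall>j\<in>I. i \<noteq> j \<longrightarrow> ((\<lambda>h. pmf (P h i) j / h) \<longlongrightarrow> q i j) (at_right 0)) \<and>
        (\<forall>i\<in>I. ((\<lambda>h. (1 - pmf (P h i) i) / h) \<longlongrightarrow> (\<Sum>\<^sub>\<infinity>j\<in>I - {i}. q i j)) (at_right 0)))"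

section \<open>The Erlang queue\<close>

text \<open>A state \<open>(n, s)\<close> consists of the number of customers and the phase of the running service.\<close>

definition erlang_states :: "nat \<Rightarrow> (nat \<times> nat) set" where
  "erlang_states k = insert (0, 0) {(n, s). 1 \<le> n \<and> 1 \<le> s \<and> s \<le> k}"

text \<open>The transitions by which the phase being served is completed.\<close>

definition phase_completes :: "nat \<Rightarrow> nat \<times> nat \<Rightarrow> nat \<times> nat \<Rightarrow> bool" where
  "phase_completes k p p' \<longleftrightarrow> (case p of (n, s) \<Rightarrow>
     (n \<ge> 1 \<and> s \<ge> 2 \<and> p' = (n, s - 1)) \<or>
     (n \<ge> 2 \<and> s = 1 \<and> p' = (n - 1, k)) \<or>
     (n = 1 \<and> s = 1 \<and> p' = (0, 0)))"

text \<open>The transitions by which a new phase starts being served.\<close>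

definition phase_starts :: "nat \<Rightarrow> nat \<times> nat \<Rightarrow> nat \<times> nat \<Rightarrow> bool" where
  "phase_starts k p p' \<longleftrightarrow>
     (p = (0, 0) \<and> p' = (1, k)) \<or> (phase_completes k p p' \<and> p' \<noteq> (0, 0))"

definition erlang_rate :: "real \<Rightarrow> real \<Rightarrow> nat \<Rightarrow> nat \<times> nat \<Rightarrow> nat \<times> nat \<Rightarrow> real" where
  "erlang_rate lam mu k p p' =
     (if p = (0, 0) then (if p' = (1, k) then lam else 0)
      else if p' = (fst p + 1, snd p) then lam
      else if phase_completes k p p' then real k * mu
      else 0)"

definition erlang_queue ::
  "'a measure \<Rightarrow> real \<Rightarrow> real \<Rightarrow> nat \<Rightarrow> (real \<Rightarrow> 'a \<Rightarrow> nat \<times> nat) \<Rightarrow> bool" where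
  "erlang_queue M lam mu k Q \<longleftrightarrow>
     markov_chain_with_rates M Q (erlang_states k) (0, 0) (erlang_rate lam mu k)"

section \<open>Phases and services along a path\<close>

definition jump_at :: "(real \<Rightarrow> 's) \<Rightarrow> real \<Rightarrow> 's \<Rightarrow> 's \<Rightarrow> bool" where
  "jump_at x t p p' \<longleftrightarrow> 0 < t \<and> eventually (\<lambda>u. x u = p) (at_left t) \<and> x t = p' \<and> p \<noteq> p'"

definition phase_start_times :: "nat \<Rightarrow> (real \<Rightarrow> nat \<times> nat) \<Rightarrow> real set" where
  "phase_start_times k x = {t. \<exists>p p'. jump_at x t p p' \<and> phase_starts k p p'}"

definition phase_completion_times :: "nat \<Rightarrow> (real \<Rightarrow> nat \<times> nat) \<Rightarrow> real set" where
  "phase_completion_times k x = {t. \<exists>p p'. jump_at x t p p' \<and> phase_completes k p p'}"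

text \<open>
  Phases are numbered \<open>0, 1, 2, \<dots>\<close> in chronological order, across all customers.  The next phase
  starts at the very instant the previous one is completed, unless the system becomes empty.
\<close>

primrec phase_start :: "nat \<Rightarrow> (real \<Rightarrow> nat \<times> nat) \<Rightarrow> nat \<Rightarrow> real" where
  "phase_start k x 0 = Inf (phase_start_times k x)"
| "phase_start k x (Suc j) =
     Inf (phase_start_times k x \<inter> {Inf (phase_completion_times k x \<inter> {phase_start k x j<..})..})"

definition phase_end :: "nat \<Rightarrow> (real \<Rightarrow> nat \<times> nat) \<Rightarrow> nat \<Rightarrow> real" where
  "phase_end k x j = Inf (phase_completion_times k x \<inter> {phase_start k x j<..})"

definition inter_phase_time :: "nat \<Rightarrow> (real \<Rightarrow> nat \<times> nat) \<Rightarrow> nat \<Rightarrow> real" where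
  "inter_phase_time k x j = phase_end k x j - phase_start k x j"

text \<open>
  The \<open>m\<close>-th service (counted from 0) comprises the \<open>k\<close> phases number \<open>m k, \<dots>, m k + k - 1\<close>.
  These path functionals are meaningful only for regular paths.  Path regularity of the processes
  is required almost surely, so the functionals are random variables on the completed probability
  space only: on the exceptional null set nothing controls their values.
\<close>

definition service_time :: "nat \<Rightarrow> (real \<Rightarrow> nat \<times> nat) \<Rightarrow> nat \<Rightarrow> real" where
  "service_time k x m = (\<Sum>i<k. inter_phase_time k x (m * k + i))"

section \<open>The mixed stable subordinator and the time change\<close>

definition cadlag_path :: "(real \<Rightarrow> real) \<Rightarrow> bool" where
  "cadlag_path x \<longleftrightarrow>
     (\<forall>t\<ge>0. (x \<longlongrightarrow> x t) (at_right t)) \<and> (\<forall>t>0. \<exists>l. (x \<longlongrightarrow> l) (at_left t))"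

definition levy_process :: "'a measure \<Rightarrow> (real \<Rightarrow> 'a \<Rightarrow> real) \<Rightarrow> bool" where
  "levy_process M D \<longleftrightarrow>
     (\<forall>t\<ge>0. D t \<in> borel_measurable M) \<and>
     (AE \<omega> in M. D 0 \<omega> = 0) \<and>
     (AE \<omega> in M. cadlag_path (\<lambda>t. D t \<omega>)) \<and>
     (\<forall>(n::nat) (t :: nat \<Rightarrow> real). 0 \<le> t 0 \<and> (\<forall>i<n. t i \<le> t (Suc i)) \<longrightarrow>
        prob_space.indep_vars M (\<lambda>_. borel) (\<lambda>i \<omega>. D (t (Suc i)) \<omega> - D (t i) \<omega>) {..<n}) \<and>
     (\<forall>s\<ge>0. \<forall>t\<ge>0. distr M borel (\<lambda>\<omega>. D (s + t) \<omega> - D s \<omega>) = distr M borel (D t))"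

definition mixed_stable_subordinator ::
  "'a measure \<Rightarrow> real \<Rightarrow> real \<Rightarrow> real \<Rightarrow> real \<Rightarrow> (real \<Rightarrow> 'a \<Rightarrow> real) \<Rightarrow> bool" where
  "mixed_stable_subordinator M a1 a2 c1 c2 D \<longleftrightarrow>
     levy_process M D \<and>
     (AE \<omega> in M. mono_on {0..} (\<lambda>t. D t \<omega>)) \<and>
     (\<forall>t\<ge>0. \<forall>z>0. integral\<^sup>L M (\<lambda>\<omega>. exp (- z * D t \<omega>)) =
        exp (- t * (c1 * z powr a1 + c2 * z powr a2)))"

definition inverse_subordinator :: "(real \<Rightarrow> 'a \<Rightarrow> real) \<Rightarrow> real \<Rightarrow> 'a \<Rightarrow> real" where
  "inverse_subordinator D t \<omega> = (if t > 0 then Inf {s. 0 \<le> s \<and> D s \<omega> > t} else 0)"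

definition time_changed :: "(real \<Rightarrow> 'a \<Rightarrow> 's) \<Rightarrow> (real \<Rightarrow> 'a \<Rightarrow> real) \<Rightarrow> real \<Rightarrow> 'a \<Rightarrow> 's" where
  "time_changed Q Y t \<omega> = Q (Y t \<omega>) \<omega>"

text \<open>The \<open>\<sigma>\<close>-algebras generated by the paths on \<open>[0,\<infinity>)\<close> are independent.\<close>

definition independent_processes ::
  "'a measure \<Rightarrow> 'b measure \<Rightarrow> (real \<Rightarrow> 'a \<Rightarrow> 'b) \<Rightarrow> 'c measure \<Rightarrow> (real \<Rightarrow> 'a \<Rightarrow> 'c) \<Rightarrow> bool" where
  "independent_processes M S X T Y \<longleftrightarrow>
     (\<forall>t\<ge>0. X t \<in> measurable M S) \<and> (\<forall>t\<ge>0. Y t \<in> measurable M T) \<and>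
     prob_space.indep_set M
       (sets (vimage_algebra (space M) (\<lambda>\<omega>. \<lambda>t\<in>{0..}. X t \<omega>) (\<Pi>\<^sub>M t\<in>{0..}. S)))
       (sets (vimage_algebra (space M) (\<lambda>\<omega>. \<lambda>t\<in>{0..}. Y t \<omega>) (\<Pi>\<^sub>M t\<in>{0..}. T)))"

section \<open>Densities\<close>

definition mittag_leffler3 :: "real \<Rightarrow> real \<Rightarrow> real \<Rightarrow> real \<Rightarrow> real" where
  "mittag_leffler3 \<gamma> \<alpha> \<beta> t =
     (\<Sum>r. Gamma (\<gamma> + real r) * t ^ r / (fact r * Gamma \<gamma> * Gamma (\<alpha> * real r + \<beta>)))"

definition inter_phase_term ::
  "real \<Rightarrow> real \<Rightarrow> real \<Rightarrow> real \<Rightarrow> real \<Rightarrow> nat \<Rightarrow> real \<Rightarrow> nat \<Rightarrow> real" where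
  "inter_phase_term a1 a2 c1 c2 mu k t r =
     (- (c2 / c1)) ^ r * t powr ((a1 - a2) * real r) *
     mittag_leffler3 (real r + 1) a1 (a1 + (a1 - a2) * real r) (- (real k * mu * t powr a1 / c1))"

text \<open>Functions on \<open>(0,\<infinity>)\<close> are extended by \<open>0\<close> to the real line.\<close>

definition inter_phase_density ::
  "real \<Rightarrow> real \<Rightarrow> real \<Rightarrow> real \<Rightarrow> real \<Rightarrow> nat \<Rightarrow> real \<Rightarrow> real" where
  "inter_phase_density a1 a2 c1 c2 mu k t =
     (if t > 0
      then real k * mu / c1 * t powr (a1 - 1) * (\<Sum>r. inter_phase_term a1 a2 c1 c2 mu k t r)
      else 0)"

definition convolution_fun :: "(real \<Rightarrow> real) \<Rightarrow> (real \<Rightarrow> real) \<Rightarrow> real \<Rightarrow> real" where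
  "convolution_fun f g t = (LBINT u:{0<..<t}. f (t - u) * g u)"

text \<open>\<open>conv_power f N\<close> is the \<open>N\<close>-fold convolution of \<open>f\<close> for \<open>N \<ge> 1\<close>; its value at \<open>N = 0\<close> is a dummy.\<close>

primrec conv_power :: "(real \<Rightarrow> real) \<Rightarrow> nat \<Rightarrow> real \<Rightarrow> real" where
  "conv_power f 0 = (\<lambda>t. 0)"
| "conv_power f (Suc N) = (if N = 0 then f else convolution_fun f (conv_power f N))"

definition service_density ::
  "real \<Rightarrow> real \<Rightarrow> real \<Rightarrow> real \<Rightarrow> real \<Rightarrow> nat \<Rightarrow> real \<Rightarrow> real" where
  "service_density a1 a2 c1 c2 mu k = conv_power (inter_phase_density a1 a2 c1 c2 mu k) k"

definition laplace_transform :: "(real \<Rightarrow> real) \<Rightarrow> real \<Rightarrow> real" where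
  "laplace_transform f z = (LBINT t:{0<..}. exp (- z * t) * f t)"

text \<open>\<open>f\<close> is nonnegative and is the probability density of the real random variable \<open>X\<close>.\<close>

definition has_pdf :: "'a measure \<Rightarrow> ('a \<Rightarrow> real) \<Rightarrow> (real \<Rightarrow> real) \<Rightarrow> bool" where
  "has_pdf M X f \<longleftrightarrow> (\<forall>t. 0 \<le> f t) \<and> distributed M lborel X (\<lambda>t. ennreal (f t))"

end

theory Submission
  imports Defs
begin

text \<open>
  Let \<open>\<psi>\<close> be the Laplace exponent of \<open>D\<close>, and let \<open>\<tau>\<^sub>l\<close> be the jump times of the Markov chain \<open>Q\<close>.  The
  time-changed chain visits the same states as \<open>Q\<close> and jumps at the left limits \<open>\<theta>\<^sub>l\<close> of \<open>D\<close> at \<open>\<tau>\<^sub>l\<close>.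
  On a grid of mesh \<open>h\<close>, the probability that \<open>Q\<close> runs through a given sequence of states with given
  holding times is a product of transition probabilities, and \<open>D\<close> has independent increments and is
  independent of \<open>Q\<close>.  Summing geometric series and letting \<open>h\<close> tend to \<open>0\<close> yields, for \<open>z\<^sub>0 = 0\<close>,
  \<open>E (\<Prod>l<m. exp (- z\<^sub>l (\<theta>\<^sub>l\<^sub>+\<^sub>1 - \<theta>\<^sub>l)); Q jumps through i\<^sub>0, \<dots>, i\<^sub>m) = \<Prod>l<m. q i\<^sub>l i\<^sub>l\<^sub>+\<^sub>1 / (r i\<^sub>l + \<psi> z\<^sub>l)\<close>.

  If \<open>z\<^sub>l\<close> depends only on the number \<open>c\<close> of completed phases and is \<open>0\<close> in the idle state, then
  \<open>c \<mapsto> \<Prod>j\<ge>c. k\<mu> / (k\<mu> + \<psi> z\<^sub>j)\<close> is harmonic for these weights.  So the joint Laplace transform of the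
  inter-phase times is the product of the factors \<open>k\<mu> / (k\<mu> + \<psi> z)\<close>, which makes them independent and
  identically distributed.  For large \<open>z\<close> the double series defining the density can be integrated
  termwise against \<open>exp (- z t)\<close> and gives the same factor; uniqueness of Laplace transforms and
  continuity then show that the series is nonnegative and is the density.
\<close>

section \<open>Laplace transforms of finite measures\<close>

text \<open>Independence is assumed between \<open>Q\<close> and the inverse of \<open>D\<close>, so
  \<open>D\<close> must first be recovered from its inverse by a countable infimum before its
  increments can be separated from \<open>Q\<close>. Left limits of \<open>D\<close> enter because,
  for \<open>t > 0\<close>, the inverse at \<open>t\<close> lies below \<open>\<tau>\<close> exactly
  when \<open>D\<close> exceeds \<open>t\<close> before \<open>\<tau>\<close>; this holds path by
  path, whether or not \<open>D\<close> jumps at \<open>\<tau>\<close>. The hypotheses on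
  \<open>Q\<close> concern fixed times only, and the grid formula takes the place of a strong Markov
  property and of a construction of the embedded chain. The condition \<open>z\<^sub>0 = 0\<close>
  costs nothing since the queue starts idle, and it absorbs a boundary effect of the grid at time 0.
  That jumps and completions never stop is proved from the same weights with all charges zero. The
  transform of the series is directly accessible only for large \<open>z\<close>, where a double
  geometric sum converges absolutely, and its terms have varying signs, so neither positivity nor
  total mass can be read off; the inter-phase time supplies both.\<close>

lemma measure_eqI_laplace_nat:
  fixes M N :: "real measure"
  assumes fin: "finite_measure M" "finite_measure N"
    and sets: "sets M = sets borel" "sets N = sets borel"
    and nonneg: "AE x in M. 0 \<le> x" "AE x in N. 0 \<le> x"
    and eq: "\<And>n::nat. (\<integral>x. exp (- real n * x) \<partial>M) = (\<integral>x. exp (- real n * x) \<partial>N)"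
  shows "M = N"
proof -
  \<comment> \<open>In the variable \<open>exp (- x)\<close> the integer Laplace points become the
    moments of a measure on the interval from 0 to 1, so Stone-Weierstrass leads from polynomials to
    continuous functions.\<close>
  have poly: "(\<integral>x. p (exp (- x)) \<partial>M) = (\<integral>x. p (exp (- x)) \<partial>N) \<and>
      integrable M (\<lambda>x. p (exp (- x))) \<and> integrable N (\<lambda>x. p (exp (- x)))"
    if "real_polynomial_function p" for p
  proof -
    from that obtain a n where p: "p = (\<lambda>x::real. \<Sum>i\<le>n. a i * x ^ i)"
      by (auto simp: real_polynomial_function_iff_sum)
    have e: "p (exp (- x)) = (\<Sum>i\<le>n. a i * exp (- real i * x))" for x
      by (simp add: p exp_of_nat_mult[symmetric])
    have int: "integrable K (\<lambda>x. exp (- real i * x))"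
      if "finite_measure K" "sets K = sets borel" "AE x in K. 0 \<le> x" for i and K :: "real measure"
    proof (rule finite_measure.integrable_const_bound[OF that(1)])
      show "AE x in K. norm (exp (- real i * x)) \<le> 1"
        using that(3) by eventually_elim simp
      show "(\<lambda>x. exp (- real i * x)) \<in> borel_measurable K"
        using that(2) by (simp cong: measurable_cong_sets)
    qed
    note intM = int[OF fin(1) sets(1) nonneg(1)] and intN = int[OF fin(2) sets(2) nonneg(2)]
    show ?thesis
      unfolding e using intM intN eq by (simp add: Bochner_Integration.integral_sum)
  qed
  have cont: "(\<integral>x. f (exp (- x)) \<partial>M) = (\<integral>x. f (exp (- x)) \<partial>N)"
    if f: "continuous_on UNIV f" "\<And>y. \<bar>f y\<bar> \<le> 1" for f :: "real \<Rightarrow> real"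
  proof -
    let ?I = "\<lambda>K. (\<integral>x. f (exp (- x)) \<partial>K)"
    have fm: "f \<in> borel_measurable borel" using f(1) by (rule borel_measurable_continuous_onI)
    have intf: "integrable K (\<lambda>x. f (exp (- x)))"
      if "finite_measure K" "sets K = sets borel" for K :: "real measure"
      using that f(2) fm
      by (intro finite_measure.integrable_const_bound[OF that(1), of _ 1])
         (auto cong: measurable_cong_sets)
    let ?C = "measure M (space M) + measure N (space N)"
    have bd: "\<bar>?I M - ?I N\<bar> \<le> e * ?C" if "e > 0" for e
    proof -
      obtain p where p: "real_polynomial_function p" "\<And>y. y \<in> {0..1} \<Longrightarrow> \<bar>f y - p y\<bar> < e"
        by (rule Stone_Weierstrass_real_polynomial_function[of "{0..1::real}" f e])
           (use f(1) \<open>e > 0\<close> in \<open>auto intro: continuous_on_subset\<close>)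
      have d: "\<bar>?I K - (\<integral>x. p (exp (- x)) \<partial>K)\<bar> \<le> e * measure K (space K)"
        if K: "finite_measure K" "sets K = sets borel" "AE x in K. 0 \<le> x"
          "integrable K (\<lambda>x. p (exp (- x)))" for K :: "real measure"
      proof -
        interpret finite_measure K by fact
        have "\<bar>?I K - (\<integral>x. p (exp (- x)) \<partial>K)\<bar> = norm (\<integral>x. f (exp (- x)) - p (exp (- x)) \<partial>K)"
          using intf[OF K(1,2)] K(4) by simp
        also have "\<dots> \<le> (\<integral>x. norm (f (exp (- x)) - p (exp (- x))) \<partial>K)"
          by (rule integral_norm_bound)
        also have "\<dots> \<le> (\<integral>x. e \<partial>K)"
          using intf[OF K(1,2)] K(3,4) p(2)
          by (intro integral_mono_AE) (auto elim!: eventually_mono intro!: less_imp_le)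
        finally show ?thesis by (simp add: mult.commute)
      qed
      show ?thesis
        using d[OF fin(1) sets(1) nonneg(1)] d[OF fin(2) sets(2) nonneg(2)] poly[OF p(1)]
        by (simp add: distrib_left)
    qed
    have "\<bar>?I M - ?I N\<bar> \<le> 0"
    proof (rule field_le_epsilon)
      fix e :: real assume "e > 0"
      have C: "?C \<ge> 0" by simp
      \<comment> \<open>The summand 1 in the denominator covers the case that both measures are
        zero.\<close>
      have "\<bar>?I M - ?I N\<bar> \<le> e / (?C + 1) * ?C" using bd[of "e / (?C + 1)"] \<open>e > 0\<close> C by simp
      also have "\<dots> \<le> e" using \<open>e > 0\<close> C
        by (subst times_divide_eq_left, subst pos_divide_le_eq) (use C in \<open>auto simp: algebra_simps add_pos_nonneg\<close>)
      finally show "\<bar>?I M - ?I N\<bar> \<le> 0 + e" by simp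
    qed
    then show ?thesis by simp
  qed
  have meas: "measure M {a<..} = measure N {a<..}" for a
  proof -
    \<comment> \<open>A continuous ramp in \<open>y = exp (- x)\<close> of slope
      \<open>- real n\<close>, ending at \<open>exp (- a)\<close>; it increases to the indicator of
      the half-line beyond \<open>a\<close>.\<close>
    define g where "g n y = min 1 (max 0 (real n * (exp (- a) - y)))" for n :: nat and y
    have g01: "0 \<le> g n y" "g n y \<le> 1" for n y by (auto simp: g_def)
    have gc: "continuous_on UNIV (g n)" for n
      unfolding g_def by (intro continuous_intros)
    have lim: "(\<lambda>n. g n (exp (- x))) \<longlonglongrightarrow> indicator {a<..} x" for x
    proof (cases "x > a")
      case True
      then have "exp (- a) - exp (- x) > 0" by simp
      then obtain n0 where n0: "real n0 * (exp (- a) - exp (- x)) > 1"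
        using reals_Archimedean3 by blast
      have "g n (exp (- x)) = 1" if "n \<ge> n0" for n
      proof -
        have "real n * (exp (- a) - exp (- x)) \<ge> real n0 * (exp (- a) - exp (- x))"
          using that \<open>exp (- a) - exp (- x) > 0\<close> by (intro mult_right_mono) auto
        with n0 show ?thesis by (simp add: g_def)
      qed
      then have "eventually (\<lambda>n. g n (exp (- x)) = 1) sequentially"
        using eventually_sequentially by blast
      with True show ?thesis by (simp add: tendsto_eventually)
    next
      case False
      then have "g n (exp (- x)) = 0" for n
        using mult_nonneg_nonpos[of "real n" "exp (- a) - exp (- x)"] by (simp add: g_def)
      with False show ?thesis by simp
    qed
    have L: "(\<lambda>n. \<integral>x. g n (exp (- x)) \<partial>K) \<longlonglongrightarrow> measure K {a<..}"
      if K: "finite_measure K" "sets K = sets borel" for K :: "real measure"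
    proof -
      interpret finite_measure K by fact
      have gm: "g n \<in> borel_measurable borel" for n
        using gc by (rule borel_measurable_continuous_onI)
      have "(\<lambda>n. \<integral>x. g n (exp (- x)) \<partial>K) \<longlonglongrightarrow> (\<integral>x. indicator {a<..} x \<partial>K)"
        using K(2) gm g01 lim
        by (intro integral_dominated_convergence[where w="\<lambda>_. 1"])
           (auto cong: measurable_cong_sets)
      then show ?thesis using K(2) by (simp add: sets_eq_imp_space_eq[OF K(2)])
    qed
    show ?thesis
      using L[OF fin(1) sets(1)] L[OF fin(2) sets(2)] cont[OF gc] g01
      by (intro LIMSEQ_unique[OF L[OF fin(1) sets(1)]]) (simp add: abs_of_nonneg)
  qed
  show ?thesis
  proof (rule measure_eqI_lessThan[OF sets])
    fix a show "emeasure M {a<..} < \<infinity>"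
      using finite_measure.emeasure_finite[OF fin(1)] by (simp add: top.not_eq_extremum)
    show "emeasure M {a<..} = emeasure N {a<..}"
      using meas by (simp add: finite_measure.emeasure_eq_measure[OF fin(1)]
        finite_measure.emeasure_eq_measure[OF fin(2)])
  qed
qed

text \<open>Weighting \<open>M\<close> by \<open>G\<close> and by the constant \<open>c\<close>
  gives two finite image measures of \<open>X\<close> with the same Laplace transform at the
  integers. They coincide, so the exponential in the hypothesis may be exchanged for an
  indicator.\<close>

lemma (in prob_space) expectation_indicator_laplace:
  fixes X G :: "'a \<Rightarrow> real"
  assumes X[measurable]: "X \<in> borel_measurable M" and X0: "AE x in M. 0 \<le> X x"
    and G[measurable]: "G \<in> borel_measurable M" and G0: "AE x in M. 0 \<le> G x \<and> G x \<le> 1"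
    and c: "0 \<le> c"
    and eq: "\<And>n::nat. expectation (\<lambda>x. exp (- real n * X x) * G x) = expectation (\<lambda>x. exp (- real n * X x)) * c"
    and A[measurable]: "A \<in> sets borel"
  shows "expectation (\<lambda>x. indicator A (X x) * G x) = expectation (\<lambda>x. indicator A (X x)) * c"
proof -
  define K where "K H = distr (density M (\<lambda>x. ennreal (H x))) borel X" for H :: "'a \<Rightarrow> real"
  have int: "(\<integral>x. f x \<partial>K H) = expectation (\<lambda>x. f (X x) * H x)"
    if [measurable]: "H \<in> borel_measurable M" "f \<in> borel_measurable borel" and "AE x in M. 0 \<le> H x"
    for H and f :: "real \<Rightarrow> real"
    unfolding K_def using that(3) by (simp add: integral_distr integral_real_density mult.commute)
  have fin: "finite_measure (K H)" if [measurable]: "H \<in> borel_measurable M" and "AE x in M. 0 \<le> H x \<and> H x \<le> C"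
    for H C
  proof (rule finite_measureI)
    have "emeasure (K H) (space (K H)) = (\<integral>\<^sup>+x. ennreal (H x) \<partial>M)"
      by (simp add: K_def emeasure_distr emeasure_density cong: nn_integral_cong)
    also have "\<dots> \<le> (\<integral>\<^sup>+x. ennreal C \<partial>M)"
    proof (rule nn_integral_mono_AE)
      show "AE x in M. ennreal (H x) \<le> ennreal C"
        using that(2) by eventually_elim (auto intro: ennreal_leI)
    qed
    also have "\<dots> < \<infinity>" by (simp add: emeasure_space_1)
    finally show "emeasure (K H) (space (K H)) \<noteq> \<infinity>" by simp
  qed
  have nn: "AE x in K H. 0 \<le> x" if [measurable]: "H \<in> borel_measurable M" for H
    unfolding K_def using X0 by (simp add: AE_distr_iff AE_density) (auto elim!: eventually_mono)
  have "K G = K (\<lambda>_. c)"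
  proof (rule measure_eqI_laplace_nat)
    show "finite_measure (K G)" "finite_measure (K (\<lambda>_. c))"
      using G0 c by (auto intro: fin[of G 1] fin[of "\<lambda>_. c" c])
    show "AE x in K G. 0 \<le> x" "AE x in K (\<lambda>_. c). 0 \<le> x" by (auto intro!: nn)
    fix n :: nat
    show "(\<integral>x. exp (- real n * x) \<partial>K G) = (\<integral>x. exp (- real n * x) \<partial>K (\<lambda>_. c))"
      using G0 c eq[of n] by (subst (1 2) int) (auto elim!: eventually_mono)
  qed (simp_all add: K_def)
  then have "(\<integral>x. indicator A x \<partial>K G) = (\<integral>x. indicator A x \<partial>K (\<lambda>_. c) :: real)" by simp
  then show ?thesis using G0 c by (subst (asm) (1 2) int) (auto elim!: eventually_mono)
qed

text \<open>Exponentials are exchanged for indicators one coordinate at a time. All other factors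
  form a weight with values in the unit interval, so uniqueness in one dimension suffices.\<close>

lemma (in prob_space) indep_vars_laplace:
  fixes X :: "nat \<Rightarrow> 'a \<Rightarrow> real"
  assumes X[measurable]: "\<And>j. X j \<in> borel_measurable M" and X0: "\<And>j. AE x in M. 0 \<le> X j x"
    and lap: "\<And>n z. (\<And>j. 0 \<le> z j) \<Longrightarrow> expectation (\<lambda>x. \<Prod>j<n. exp (- z j * X j x)) =
      (\<Prod>j<n. expectation (\<lambda>x. exp (- z j * X j x)))"
  shows "indep_vars (\<lambda>_. borel) X UNIV"
proof -
  have main: "expectation (\<lambda>x. \<Prod>j<n. indicator (A j) (X j x)) =
      (\<Prod>j<n. expectation (\<lambda>x. indicator (A j) (X j x) :: real))"
    if A[measurable]: "\<And>j. A j \<in> sets borel" for A :: "nat \<Rightarrow> real set" and n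
  proof -
    \<comment> \<open>Hybrid factors: the coordinates below \<open>r\<close> have already been
      exchanged.\<close>
    define f where "f z r j x = (if j < r then indicator (A j) (X j x) else exp (- z j * X j x))"
      for z :: "nat \<Rightarrow> real" and r j x
    have f_m[measurable]: "f z r j \<in> borel_measurable M" for z r j
      unfolding f_def by measurable
    have f01: "AE x in M. 0 \<le> f z r j x \<and> f z r j x \<le> 1" if "\<And>j. 0 \<le> z j" for z r j
      using X0[of j] by eventually_elim (use that in \<open>auto simp: f_def indicator_def\<close>)
    have "r \<le> n \<Longrightarrow> (\<And>j. 0 \<le> z j) \<Longrightarrow>
       expectation (\<lambda>x. \<Prod>j<n. f z r j x) = (\<Prod>j<n. expectation (f z r j))" for r z
    proof (induction r arbitrary: z)
      case 0
      then show ?case using lap[of z n] by (simp add: f_def)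
    next
      case (Suc r)
      have z0: "\<And>j. 0 \<le> z j" using Suc by auto
      let ?R = "{..<n} - {r}"
      define G where "G x = (\<Prod>j\<in>?R. f z (Suc r) j x)" for x
      have rem: "(\<Prod>j<n. h j) = h r * (\<Prod>j\<in>?R. h j)" for h :: "nat \<Rightarrow> real"
        using Suc.prems by (intro prod.remove) auto
      have fS: "f z (Suc r) r = (\<lambda>x. indicator (A r) (X r x))"
        by (simp add: f_def fun_eq_iff)
      have G01: "AE x in M. 0 \<le> G x \<and> G x \<le> 1"
      proof -
        have "AE x in M. \<forall>j\<in>?R. 0 \<le> f z (Suc r) j x \<and> f z (Suc r) j x \<le> 1"
          using f01[OF z0] by (intro AE_ball_countable') auto
        then show ?thesis
          by eventually_elim (auto simp: G_def intro!: prod_nonneg prod_le_1)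
      qed
      let ?c = "\<Prod>j\<in>?R. expectation (f z (Suc r) j)"
      have "expectation (\<lambda>x. indicator (A r) (X r x) * G x) = expectation (\<lambda>x. indicator (A r) (X r x)) * ?c"
      proof (rule expectation_indicator_laplace[OF X X0 _ G01 _ _ A])
        show "G \<in> borel_measurable M" unfolding G_def by measurable
        show "0 \<le> ?c"
          using f01[OF z0] by (intro prod_nonneg integral_nonneg_AE ballI) (auto elim!: eventually_mono)
        fix m :: nat
        \<comment> \<open>The induction hypothesis holds for every \<open>z\<close>; letting only
          its \<open>r\<close>-th entry run through the integers yields the transforms that
          determine the law of \<open>X r\<close>.\<close>
        let ?z = "z(r := real m)"
        have eqR: "f ?z r j = f z (Suc r) j" if "j \<noteq> r" for j
          using that by (auto simp: f_def fun_eq_iff)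
        have fr: "f ?z r r = (\<lambda>x. exp (- real m * X r x))"
          by (simp add: f_def fun_eq_iff)
        have "expectation (\<lambda>x. \<Prod>j<n. f ?z r j x) = (\<Prod>j<n. expectation (f ?z r j))"
          using Suc.prems by (intro Suc.IH) auto
        moreover have "(\<Prod>j<n. f ?z r j x) = exp (- real m * X r x) * G x" for x
          using rem[of "\<lambda>j. f ?z r j x"] by (simp add: G_def eqR fr)
        moreover have "(\<Prod>j<n. expectation (f ?z r j)) = expectation (\<lambda>x. exp (- real m * X r x)) * ?c"
          using rem[of "\<lambda>j. expectation (f ?z r j)"] by (simp add: eqR fr)
        ultimately show "expectation (\<lambda>x. exp (- real m * X r x) * G x) =
            expectation (\<lambda>x. exp (- real m * X r x)) * ?c" by simp
      qed
      moreover have "(\<Prod>j<n. f z (Suc r) j x) = indicator (A r) (X r x) * G x" for x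
        using rem[of "\<lambda>j. f z (Suc r) j x"] by (simp add: G_def fS)
      moreover have "(\<Prod>j<n. expectation (f z (Suc r) j)) = expectation (\<lambda>x. indicator (A r) (X r x)) * ?c"
        using rem[of "\<lambda>j. expectation (f z (Suc r) j)"] by (simp add: fS)
      ultimately show ?case by simp
    qed
    from this[of n "\<lambda>_. 0"]
    have "expectation (\<lambda>x. \<Prod>j<n. f (\<lambda>_. 0) n j x) = (\<Prod>j<n. expectation (f (\<lambda>_. 0) n j))" by simp
    moreover have "f (\<lambda>_. 0) n j = (\<lambda>x. indicator (A j) (X j x))" if "j < n" for j
      using that by (simp add: f_def fun_eq_iff)
    ultimately show ?thesis by simp
  qed
  have pr: "expectation (\<lambda>x. indicator B (X j x)) = prob (X j -` B \<inter> space M)" if [measurable]: "B \<in> sets borel" for B j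
  proof -
    have "expectation (\<lambda>x. indicator B (X j x)) = expectation (indicator (X j -` B \<inter> space M))"
      by (intro Bochner_Integration.integral_cong) (auto simp: indicator_def)
    also have "\<dots> = prob (X j -` B \<inter> space M)" by simp
    finally show ?thesis .
  qed
  show ?thesis
    unfolding indep_vars_def2
  proof (intro conjI ballI indep_setsI)
    fix J :: "nat set" and S
    assume J: "J \<noteq> {}" "finite J" and S: "\<forall>j\<in>J. S j \<in> {X j -` A \<inter> space M |A. A \<in> sets borel}"
    then have "\<forall>j\<in>J. \<exists>A. A \<in> sets borel \<and> S j = X j -` A \<inter> space M" by auto
    then obtain B where B: "\<And>j. j \<in> J \<Longrightarrow> B j \<in> sets borel \<and> S j = X j -` B j \<inter> space M"
      by metis
    \<comment> \<open>The choice \<open>UNIV\<close> outside \<open>J\<close> makes the surplus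
      factors equal to 1.\<close>
    define A where "A j = (if j \<in> J then B j else UNIV)" for j
    have A[measurable]: "A j \<in> sets borel" for j using B by (auto simp: A_def)
    obtain n where n: "J \<subseteq> {..<n}" using J finite_nat_iff_bounded by blast
    have "(\<Prod>j<n. expectation (\<lambda>x. indicator (A j) (X j x) :: real)) = (\<Prod>j\<in>J. prob (S j))"
      unfolding pr[OF A] using n B
      by (intro prod.mono_neutral_cong_right) (auto simp: A_def prob_space)
    moreover have "(\<Prod>j<n. indicator (A j) (X j x)) = (indicator (\<Inter>j\<in>J. S j) x :: real)" if "x \<in> space M" for x
    proof -
      have "(\<Prod>j<n. indicator (A j) (X j x)) = (\<Prod>j\<in>J. indicator (A j) (X j x) :: real)"
        using n by (intro prod.mono_neutral_right) (auto simp: A_def)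
      also have "\<dots> = (\<Prod>j\<in>J. indicator (S j) x)"
        using B that by (intro prod.cong) (auto simp: A_def indicator_def)
      also have "\<dots> = indicator (\<Inter>j\<in>J. S j) x"
        using J by (simp add: indicator_def prod_zero_iff)
      finally show ?thesis .
    qed
    then have "expectation (\<lambda>x. \<Prod>j<n. indicator (A j) (X j x)) = expectation (indicator (\<Inter>j\<in>J. S j) :: _ \<Rightarrow> real)"
      by (intro Bochner_Integration.integral_cong) auto
    moreover have "(\<Inter>j\<in>J. S j) \<in> sets M"
    proof (rule sets.finite_INT[OF J(2,1)])
      fix j assume "j \<in> J"
      then have [measurable]: "B j \<in> sets borel" and "S j = X j -` B j \<inter> space M" using B by auto
      then show "S j \<in> sets M" by simp
    qed
    ultimately show "prob (\<Inter>j\<in>J. S j) = (\<Prod>j\<in>J. prob (S j))"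
      using main[of A n, OF A] by simp
  qed auto
qed

section \<open>The inter-phase density\<close>

lemma Gamma_nn_integral_laplace:
  fixes s z :: real
  assumes "s > 0" "z > 0"
  shows "(\<integral>\<^sup>+t. ennreal (indicator {0<..} t * (t powr (s - 1) * exp (- z * t))) \<partial>lborel) = ennreal (Gamma s / z powr s)"
proof -
  let ?f = "\<lambda>t::real. indicator {0<..} t * (t powr (s - 1) * exp (- t))"
  have "(\<integral>\<^sup>+t. ennreal (indicator {0..} t * (t powr (s - 1) / exp t)) \<partial>lborel) = ennreal (Gamma s)"
    using nn_integral_has_integral_lebesgue[OF _ Gamma_integral_real[OF \<open>s > 0\<close>]] by simp
  moreover have "(\<integral>\<^sup>+t. ennreal (indicator {0..} t * (t powr (s - 1) / exp t)) \<partial>lborel) = (\<integral>\<^sup>+t. ennreal (?f t) \<partial>lborel)"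
    by (intro nn_integral_cong) (auto simp: indicator_def exp_minus divide_simps)
  ultimately have G: "(\<integral>\<^sup>+t. ennreal (?f t) \<partial>lborel) = ennreal (Gamma s)" by simp
  have "ennreal (Gamma s) = ennreal z * (\<integral>\<^sup>+t. ennreal (?f (0 + z * t)) \<partial>lborel)"
    unfolding G[symmetric] using assms by (subst nn_integral_real_affine[where c=z and t=0]) auto
  also have "\<dots> = ennreal z * (\<integral>\<^sup>+t. ennreal (z powr (s - 1)) * ennreal (indicator {0<..} t * (t powr (s - 1) * exp (- z * t))) \<partial>lborel)"
    using assms
    by (intro arg_cong[where f="\<lambda>x. ennreal z * x"] nn_integral_cong)
       (auto simp: indicator_def powr_mult zero_less_mult_iff ennreal_mult[symmetric])
  also have "\<dots> = ennreal (z powr s) * (\<integral>\<^sup>+t. ennreal (indicator {0<..} t * (t powr (s - 1) * exp (- z * t))) \<partial>lborel)"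
    using assms by (subst nn_integral_cmult) (auto simp: mult.assoc[symmetric] ennreal_mult[symmetric] powr_mult_base)
  finally have "ennreal (1 / z powr s) * ennreal (Gamma s) = ennreal (1 / z powr s) * ennreal (z powr s) * (\<integral>\<^sup>+t. ennreal (indicator {0<..} t * (t powr (s - 1) * exp (- z * t))) \<partial>lborel)"
    by (simp add: mult.assoc)
  then show ?thesis using assms by (simp add: ennreal_mult[symmetric])
qed

lemma integral_powr_exp:
  fixes s z :: real
  assumes "s > 0" "z > 0"
  shows "integrable lborel (\<lambda>t. indicator {0<..} t * (t powr (s - 1) * exp (- z * t)))"
    and "(\<integral>t. indicator {0<..} t * (t powr (s - 1) * exp (- z * t)) \<partial>lborel) = Gamma s / z powr s"
proof -
  note G = Gamma_nn_integral_laplace[OF assms(1) assms(2)]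
  show "integrable lborel (\<lambda>t. indicator {0<..} t * (t powr (s - 1) * exp (- z * t)))"
    by (rule integrableI_nonneg) (use G in \<open>auto simp: less_top[symmetric]\<close>)
  show "(\<integral>t. indicator {0<..} t * (t powr (s - 1) * exp (- z * t)) \<partial>lborel) = Gamma s / z powr s"
    by (subst integral_eq_nn_integral)
       (use G Gamma_real_pos[OF assms(1)] in auto)
qed

text \<open>The Gamma integral over an interval of length 1 already gives
  \<open>Gamma (s + 1) \<ge> y powr s * exp (- (y + 1))\<close>. In the resulting bound
  \<open>s\<close> occurs only as an exponent of the free parameter \<open>w\<close>, so the double
  series at any \<open>t\<close> is dominated by a geometric one at a large
  \<open>w\<close>.\<close>

lemma powr_div_Gamma_le:
  assumes s: "s > 0" and t: "t > (0::real)" and w: "w > 0"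
  shows "t powr (s - 1) / Gamma s \<le> exp (exp 1 * w * t + 1) / t * w powr (- s)"
proof -
  \<comment> \<open>The factor \<open>exp 1\<close> contributes \<open>exp s\<close>, which absorbs
    the factor \<open>s\<close> from \<open>Gamma (s + 1) = s * Gamma s\<close>.\<close>
  define y where "y = exp 1 * w * t"
  have y: "y > 0" using t w by (simp add: y_def)
  have Gp: "Gamma (s + 1) = s * Gamma s"
    using s by (intro Gamma_plus1) (auto elim!: nonpos_Ints_cases)
  have "ennreal (y powr s * exp (- (y + 1))) = (\<integral>\<^sup>+x. ennreal (y powr s * exp (- (y + 1))) * indicator {y..y+1} x \<partial>lborel)"
    by (simp add: nn_integral_cmult_indicator)
  also have "\<dots> \<le> (\<integral>\<^sup>+x. ennreal (indicator {0<..} x * (x powr (s + 1 - 1) * exp (- 1 * x))) \<partial>lborel)"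
    using y s by (intro nn_integral_mono) (auto simp: indicator_def intro!: ennreal_leI mult_mono powr_mono2)
  also have "\<dots> = ennreal (Gamma (s + 1))"
    using Gamma_nn_integral_laplace[of "s + 1" 1] s by simp
  finally have "y powr s * exp (- (y + 1)) \<le> s * Gamma s"
    using s Gamma_real_pos[of "s + 1"] Gp by (subst (asm) ennreal_le_iff) auto
  then have "y powr s / Gamma s \<le> s * exp (y + 1)"
    using Gamma_real_pos[OF s] by (simp add: exp_minus exp_diff exp_add divide_simps mult_ac)
  also have "\<dots> \<le> exp 1 powr s * exp (y + 1)"
    using exp_ge_add_one_self[of s] by (intro mult_right_mono) (auto simp: exp_powr_real intro: order_trans[OF _ exp_ge_add_one_self])
  also have "y powr s = exp 1 powr s * (w powr s * (t * t powr (s - 1)))"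
    using t w by (simp add: y_def powr_mult powr_mult_base)
  finally have "w powr s * (t * t powr (s - 1)) / Gamma s \<le> exp (y + 1)"
    by (simp add: divide_simps split: if_splits)
  then show ?thesis
    using t w Gamma_real_pos[OF s] by (simp add: y_def powr_minus divide_simps mult_ac)
qed

text \<open>Summed along the antidiagonals \<open>n + r = N\<close>, the binomial theorem gives
  \<open>(u + v) ^ N\<close>, and a geometric series remains.\<close>

lemma has_sum_binomial_powers:
  fixes u v :: real
  assumes uv: "\<bar>u\<bar> + \<bar>v\<bar> < 1"
  shows "((\<lambda>(r::nat, n::nat). real ((n + r) choose r) * u ^ r * v ^ n) has_sum (1 / (1 - (u + v)))) UNIV"
    and "(\<lambda>(r::nat, n::nat). real ((n + r) choose r) * \<bar>u\<bar> ^ r * \<bar>v\<bar> ^ n) summable_on UNIV"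
proof -
  let ?S = "Sigma UNIV (\<lambda>N::nat. {..N})"
  let ?h = "\<lambda>u v (N, r). real (N choose r) * u ^ r * v ^ (N - r) :: real"
  have inner: "((\<lambda>r. ?h u v (N, r)) has_sum ((u + v) ^ N)) {..N}" for u v N
    using has_sum_finite[of "{..N}" "\<lambda>r. ?h u v (N, r)"] by (simp add: binomial_ring)
  have geo: "((\<lambda>N. (u + v) ^ N) has_sum (1 / (1 - (u + v)))) UNIV" if "\<bar>u + v\<bar> < 1" for u v :: real
  proof -
    have "summable (\<lambda>N. norm ((u + v) ^ N))" using that by (simp add: power_abs summable_geometric)
    then show ?thesis
      using geometric_sums[of "u + v"] that by (intro norm_summable_imp_has_sum) auto
  qed
  have abs: "?h \<bar>u\<bar> \<bar>v\<bar> summable_on ?S"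
    using inner[where u="\<bar>u\<bar>" and v="\<bar>v\<bar>"] geo[of "\<bar>u\<bar>" "\<bar>v\<bar>"] uv
    by (intro summable_on_SigmaI[where g="\<lambda>N. (\<bar>u\<bar> + \<bar>v\<bar>) ^ N"]) (auto simp: summable_on_def)
  have "(\<lambda>x. norm (?h u v x)) summable_on ?S"
    using abs by (rule summable_on_cong[THEN iffD1, rotated]) (auto simp: abs_mult power_abs)
  then have "?h u v summable_on ?S" by (rule abs_summable_summable)
  then have S: "(?h u v has_sum (1 / (1 - (u + v)))) ?S"
    using geo[of u v] uv by (intro has_sum_SigmaI[OF inner]) auto
  have bij: "bij_betw (\<lambda>(r::nat, n). (n + r, r)) UNIV ?S"
    by (rule bij_betwI[where g="\<lambda>(N, r). (r, N - r)"]) auto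
  have e: "(\<lambda>(r::nat, n::nat). real ((n + r) choose r) * u ^ r * v ^ n) = (\<lambda>x. ?h u v ((\<lambda>(r, n). (n + r, r)) x))" for u v
    by auto
  show "((\<lambda>(r::nat, n::nat). real ((n + r) choose r) * u ^ r * v ^ n) has_sum (1 / (1 - (u + v)))) UNIV"
    unfolding e by (rule iffD2[OF has_sum_reindex_bij_betw[OF bij, of "?h u v"] S])
  show "(\<lambda>(r::nat, n::nat). real ((n + r) choose r) * \<bar>u\<bar> ^ r * \<bar>v\<bar> ^ n) summable_on UNIV"
    unfolding e by (rule iffD2[OF summable_on_reindex_bij_betw[OF bij, of "?h \<bar>u\<bar> \<bar>v\<bar>"] abs])
qed

section \<open>The double Mittag-Leffler series and its Laplace transform\<close>

context
  fixes a b A B :: real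
  assumes a: "a > 0" and b: "b > 0" and A: "A \<ge> 0" and B: "B > 0"
begin

definition "ml_exponent r n = a + b * real r + a * real (n::nat)"

text \<open>The term with outer index \<open>r\<close> and inner index \<open>n\<close> once every
  Mittag-Leffler function in the density is expanded; the factor \<open>t powr (a1 - 1)\<close> is
  included, the constant in front is not. Since \<open>t powr (s - 1) / Gamma s\<close> has
  transform \<open>z powr (- s)\<close>, each term transforms into a binomial coefficient times
  powers of \<open>- A * z powr (- b)\<close> and \<open>- B * z powr (- a)\<close>.\<close>

definition ml_term :: "real \<Rightarrow> nat \<times> nat \<Rightarrow> real" where
  "ml_term t = (\<lambda>(r, n). (- A) ^ r * (- B) ^ n * real ((n + r) choose r) *
     (t powr (ml_exponent r n - 1) / Gamma (ml_exponent r n)))"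

definition "ml_sum t = (\<Sum>\<^sub>\<infinity>p. ml_term t p)"

lemma ml_exponent_pos: "ml_exponent r n > 0"
  using a b by (auto simp: ml_exponent_def intro!: add_pos_nonneg)

lemma powr_ml_exponent:
  assumes "w > 0"
  shows "w powr (- ml_exponent r n) = w powr (- a) * (w powr (- b)) ^ r * (w powr (- a)) ^ n"
  using assms by (simp add: ml_exponent_def powr_realpow[symmetric] powr_powr powr_add[symmetric] algebra_simps)

text \<open>Both exponents are negative, so beyond some threshold every point lies in the region
  where the double geometric sum converges absolutely. Later identities for transforms of the series
  start from such points.\<close>

lemma ml_ratio_small: "eventually (\<lambda>w. A * w powr (- b) + B * w powr (- a) < 1) at_top"
proof -
  have "((\<lambda>w. A * w powr (- b) + B * w powr (- a)) \<longlongrightarrow> A * 0 + B * 0) at_top"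
    using a b by (intro tendsto_intros tendsto_neg_powr) (auto simp: filterlim_ident)
  then show ?thesis by (simp add: order_tendstoD)
qed

lemma ml_bound_summable:
  assumes w: "w > 0" "A * w powr (- b) + B * w powr (- a) < 1"
  shows "(\<lambda>(r::nat, n::nat). A ^ r * B ^ n * real ((n + r) choose r) * w powr (- ml_exponent r n)) summable_on UNIV"
proof -
  have "(\<lambda>p. w powr (- a) * (case p of (r, n) \<Rightarrow> real ((n + r) choose r) * \<bar>A * w powr (- b)\<bar> ^ r * \<bar>B * w powr (- a)\<bar> ^ n)) summable_on UNIV"
    using w A B by (intro summable_on_cmult_right has_sum_binomial_powers(2)) (auto simp: abs_mult)
  then show ?thesis
    by (rule summable_on_cong[THEN iffD1, rotated])
       (use w A B in \<open>auto simp: powr_ml_exponent abs_mult power_mult_distrib\<close>)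
qed

text \<open>The comparison point \<open>w\<close> is independent of \<open>t\<close>: all dependence
  on the indices sits in a family that is summable for large \<open>w\<close>, and the remaining
  factor is locally bounded in \<open>t\<close>.\<close>

lemma ml_term_bound:
  assumes w: "w > 0" and t: "t > 0"
  shows "\<bar>ml_term t (r, n)\<bar> \<le> exp (exp 1 * w * t + 1) / t *
     (A ^ r * B ^ n * real ((n + r) choose r) * w powr (- ml_exponent r n))"
proof -
  have "\<bar>ml_term t (r, n)\<bar> = A ^ r * B ^ n * real ((n + r) choose r) * (t powr (ml_exponent r n - 1) / Gamma (ml_exponent r n))"
    using A B Gamma_real_pos[OF ml_exponent_pos, of r n] by (simp add: ml_term_def abs_mult power_abs)
  also have "\<dots> \<le> A ^ r * B ^ n * real ((n + r) choose r) *
      (exp (exp 1 * w * t + 1) / t * w powr (- ml_exponent r n))"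
    using A B powr_div_Gamma_le[OF ml_exponent_pos t w] by (intro mult_left_mono) auto
  finally show ?thesis by (simp add: mult_ac)
qed

lemma ml_term_abs_summable:
  assumes t: "t > 0"
  shows "(\<lambda>p. norm (ml_term t p)) summable_on UNIV"
proof -
  obtain w where w: "w > 0" "A * w powr (- b) + B * w powr (- a) < 1"
    using eventually_happens[OF eventually_conj[OF ml_ratio_small eventually_gt_at_top[of 0]]] by auto
  have "(\<lambda>p. exp (exp 1 * w * t + 1) / t * (case p of (r, n) \<Rightarrow> A ^ r * B ^ n * real ((n + r) choose r) * w powr (- ml_exponent r n))) summable_on UNIV"
    by (intro summable_on_cmult_right ml_bound_summable w)
  then show ?thesis
    by (rule summable_on_comparison_test) (use ml_term_bound[OF w(1) t] in auto)
qed

lemma continuous_on_ml_sum: "continuous_on {0<..} ml_sum"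
proof -
  obtain w where w: "w > 0" "A * w powr (- b) + B * w powr (- a) < 1"
    using eventually_happens[OF eventually_conj[OF ml_ratio_small eventually_gt_at_top[of 0]]] by auto
  have "continuous_on {x<..<y} ml_sum" if "x > 0" for x y
    unfolding ml_sum_def
  proof (rule uniform_limit_theorem)
    \<comment> \<open>The bound at \<open>t\<close> made uniform on the interval: the exponential is
      largest at the right end and \<open>1 / t\<close> at the left end.\<close>
    let ?M = "\<lambda>(r::nat, n::nat). exp (exp 1 * w * y + 1) / x * (A ^ r * B ^ n * real ((n + r) choose r) * w powr (- ml_exponent r n))"
    show "uniform_limit {x<..<y} (\<lambda>X t. \<Sum>p\<in>X. ml_term t p) (\<lambda>t. \<Sum>\<^sub>\<infinity>p. ml_term t p) (finite_subsets_at_top UNIV)"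
    proof (rule Weierstrass_m_test_general)
      show "?M summable_on UNIV"
        using summable_on_cmult_right[OF ml_bound_summable[OF w], of "exp (exp 1 * w * y + 1) / x"]
        by (simp add: case_prod_unfold)
      fix p :: "nat \<times> nat" and t assume t: "t \<in> {x<..<y}"
      obtain r n where p: "p = (r, n)" by fastforce
      have "\<bar>ml_term t (r, n)\<bar> \<le> exp (exp 1 * w * t + 1) / t *
        (A ^ r * B ^ n * real ((n + r) choose r) * w powr (- ml_exponent r n))"
        using ml_term_bound[OF w(1)] t \<open>x > 0\<close> by auto
      also have "\<dots> \<le> exp (exp 1 * w * y + 1) / x *
        (A ^ r * B ^ n * real ((n + r) choose r) * w powr (- ml_exponent r n))"
        using t \<open>x > 0\<close> w(1) A B by (intro mult_right_mono frac_le) auto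
      finally show "norm (ml_term t p) \<le> ?M p" by (simp add: p)
    qed
    show "\<forall>\<^sub>F X in finite_subsets_at_top UNIV. continuous_on {x<..<y} (\<lambda>t. \<Sum>p\<in>X. ml_term t p)"
    proof (intro always_eventually allI continuous_on_sum)
      fix p :: "nat \<times> nat"
      obtain r n where p: "p = (r, n)" by fastforce
      show "continuous_on {x<..<y} (\<lambda>t. ml_term t p)"
        unfolding p ml_term_def using \<open>x > 0\<close> Gamma_real_pos[OF ml_exponent_pos, of r n]
        by (auto intro!: continuous_intros)
    qed
  qed simp
  note c = this
  show ?thesis
  proof (rule continuous_at_imp_continuous_on, rule ballI)
    fix t :: real assume "t \<in> {0<..}"
    then have "continuous_on {t/2<..<t+1} ml_sum" "t \<in> {t/2<..<t+1}" using c[of "t/2"] by auto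
    then show "isCont ml_sum t" using continuous_on_eq_continuous_at open_greaterThanLessThan by blast
  qed
qed

text \<open>The integrals of the absolute values of the terms are summable precisely because of the
  smallness condition on \<open>z\<close>; this licenses termwise integration, and the transformed
  terms form the binomial double sum.\<close>

lemma ml_sum_laplace:
  assumes z: "z > 0" "A * z powr (- b) + B * z powr (- a) < 1"
  shows "integrable lborel (\<lambda>t. indicator {0<..} t * (exp (- z * t) * ml_sum t))"
    and "(\<integral>t. indicator {0<..} t * (exp (- z * t) * ml_sum t) \<partial>lborel) =
      z powr (- a) / (1 + A * z powr (- b) + B * z powr (- a))"
proof -
  define c where "c = (\<lambda>(r, n). (- A) ^ r * (- B) ^ n * real ((n + r) choose r))"
  \<comment> \<open>The pairs of indices are enumerated by \<open>prod_decode\<close>, since sum and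
    integral are interchanged for a sequence of functions.\<close>
  define h where "h m t = indicator {0<..} t * (exp (- z * t) * ml_term t (prod_decode m))" for m and t :: real
  have bij: "bij_betw prod_decode UNIV UNIV" by (rule bij_prod_decode)
  let ?s = "\<lambda>(r::nat, n::nat). ml_exponent r n"
  have s0: "?s p > 0" for p by (cases p) (auto simp: ml_exponent_pos)
  have h: "h m = (\<lambda>t. c (prod_decode m) / Gamma (?s (prod_decode m)) *
      (indicator {0<..} t * (t powr (?s (prod_decode m) - 1) * exp (- z * t))))" for m
    by (auto simp: h_def ml_term_def c_def fun_eq_iff split: prod.split)
  have int: "integrable lborel (h m)" for m
    unfolding h by (intro integrable_mult_right integral_powr_exp s0 z)
  have hI: "(\<integral>t. h m t \<partial>lborel) = c (prod_decode m) * z powr (- ?s (prod_decode m))" for m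
    unfolding h using Gamma_real_pos[OF s0, of "prod_decode m"]
    by (subst integral_mult_right_zero, subst integral_powr_exp[OF s0 z(1)]) (simp add: powr_minus divide_simps)
  have hN: "(\<integral>t. norm (h m t) \<partial>lborel) = \<bar>c (prod_decode m)\<bar> * z powr (- ?s (prod_decode m))" for m
  proof -
    have "(\<integral>t. norm (h m t) \<partial>lborel) = (\<integral>t. \<bar>c (prod_decode m)\<bar> / Gamma (?s (prod_decode m)) *
      (indicator {0<..} t * (t powr (?s (prod_decode m) - 1) * exp (- z * t))) \<partial>lborel)"
      unfolding h using Gamma_real_pos[OF s0, of "prod_decode m"]
      by (intro Bochner_Integration.integral_cong) (auto simp: abs_mult indicator_def)
    then show ?thesis using Gamma_real_pos[OF s0, of "prod_decode m"]
      by (subst (asm) integral_mult_right_zero, subst (asm) integral_powr_exp[OF s0 z(1)]) (simp add: powr_minus divide_simps)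
  qed
  have "(\<lambda>p. \<bar>c p\<bar> * z powr (- ?s p)) summable_on UNIV"
    using ml_bound_summable[OF z] by (rule summable_on_cong[THEN iffD1, rotated])
      (use A B in \<open>auto simp: c_def abs_mult power_abs\<close>)
  then have "(\<lambda>m. \<bar>c (prod_decode m)\<bar> * z powr (- ?s (prod_decode m))) summable_on UNIV"
    by (subst summable_on_reindex_bij_betw[OF bij])
  then have sumN: "summable (\<lambda>m. \<integral>t. norm (h m t) \<partial>lborel)"
    unfolding hN by (rule summable_on_imp_summable)
  have pt: "summable (\<lambda>m. norm (h m t)) \<and> (\<Sum>m. h m t) = indicator {0<..} t * (exp (- z * t) * ml_sum t)" for t
  proof (cases "t > 0")
    case False then show ?thesis by (simp add: h_def)
  next
    case True
    have "(\<lambda>m. norm (ml_term t (prod_decode m))) summable_on UNIV"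
      using ml_term_abs_summable[OF True] by (subst summable_on_reindex_bij_betw[OF bij, of "\<lambda>p. norm (ml_term t p)"])
    then have s: "summable (\<lambda>m. norm (ml_term t (prod_decode m)))"
      by (rule summable_on_imp_summable)
    have "((\<lambda>m. ml_term t (prod_decode m)) has_sum ml_sum t) UNIV"
      unfolding ml_sum_def using abs_summable_summable[OF ml_term_abs_summable[OF True]]
      by (subst has_sum_reindex_bij_betw[OF bij, of "ml_term t"]) simp
    then have "(\<lambda>m. ml_term t (prod_decode m)) sums ml_sum t" by (rule has_sum_imp_sums)
    then have "(\<lambda>m. exp (- z * t) * ml_term t (prod_decode m)) sums (exp (- z * t) * ml_sum t)" by (rule sums_mult)
    moreover have "summable (\<lambda>m. exp (- z * t) * norm (ml_term t (prod_decode m)))" using s by (rule summable_mult)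
    ultimately show ?thesis using True by (auto simp: h_def abs_mult sums_iff)
  qed
  have AEs: "AE t in lborel. summable (\<lambda>m. norm (h m t))" using pt by auto
  have eq: "(\<lambda>t. \<Sum>m. h m t) = (\<lambda>t. indicator {0<..} t * (exp (- z * t) * ml_sum t))" using pt by auto
  show "integrable lborel (\<lambda>t. indicator {0<..} t * (exp (- z * t) * ml_sum t))"
    using integrable_suminf[OF int AEs sumN] by (simp add: eq)
  let ?u = "- A * z powr (- b)" and ?v = "- B * z powr (- a)"
  have "((\<lambda>p. z powr (- a) * (case p of (r, n) \<Rightarrow> real ((n + r) choose r) * ?u ^ r * ?v ^ n)) has_sum
      (z powr (- a) * (1 / (1 - (?u + ?v))))) UNIV"
    using z A B by (intro has_sum_cmult_right has_sum_binomial_powers(1)) (auto simp: abs_mult)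
  then have "((\<lambda>p. c p * z powr (- ?s p)) has_sum (z powr (- a) * (1 / (1 - (?u + ?v))))) UNIV"
  proof (rule has_sum_cong[THEN iffD1, rotated])
    fix p :: "nat \<times> nat"
    obtain r n where p: "p = (r, n)" by fastforce
    show "z powr (- a) * (case p of (r, n) \<Rightarrow> real ((n + r) choose r) * ?u ^ r * ?v ^ n) = c p * z powr (- ?s p)"
      by (simp only: p c_def prod.case powr_ml_exponent[OF z(1)] power_mult_distrib mult_ac)
  qed
  then have "((\<lambda>m. c (prod_decode m) * z powr (- ?s (prod_decode m))) has_sum (z powr (- a) * (1 / (1 - (?u + ?v))))) UNIV"
    by (subst has_sum_reindex_bij_betw[OF bij, of "\<lambda>p. c p * z powr (- ?s p)"])
  then have "(\<lambda>m. c (prod_decode m) * z powr (- ?s (prod_decode m))) sums (z powr (- a) * (1 / (1 - (?u + ?v))))"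
    by (rule has_sum_imp_sums)
  then have "(\<Sum>m. \<integral>t. h m t \<partial>lborel) = z powr (- a) / (1 + A * z powr (- b) + B * z powr (- a))"
    unfolding hI by (simp add: sums_iff add.assoc)
  then show "(\<integral>t. indicator {0<..} t * (exp (- z * t) * ml_sum t) \<partial>lborel) =
      z powr (- a) / (1 + A * z powr (- b) + B * z powr (- a))"
    using integral_suminf[OF int AEs sumN] by (simp add: eq)
qed

lemma ml_sum_inner_summable:
  assumes t: "t > 0"
  shows "summable (\<lambda>n. ml_term t (r, n))"
proof -
  have abs: "(\<lambda>(r, n). norm (ml_term t (r, n))) summable_on UNIV \<times> UNIV"
    using ml_term_abs_summable[OF t] by (simp add: case_prod_unfold)
  have "(\<lambda>n. norm (ml_term t (r, n))) summable_on UNIV"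
    using summable_on_SigmaD1[OF abs, of r] by simp
  then show ?thesis by (rule summable_on_imp_summable[OF abs_summable_summable])
qed

text \<open>Absolute summability turns the sum over pairs into the iterated series by which the
  density is defined.\<close>

lemma ml_sum_nested:
  assumes t: "t > 0"
  shows "(\<lambda>r. \<Sum>n. ml_term t (r, n)) sums ml_sum t"
proof -
  have abs: "(\<lambda>(r, n). norm (ml_term t (r, n))) summable_on UNIV \<times> UNIV"
    using ml_term_abs_summable[OF t] by (simp add: case_prod_unfold)
  have inner: "(\<lambda>n. norm (ml_term t (r, n))) summable_on UNIV" for r
    using summable_on_SigmaD1[OF abs, of r] by simp
  have in_eq: "(\<Sum>\<^sub>\<infinity>n. ml_term t (r, n)) = (\<Sum>n. ml_term t (r, n))" for r
    using has_sum_imp_sums[OF has_sum_infsum[OF abs_summable_summable[OF inner[of r]]]] by (simp add: sums_iff)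
  have "((\<lambda>r. \<Sum>\<^sub>\<infinity>n. ml_term t (r, n)) has_sum ml_sum t) UNIV"
  proof -
    have "(ml_term t has_sum ml_sum t) (UNIV \<times> UNIV)"
      unfolding ml_sum_def using abs_summable_summable[OF ml_term_abs_summable[OF t]] by simp
    then show ?thesis
      by (rule has_sum_SigmaD) (use abs_summable_summable[OF inner] in auto)
  qed
  then show ?thesis unfolding in_eq by (rule has_sum_imp_sums)
qed

end

lemma inter_phase_term_eq:
  assumes "t > 0" and "a2 < a1" "0 < a1" "0 < c1" "0 \<le> c2" "0 < real k * mu"
  shows "inter_phase_term a1 a2 c1 c2 mu k t r * t powr (a1 - 1) =
    (\<Sum>n. ml_term a1 (a1 - a2) (c2 / c1) (real k * mu / c1) t (r, n))"
proof -
  let ?B = "real k * mu / c1"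
  let ?s = "\<lambda>n. ml_exponent a1 (a1 - a2) r n"
  let ?c = "(- (c2 / c1)) ^ r * t powr ((a1 - a2) * real r) * t powr (a1 - 1)"
  have ab: "0 < a1" "0 < a1 - a2" "0 \<le> c2 / c1" "0 < ?B" using assms by auto
  have s: "?s n > 0" for n by (rule ml_exponent_pos[OF ab])
  have G: "Gamma (real r + 1 + real n) / (fact n * Gamma (real r + 1)) = real ((n + r) choose r)" for n
  proof -
    have "Gamma (real r + 1 + real n) = fact (n + r)" "Gamma (real r + 1) = fact r"
      using Gamma_fact[of "n + r", where 'a=real] Gamma_fact[of r, where 'a=real] by (simp_all add: add_ac)
    then show ?thesis by (simp add: binomial_fact add.commute[of n r])
  qed
  have e: "ml_term a1 (a1 - a2) (c2 / c1) ?B t (r, n) = ?c *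
     (Gamma (real r + 1 + real n) * (- (real k * mu * t powr a1 / c1)) ^ n /
       (fact n * Gamma (real r + 1) * Gamma (a1 * real n + (a1 + (a1 - a2) * real r))))" (is "?L = ?R") for n
  proof -
    have p: "t powr (?s n - 1) = t powr ((a1 - a2) * real r) * t powr (a1 - 1) * (t powr a1) ^ n"
      using assms by (simp add: ml_exponent_def[OF ab] powr_realpow[symmetric] powr_powr powr_add[symmetric] algebra_simps)
    have q: "(- (real k * mu * t powr a1 / c1)) ^ n = (- ?B) ^ n * (t powr a1) ^ n"
      by (simp add: power_mult_distrib[symmetric])
    have g: "Gamma (a1 * real n + (a1 + (a1 - a2) * real r)) = Gamma (?s n)"
      by (simp add: ml_exponent_def[OF ab] add_ac)
    have "?R = ?c * ((Gamma (real r + 1 + real n) / (fact n * Gamma (real r + 1))) * (- (real k * mu * t powr a1 / c1)) ^ n / Gamma (?s n))"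
      unfolding g by simp
    also have "\<dots> = ?L" unfolding G q ml_term_def[OF ab] prod.case p by (simp add: mult_ac)
    finally show ?thesis by simp
  qed
  show ?thesis
  \<comment> \<open>The prefactor vanishes when \<open>c2 = 0\<close> and \<open>r > 0\<close>. Then
    summability of the inner series cannot be obtained by cancelling it, but both sides are
    0.\<close>
  proof (cases "?c = 0")
    case True
    have "inter_phase_term a1 a2 c1 c2 mu k t r * t powr (a1 - 1) = ?c *
        mittag_leffler3 (real r + 1) a1 (a1 + (a1 - a2) * real r) (- (real k * mu * t powr a1 / c1))"
      by (simp only: inter_phase_term_def mult_ac)
    then show ?thesis unfolding e True by simp
  next
    case False
    have "summable (\<lambda>n. ml_term a1 (a1 - a2) (c2 / c1) ?B t (r, n))"
      by (rule ml_sum_inner_summable[OF ab assms(1)])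
    then have "summable (\<lambda>n. Gamma (real r + 1 + real n) * (- (real k * mu * t powr a1 / c1)) ^ n /
       (fact n * Gamma (real r + 1) * Gamma (a1 * real n + (a1 + (a1 - a2) * real r))))"
      unfolding e by (rule summable_mult_D[OF _ False])
    from suminf_mult[OF this, of ?c]
    show ?thesis unfolding e mittag_leffler3_def inter_phase_term_def by (simp only: mult_ac)
  qed
qed

section \<open>The inter-phase density as a multiple of the double series\<close>

context
  fixes a1 a2 c1 c2 mu :: real and k :: nat
  assumes a: "a2 < a1" "0 < a1" and c: "0 < c1" "0 \<le> c2" and mu: "0 < mu" and k: "k \<ge> 1"
begin

lemma inter_phase_ab: "0 < a1" "0 < a1 - a2" "0 \<le> c2 / c1" "0 < real k * mu / c1"
  using a c mu k by auto

lemma inter_phase_term_sums: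
  assumes "t > 0"
  shows "inter_phase_term a1 a2 c1 c2 mu k t sums
    (t powr (1 - a1) * ml_sum a1 (a1 - a2) (c2 / c1) (real k * mu / c1) t)"
proof -
  have "0 < real k * mu" using mu k by simp
  note e = inter_phase_term_eq[OF assms a(1,2) c this]
  have "(\<lambda>r. inter_phase_term a1 a2 c1 c2 mu k t r * t powr (a1 - 1)) sums
      ml_sum a1 (a1 - a2) (c2 / c1) (real k * mu / c1) t"
    unfolding e by (rule ml_sum_nested[OF inter_phase_ab assms])
  then have "(\<lambda>r. t powr (1 - a1) * (inter_phase_term a1 a2 c1 c2 mu k t r * t powr (a1 - 1))) sums
      (t powr (1 - a1) * ml_sum a1 (a1 - a2) (c2 / c1) (real k * mu / c1) t)"
    by (rule sums_mult)
  moreover have "t powr (1 - a1) * (x * t powr (a1 - 1)) = x" for x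
  proof -
    have "t powr (1 - a1) * (x * t powr (a1 - 1)) = x * (t powr (1 - a1) * t powr (a1 - 1))" by simp
    also have "\<dots> = x" using assms by (simp only: powr_add[symmetric]) simp
    finally show ?thesis .
  qed
  ultimately show ?thesis by simp
qed

lemma inter_phase_term_summable: "t > 0 \<Longrightarrow> summable (inter_phase_term a1 a2 c1 c2 mu k t)"
  using inter_phase_term_sums by (rule sums_summable)

lemma inter_phase_density_eq:
  "inter_phase_density a1 a2 c1 c2 mu k t =
     (if t > 0 then real k * mu / c1 * ml_sum a1 (a1 - a2) (c2 / c1) (real k * mu / c1) t else 0)"
  using inter_phase_term_sums[of t]
  by (auto simp: inter_phase_density_def sums_iff mult.assoc[symmetric])
     (auto simp: mult.assoc powr_add[symmetric])

lemma continuous_on_inter_phase_density: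
  "continuous_on {0<..} (inter_phase_density a1 a2 c1 c2 mu k)"
proof -
  have "continuous_on {0<..} (\<lambda>t. real k * mu / c1 * ml_sum a1 (a1 - a2) (c2 / c1) (real k * mu / c1) t)"
    by (intro continuous_intros continuous_on_ml_sum inter_phase_ab)
  then show ?thesis
    by (rule continuous_on_eq) (auto simp: inter_phase_density_eq)
qed

lemma borel_measurable_inter_phase_density[measurable]:
  "inter_phase_density a1 a2 c1 c2 mu k \<in> borel_measurable borel"
proof -
  have "inter_phase_density a1 a2 c1 c2 mu k = (\<lambda>t. if t \<in> {0<..} then inter_phase_density a1 a2 c1 c2 mu k t else 0)"
    by (auto simp: inter_phase_density_eq)
  also have "\<dots> \<in> borel_measurable borel"
    by (intro borel_measurable_continuous_on_if continuous_on_inter_phase_density) auto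
  finally show ?thesis .
qed

text \<open>The transform of the double series, with numerator and denominator multiplied by
  \<open>c1 * z powr a1\<close>. The threshold on \<open>z\<close> is the one for absolute
  convergence and is removed only after the density is known to belong to a random variable.\<close>

lemma inter_phase_density_laplace_eventually:
  "eventually (\<lambda>z. integrable lborel (\<lambda>t. exp (- z * t) * inter_phase_density a1 a2 c1 c2 mu k t) \<and>
     (\<integral>t. exp (- z * t) * inter_phase_density a1 a2 c1 c2 mu k t \<partial>lborel) =
       real k * mu / (real k * mu + c1 * z powr a1 + c2 * z powr a2)) at_top"
  using ml_ratio_small[OF inter_phase_ab] eventually_gt_at_top[of 0]
proof eventually_elim
  case (elim z)
  let ?ml = "ml_sum a1 (a1 - a2) (c2 / c1) (real k * mu / c1)"
  note L = ml_sum_laplace[OF inter_phase_ab elim(2,1)]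
  have e: "exp (- z * t) * inter_phase_density a1 a2 c1 c2 mu k t =
     real k * mu / c1 * (indicator {0<..} t * (exp (- z * t) * ?ml t))" for t
    by (simp add: inter_phase_density_eq indicator_def)
  have p: "z powr (- (a1 - a2)) = z powr a2 / z powr a1" "z powr (- a1) = 1 / z powr a1"
    using elim(2) by (simp_all add: powr_diff[symmetric] powr_minus divide_simps)
  have "real k * mu / c1 * (z powr (- a1) / (1 + c2 / c1 * z powr (- (a1 - a2)) + real k * mu / c1 * z powr (- a1))) =
     real k * mu / (real k * mu + c1 * z powr a1 + c2 * z powr a2)"
  proof -
    have d: "c1 * z powr a1 > 0" "c1 * z powr a1 \<noteq> 0" "z powr a1 \<noteq> 0" using c elim(2) by auto
    have "1 + c2 / c1 * z powr (- (a1 - a2)) + real k * mu / c1 * z powr (- a1) =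
       (real k * mu + c1 * z powr a1 + c2 * z powr a2) / (c1 * z powr a1)"
      using d unfolding p by (simp add: field_simps)
    then show ?thesis using d c unfolding p by simp
  qed
  then show ?case
    unfolding e integral_mult_right_zero L(2) using integrable_mult_right[OF L(1)] by blast
qed

end

section \<open>Densities from Laplace transforms\<close>

text \<open>An identity for a function of unknown sign is balanced by moving its negative part to
  the other side, so that both sides stay measures.\<close>

definition add_measure :: "'a measure \<Rightarrow> 'a measure \<Rightarrow> 'a measure" where
  "add_measure M N = measure_of (space M) (sets M) (\<lambda>A. emeasure M A + emeasure N A)"

lemma space_add_measure[simp]: "space (add_measure M N) = space M"
  and sets_add_measure[simp, measurable_cong]: "sets (add_measure M N) = sets M"
  by (simp_all add: add_measure_def)

lemma emeasure_add_measure: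
  assumes s: "sets N = sets M" and A: "A \<in> sets M"
  shows "emeasure (add_measure M N) A = emeasure M A + emeasure N A"
  unfolding add_measure_def
proof (rule emeasure_measure_of_sigma)
  show "sigma_algebra (space M) (sets M)" by (rule sets.sigma_algebra_axioms)
  show "positive (sets M) (\<lambda>A. emeasure M A + emeasure N A)" by (simp add: positive_def)
  show "countably_additive (sets M) (\<lambda>A. emeasure M A + emeasure N A)"
    using s by (auto simp: countably_additive_def suminf_add[symmetric] suminf_emeasure)
qed fact

lemma nn_integral_add_measure:
  assumes s: "sets N = sets M" and f: "f \<in> borel_measurable M"
  shows "(\<integral>\<^sup>+x. f x \<partial>add_measure M N) = (\<integral>\<^sup>+x. f x \<partial>M) + (\<integral>\<^sup>+x. f x \<partial>N)"
proof -
  have m: "g \<in> borel_measurable N" "g \<in> borel_measurable (add_measure M N)"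
    if "g \<in> borel_measurable M" for g :: "'a \<Rightarrow> ennreal"
    using that s by (simp_all cong: measurable_cong_sets)
  show ?thesis
    using f
  proof (induction rule: borel_measurable_induct)
    case (cong f g)
    then show ?case using sets_eq_imp_space_eq[OF s]
      by (simp cong: nn_integral_cong_simp)
  next
    case (set A)
    then show ?case using s by (simp add: emeasure_add_measure)
  next
    case (mult u c)
    then show ?case using m[OF mult(2)] by (simp add: nn_integral_cmult distrib_left)
  next
    case (add u v)
    then show ?case using m[OF add(1)] m[OF add(3)] add by (simp add: nn_integral_add add_ac)
  next
    case (seq U)
    have U: "U i \<in> borel_measurable M" for i using seq by auto
    have "(\<integral>\<^sup>+x. Sup (range U) x \<partial>K) = (SUP i. \<integral>\<^sup>+x. U i x \<partial>K)" if "\<And>i. U i \<in> borel_measurable K" for K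
      using nn_integral_monotone_convergence_SUP[OF seq(3) that] by (simp add: SUP_apply image_comp)
    note S = this[OF U] this[OF m(1)[OF U]] this[OF m(2)[OF U]]
    have inc: "incseq (\<lambda>i. \<integral>\<^sup>+x. U i x \<partial>K)" for K
      using seq(3) by (auto simp: incseq_def le_fun_def intro!: nn_integral_mono)
    show ?case unfolding S by (simp add: seq.IH ennreal_SUP_add[OF inc inc])
  qed
qed

text \<open>By continuity the points of the open half-line where \<open>f\<close> is negative form
  an open set, and an open null set is empty.\<close>

lemma AE_nonneg_imp_nonneg:
  fixes f :: "real \<Rightarrow> real"
  assumes "AE t in lborel. 0 \<le> f t" and c: "continuous_on {0<..} f" and t: "t > 0"
  shows "0 \<le> f t"
proof (rule ccontr)
  assume "\<not> 0 \<le> f t"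
  have o: "open ({0<..} \<inter> f -` {..<0})"
    using c by (simp add: continuous_on_open_vimage Int_commute)
  have "negligible ({0<..} \<inter> f -` {..<0})"
  proof -
    have "AE t in lborel. t \<notin> {0<..} \<inter> f -` {..<0}"
      using assms(1) by eventually_elim auto
    then have "{0<..} \<inter> f -` {..<0} \<in> null_sets lborel"
      using o by (subst AE_iff_null_sets) auto
    then show ?thesis by (simp add: negligible_iff_null_sets null_sets_completionI)
  qed
  then have "{0<..} \<inter> f -` {..<0} = {}" using open_not_negligible[OF o] by blast
  then show False using t \<open>\<not> 0 \<le> f t\<close> by auto
qed

lemma density_exp_inverse:
  fixes M :: "real measure"
  assumes "sets M = sets borel" and [measurable]: "f \<in> borel_measurable borel"
  shows "density (density M (\<lambda>x. ennreal (exp (- w * x)) * f x)) (\<lambda>x. ennreal (exp (w * x))) = density M f"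
proof -
  have [measurable_cong]: "sets M = sets borel" by fact
  have "ennreal (exp (- w * x)) * f x * ennreal (exp (w * x)) = f x" for x
  proof -
    have "ennreal (exp (- w * x)) * f x * ennreal (exp (w * x)) = f x * ennreal (exp (- w * x) * exp (w * x))"
      by (simp add: ennreal_mult' mult_ac)
    also have "exp (- w * x) * exp (w * x) = 1" by (simp add: exp_minus)
    finally show ?thesis by simp
  qed
  then show ?thesis by (subst density_density_eq) auto
qed

text \<open>Transforms are given only at the points \<open>w + n\<close>. Tilting both measures by
  \<open>exp (- w * x)\<close> moves these points to the integers and makes the measure with density
  \<open>f\<close> finite; multiplication by \<open>exp (w * x)\<close> then undoes the
  tilt.\<close>

lemma (in prob_space) distributed_laplaceI:
  fixes X :: "'a \<Rightarrow> real" and f :: "real \<Rightarrow> real"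
  assumes X[measurable]: "X \<in> borel_measurable M" and X0: "AE x in M. 0 \<le> X x"
    and f[measurable]: "f \<in> borel_measurable borel" and f0: "\<And>t. 0 \<le> f t" "\<And>t. t \<le> 0 \<Longrightarrow> f t = 0"
    and w: "w \<ge> 0"
    and lap: "\<And>n::nat. (\<integral>\<^sup>+t. ennreal (exp (- (w + real n) * t) * f t) \<partial>lborel) =
        ennreal (expectation (\<lambda>x. exp (- (w + real n) * X x)))"
  shows "distributed M lborel X (\<lambda>t. ennreal (f t))"
proof -
  let ?D = "distr M borel X"
  let ?K1 = "density ?D (\<lambda>x. ennreal (exp (- w * x)) * 1)"
  let ?K2 = "density lborel (\<lambda>x. ennreal (exp (- w * x)) * ennreal (f x))"
  have i1: "integrable M (\<lambda>x. exp (- (w + real n) * X x))" for n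
    using X0 w by (intro integrable_const_bound[where B=1]) (auto elim!: eventually_mono intro!: mult_nonpos_nonneg)
  have n2: "(\<integral>\<^sup>+t. ennreal (exp (- real n * t)) \<partial>?K2) = ennreal (expectation (\<lambda>x. exp (- (w + real n) * X x)))" for n
    unfolding lap[symmetric] using f0
    by (subst nn_integral_density) (auto intro!: nn_integral_cong simp: ennreal_mult[symmetric] exp_add[symmetric] algebra_simps)
  have n1: "(\<integral>\<^sup>+t. ennreal (exp (- real n * t)) \<partial>?K1) = ennreal (expectation (\<lambda>x. exp (- (w + real n) * X x)))" for n
  proof -
    have "(\<integral>\<^sup>+t. ennreal (exp (- real n * t)) \<partial>?K1) = (\<integral>\<^sup>+x. ennreal (exp (- (w + real n) * X x)) \<partial>M)"
      by (subst nn_integral_density) (auto intro!: nn_integral_cong simp: nn_integral_distr ennreal_mult[symmetric] exp_add[symmetric] algebra_simps)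
    then show ?thesis using i1[of n] by (simp add: nn_integral_eq_integral)
  qed
  have "?K1 = ?K2"
  proof (rule measure_eqI_laplace_nat)
    show "finite_measure ?K1" using n1[of 0]
      by (intro finite_measureI) (simp add: emeasure_density nn_integral_density cong: nn_integral_cong)
    show "finite_measure ?K2" using n2[of 0]
      by (intro finite_measureI) (simp add: emeasure_density nn_integral_density cong: nn_integral_cong)
    show "AE x in ?K1. 0 \<le> x" using X0 by (simp add: AE_density AE_distr_iff)
    show "AE x in ?K2. 0 \<le> x"
    proof -
      have "0 < ennreal (exp (- w * x)) * ennreal (f x) \<longrightarrow> 0 \<le> x" for x
        using f0(2)[of x] by (cases "x \<le> 0") auto
      then show ?thesis by (simp add: AE_density)
    qed
    fix n :: nat
    show "(\<integral>x. exp (- real n * x) \<partial>?K1) = (\<integral>x. exp (- real n * x) \<partial>?K2)"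
      by (subst (1 2) integral_eq_nn_integral) (simp_all only: n1 n2, simp_all)
  qed simp_all
  then have "density ?K1 (\<lambda>x. ennreal (exp (w * x))) = density ?K2 (\<lambda>x. ennreal (exp (w * x)))" by simp
  then have "density ?D (\<lambda>x. 1) = density lborel (\<lambda>x. ennreal (f x))"
    by (subst (asm) (1 2) density_exp_inverse) auto
  then have "distr M borel X = density lborel (\<lambda>x. ennreal (f x))"
    by (simp add: density_1)
  moreover have "distr M lborel X = distr M borel X" by (intro distr_cong) auto
  ultimately show ?thesis by (auto simp: distributed_def)
qed

text \<open>After tilting, the law of \<open>X\<close> plus the negative part of \<open>f\<close>
  has the same transforms as the positive part, hence is the same measure. The positive part does
  not charge the set where \<open>f\<close> is negative, so neither does the negative part.\<close>

lemma (in prob_space) nonneg_laplaceI: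
  fixes X :: "'a \<Rightarrow> real" and f :: "real \<Rightarrow> real"
  assumes X[measurable]: "X \<in> borel_measurable M" and X0: "AE x in M. 0 \<le> X x"
    and f[measurable]: "f \<in> borel_measurable borel" and f0: "\<And>t. t \<le> 0 \<Longrightarrow> f t = 0"
    and w: "w \<ge> 0"
    and int: "\<And>n::nat. integrable lborel (\<lambda>t. exp (- (w + real n) * t) * f t)"
    and lap: "\<And>n::nat. (\<integral>t. exp (- (w + real n) * t) * f t \<partial>lborel) =
        expectation (\<lambda>x. exp (- (w + real n) * X x))"
  shows "AE t in lborel. 0 \<le> f t"
proof -
  let ?D = "distr M borel X"
  let ?K1 = "density ?D (\<lambda>x. ennreal (exp (- w * x)))"
  let ?N = "density lborel (\<lambda>x. ennreal (exp (- w * x) * max 0 (- f x)))"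
  let ?P = "density lborel (\<lambda>x. ennreal (exp (- w * x) * max 0 (f x)))"
  have i1: "integrable M (\<lambda>x. exp (- (w + real n) * X x))" for n
    using X0 w by (intro integrable_const_bound[where B=1]) (auto elim!: eventually_mono intro!: mult_nonpos_nonneg)
  have n1: "(\<integral>\<^sup>+t. ennreal (exp (- real n * t)) \<partial>?K1) = ennreal (expectation (\<lambda>x. exp (- (w + real n) * X x)))" for n
  proof -
    have "(\<integral>\<^sup>+t. ennreal (exp (- real n * t)) \<partial>?K1) = (\<integral>\<^sup>+x. ennreal (exp (- (w + real n) * X x)) \<partial>M)"
      by (subst nn_integral_density) (auto intro!: nn_integral_cong simp: nn_integral_distr ennreal_mult[symmetric] exp_add[symmetric] algebra_simps)
    then show ?thesis using i1[of n] by (simp add: nn_integral_eq_integral)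
  qed
  \<comment> \<open>The sign \<open>s\<close> is instantiated by 1 and by -1, which treats both
    parts of \<open>f\<close> at once.\<close>
  have mx: "exp (- (w + real n) * t) * max 0 (s * f t) = max 0 (s * (exp (- (w + real n) * t) * f t))" for n t s
    by (auto simp: max_def mult_le_0_iff zero_le_mult_iff mult.left_commute)
  have im: "integrable lborel (\<lambda>t. exp (- (w + real n) * t) * max 0 (s * f t))" for n s
    unfolding mx using int[of n] by (intro integrable_max) auto
  have nK: "(\<integral>\<^sup>+t. ennreal (exp (- real n * t)) \<partial>density lborel (\<lambda>x. ennreal (exp (- w * x) * max 0 (s * f x)))) =
      ennreal (\<integral>t. exp (- (w + real n) * t) * max 0 (s * f t) \<partial>lborel)" for n s
    using im[of n s]
    by (subst nn_integral_density, simp, simp, subst nn_integral_eq_integral[symmetric])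
       (auto intro!: nn_integral_cong simp: ennreal_mult[symmetric] exp_add[symmetric] algebra_simps)
  note nN = nK[of "-1", simplified mult_minus1]
  note nP = nK[of 1, simplified mult_1]
  note imN = im[of _ "-1", simplified mult_minus1]
  note imP = im[of _ 1, simplified mult_1]
  have bal: "(\<integral>t. exp (- (w + real n) * t) * max 0 (f t) \<partial>lborel) =
      expectation (\<lambda>x. exp (- (w + real n) * X x)) + (\<integral>t. exp (- (w + real n) * t) * max 0 (- f t) \<partial>lborel)" for n
  proof -
    have "(\<integral>t. exp (- (w + real n) * t) * max 0 (f t) \<partial>lborel) - (\<integral>t. exp (- (w + real n) * t) * max 0 (- f t) \<partial>lborel)
      = (\<integral>t. exp (- (w + real n) * t) * max 0 (f t) - exp (- (w + real n) * t) * max 0 (- f t) \<partial>lborel)"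
      using imN imP by (intro Bochner_Integration.integral_diff[symmetric])
    also have "\<dots> = (\<integral>t. exp (- (w + real n) * t) * f t \<partial>lborel)"
      by (intro Bochner_Integration.integral_cong) (auto simp: max_def)
    finally show ?thesis using lap[of n] by simp
  qed
  let ?A = "add_measure ?K1 ?N"
  have nA: "(\<integral>\<^sup>+t. ennreal (exp (- real n * t)) \<partial>?A) = (\<integral>\<^sup>+t. ennreal (exp (- real n * t)) \<partial>?P)" for n
    by (subst nn_integral_add_measure, simp, simp, unfold n1 nN nP bal)
       (auto intro!: ennreal_plus[symmetric] integral_nonneg_AE)
  have "?A = ?P"
  proof (rule measure_eqI_laplace_nat)
    have t: "(\<integral>\<^sup>+t. ennreal (exp (- real 0 * t)) \<partial>?P) < \<infinity>" unfolding nP by simp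
    show "finite_measure ?P"
      using t by (intro finite_measureI) simp
    show "finite_measure ?A" using t unfolding nA[symmetric]
      by (intro finite_measureI) simp
    show "AE x in ?P. 0 \<le> x"
    proof -
      have "0 < ennreal (exp (- w * x) * max 0 (f x)) \<Longrightarrow> 0 \<le> x" for x
        using f0[of x] by (cases "x \<le> 0") auto
      note aux = this
      show ?thesis by (subst AE_density, measurable, rule AE_I2, rule impI, rule aux)
    qed
    show "AE x in ?A. 0 \<le> x"
    proof -
      have "AE x in ?K1. 0 \<le> x" using X0 by (simp add: AE_density AE_distr_iff)
      then have "emeasure ?K1 {..<0} = 0" by (subst (asm) AE_iff_measurable[of "{..<0}"]) auto
      moreover have "AE x in ?N. 0 \<le> x"
      proof -
        have "0 < ennreal (exp (- w * x) * max 0 (- f x)) \<Longrightarrow> 0 \<le> x" for x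
          using f0[of x] by (cases "x \<le> 0") auto
        note aux = this
      show ?thesis by (subst AE_density, measurable, rule AE_I2, rule impI, rule aux)
      qed
      then have "emeasure ?N {..<0} = 0" by (subst (asm) AE_iff_measurable[of "{..<0}"]) auto
      ultimately have "emeasure ?A {..<0} = 0" by (subst emeasure_add_measure) auto
      then show ?thesis by (subst AE_iff_measurable[of "{..<0}"]) auto
    qed
    fix n :: nat
    show "(\<integral>x. exp (- real n * x) \<partial>?A) = (\<integral>x. exp (- real n * x) \<partial>?P)"
      by (subst (1 2) integral_eq_nn_integral) (simp_all only: nA, simp_all)
  qed simp_all
  then have "emeasure ?A {t. f t < 0} = emeasure ?P {t. f t < 0}" by simp
  also have "\<dots> = 0"
    by (subst emeasure_density) (auto simp: nn_integral_0_iff_AE indicator_def)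
  finally have "emeasure ?N {t. f t < 0} = 0"
    by (subst (asm) emeasure_add_measure) auto
  then have "AE t in lborel. ennreal (exp (- w * t) * max 0 (- f t)) * indicator {t. f t < 0} t = 0"
    by (subst (asm) emeasure_density) (auto simp: nn_integral_0_iff_AE)
  then show ?thesis
    by eventually_elim (auto simp: indicator_def ennreal_eq_0_iff mult_le_0_iff max_def split: if_splits)
qed

section \<open>Laplace transforms of convolutions\<close>

lemma convolution_fun_laplace:
  fixes f g :: "real \<Rightarrow> real"
  assumes f[measurable]: "f \<in> borel_measurable borel" and f0: "\<And>t. 0 \<le> f t" "\<And>t. t \<le> 0 \<Longrightarrow> f t = 0"
    and g[measurable]: "g \<in> borel_measurable borel" and g0: "\<And>t. 0 \<le> g t" "\<And>t. t \<le> 0 \<Longrightarrow> g t = 0"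
  shows "convolution_fun f g \<in> borel_measurable borel"
    and "0 \<le> convolution_fun f g t"
    and "t \<le> 0 \<Longrightarrow> convolution_fun f g t = 0"
    and "(\<integral>\<^sup>+t. ennreal (exp (- z * t) * f t) \<partial>lborel) < \<infinity> \<Longrightarrow>
      (\<integral>\<^sup>+t. ennreal (exp (- z * t) * g t) \<partial>lborel) < \<infinity> \<Longrightarrow>
      (\<integral>\<^sup>+t. ennreal (exp (- z * t) * convolution_fun f g t) \<partial>lborel) =
      (\<integral>\<^sup>+t. ennreal (exp (- z * t) * f t) \<partial>lborel) * (\<integral>\<^sup>+t. ennreal (exp (- z * t) * g t) \<partial>lborel)"
proof -
  \<comment> \<open>The convolution as an extended nonnegative integral over the whole line; the
    integrand vanishes unless \<open>0 < u < t\<close>. Where \<open>H\<close> is infinite,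
    \<open>convolution_fun\<close> takes the default value 0.\<close>
  define H where "H t = (\<integral>\<^sup>+u. ennreal (f (t - u) * g u) \<partial>lborel)" for t
  have H[measurable]: "H \<in> borel_measurable borel" unfolding H_def by measurable
  have c: "convolution_fun f g t = enn2real (H t)" for t
  proof -
    have "convolution_fun f g t = (\<integral>u. f (t - u) * g u \<partial>lborel)"
      unfolding convolution_fun_def set_lebesgue_integral_def
    proof (rule Bochner_Integration.integral_cong[OF refl])
      fix u show "indicator {0<..<t} u *\<^sub>R (f (t - u) * g u) = f (t - u) * g u"
        using f0(2)[of "t - u"] g0(2)[of u] by (cases "0 < u"; cases "u < t") auto
    qed
    also have "\<dots> = enn2real (H t)"
      unfolding H_def using f0 g0 by (intro integral_eq_nn_integral) auto
    finally show ?thesis .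
  qed
  show "convolution_fun f g \<in> borel_measurable borel" unfolding c[abs_def] by measurable
  show "0 \<le> convolution_fun f g t" by (simp add: c)
  show "convolution_fun f g t = 0" if "t \<le> 0"
    using that by (simp add: convolution_fun_def set_lebesgue_integral_def)
  assume fin: "(\<integral>\<^sup>+t. ennreal (exp (- z * t) * f t) \<partial>lborel) < \<infinity>" (is "?F < _")
    "(\<integral>\<^sup>+t. ennreal (exp (- z * t) * g t) \<partial>lborel) < \<infinity>" (is "?G < _")
  have "(\<integral>\<^sup>+t. ennreal (exp (- z * t)) * H t \<partial>lborel) =
      (\<integral>\<^sup>+t. \<integral>\<^sup>+u. ennreal (exp (- z * (t - u)) * f (t - u)) * ennreal (exp (- z * u) * g u) \<partial>lborel \<partial>lborel)"
  proof (rule nn_integral_cong)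
    fix t :: real
    have e: "exp (- z * t) = exp (- z * (t - u)) * exp (- z * u)" for u
      by (simp add: exp_add[symmetric] algebra_simps)
    have "ennreal (exp (- z * t)) * ennreal (f (t - u) * g u) =
        ennreal (exp (- z * (t - u)) * f (t - u)) * ennreal (exp (- z * u) * g u)" for u
      unfolding e[of u] using f0 g0 by (simp add: ennreal_mult[symmetric] mult_ac)
    then show "ennreal (exp (- z * t)) * H t =
        (\<integral>\<^sup>+u. ennreal (exp (- z * (t - u)) * f (t - u)) * ennreal (exp (- z * u) * g u) \<partial>lborel)"
      unfolding H_def by (subst nn_integral_cmult[symmetric]) auto
  qed
  also have "\<dots> = (\<integral>\<^sup>+u. \<integral>\<^sup>+t. ennreal (exp (- z * (t - u)) * f (t - u)) * ennreal (exp (- z * u) * g u) \<partial>lborel \<partial>lborel)"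
    by (rule lborel_pair.Fubini') measurable
  also have "\<dots> = (\<integral>\<^sup>+u. ?F * ennreal (exp (- z * u) * g u) \<partial>lborel)"
  proof (rule nn_integral_cong)
    fix u :: real
    have "(\<integral>\<^sup>+t. ennreal (exp (- z * (t - u)) * f (t - u)) * ennreal (exp (- z * u) * g u) \<partial>lborel) =
        (\<integral>\<^sup>+t. ennreal (exp (- z * (t - u)) * f (t - u)) \<partial>lborel) * ennreal (exp (- z * u) * g u)"
      by (rule nn_integral_multc) measurable
    also have "(\<integral>\<^sup>+t. ennreal (exp (- z * (t - u)) * f (t - u)) \<partial>lborel) = ?F"
      by (subst nn_integral_real_affine[where c=1 and t="u"]) auto
    finally show "(\<integral>\<^sup>+t. ennreal (exp (- z * (t - u)) * f (t - u)) * ennreal (exp (- z * u) * g u) \<partial>lborel) =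
       ?F * ennreal (exp (- z * u) * g u)" .
  qed
  also have "\<dots> = ?F * ?G" by (rule nn_integral_cmult) measurable
  finally have T: "(\<integral>\<^sup>+t. ennreal (exp (- z * t)) * H t \<partial>lborel) = ?F * ?G" .
  have "?F * ?G < \<infinity>" using fin by (simp add: ennreal_mult_less_top)
  \<comment> \<open>Finiteness of the two transforms confines the default value to a null
    set.\<close>
  then have "AE t in lborel. ennreal (exp (- z * t)) * H t \<noteq> \<infinity>"
    unfolding T[symmetric] by (intro nn_integral_PInf_AE) auto
  then have "AE t in lborel. ennreal (exp (- z * t) * convolution_fun f g t) = ennreal (exp (- z * t)) * H t"
    by eventually_elim (auto simp: c ennreal_mult ennreal_mult_eq_top_iff less_top[symmetric])
  then show "(\<integral>\<^sup>+t. ennreal (exp (- z * t) * convolution_fun f g t) \<partial>lborel) = ?F * ?G"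
    unfolding T[symmetric] by (rule nn_integral_cong_AE)
qed

lemma conv_power_laplace:
  fixes f :: "real \<Rightarrow> real"
  assumes f[measurable]: "f \<in> borel_measurable borel" and f0: "\<And>t. 0 \<le> f t" "\<And>t. t \<le> 0 \<Longrightarrow> f t = 0"
  shows "N \<ge> 1 \<Longrightarrow> conv_power f N \<in> borel_measurable borel \<and> (\<forall>t. 0 \<le> conv_power f N t) \<and> (\<forall>t\<le>0. conv_power f N t = 0) \<and>
      (\<forall>z. (\<integral>\<^sup>+t. ennreal (exp (- z * t) * f t) \<partial>lborel) < \<infinity> \<longrightarrow>
      (\<integral>\<^sup>+t. ennreal (exp (- z * t) * conv_power f N t) \<partial>lborel) = (\<integral>\<^sup>+t. ennreal (exp (- z * t) * f t) \<partial>lborel) ^ N)"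
proof (induction N)
  case (Suc N)
  show ?case
  proof (cases "N = 0")
    case True
    then show ?thesis using f0 f by simp
  next
    case False
    then have g: "conv_power f N \<in> borel_measurable borel" "\<And>t. 0 \<le> conv_power f N t" "\<And>t. t \<le> 0 \<Longrightarrow> conv_power f N t = 0"
      and L: "\<And>z. (\<integral>\<^sup>+t. ennreal (exp (- z * t) * f t) \<partial>lborel) < \<infinity> \<Longrightarrow>
      (\<integral>\<^sup>+t. ennreal (exp (- z * t) * conv_power f N t) \<partial>lborel) = (\<integral>\<^sup>+t. ennreal (exp (- z * t) * f t) \<partial>lborel) ^ N"
      using Suc.IH by auto
    note C = convolution_fun_laplace[OF f f0 g]
    have "(\<integral>\<^sup>+t. ennreal (exp (- z * t) * convolution_fun f (conv_power f N) t) \<partial>lborel) =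
       (\<integral>\<^sup>+t. ennreal (exp (- z * t) * f t) \<partial>lborel) ^ Suc N"
      if F: "(\<integral>\<^sup>+t. ennreal (exp (- z * t) * f t) \<partial>lborel) < \<infinity>" for z
    proof -
      have "(\<integral>\<^sup>+t. ennreal (exp (- z * t) * f t) \<partial>lborel) ^ N < \<infinity>"
        using F by (simp add: less_top[symmetric] power_eq_top_ennreal)
      then show ?thesis using C(4)[OF _ _ F] L[OF F] F by simp
    qed
    then show ?thesis using False C(1,2,3) by simp
  qed
qed simp

lemma laplace_transform_nonneg:
  assumes "f \<in> borel_measurable borel" "\<And>t. 0 \<le> f t" "\<And>t. t \<le> 0 \<Longrightarrow> f t = 0"
  shows "laplace_transform f z = enn2real (\<integral>\<^sup>+t. ennreal (exp (- z * t) * f t) \<partial>lborel)"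
proof -
  have "laplace_transform f z = (\<integral>t. exp (- z * t) * f t \<partial>lborel)"
    unfolding laplace_transform_def set_lebesgue_integral_def
    using assms(3) by (intro Bochner_Integration.integral_cong) (auto simp: indicator_def)
  also have "\<dots> = enn2real (\<integral>\<^sup>+t. ennreal (exp (- z * t) * f t) \<partial>lborel)"
    using assms by (intro integral_eq_nn_integral) auto
  finally show ?thesis .
qed

section \<open>Jumps of step paths\<close>

text \<open>If the path stays constant after the \<open>l\<close>-th jump, the infimum is over the
  empty set and carries no meaning; \<open>has_jumps\<close> guards against this.\<close>

primrec jump_time :: "(real \<Rightarrow> 's) \<Rightarrow> nat \<Rightarrow> real" where
  "jump_time x 0 = 0"
| "jump_time x (Suc l) = Inf {t. jump_time x l < t \<and> x t \<noteq> x (jump_time x l)}"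

declare jump_time.simps(2) [simp del]

definition jump_state :: "(real \<Rightarrow> 's) \<Rightarrow> nat \<Rightarrow> 's" where
  "jump_state x l = x (jump_time x l)"

definition has_jumps :: "(real \<Rightarrow> 's) \<Rightarrow> nat \<Rightarrow> bool" where
  "has_jumps x m \<longleftrightarrow> (\<forall>l<m. \<exists>t>jump_time x l. x t \<noteq> x (jump_time x l))"

lemma has_jumps_Suc: "has_jumps x (Suc m) \<longleftrightarrow> has_jumps x m \<and> (\<exists>t>jump_time x m. x t \<noteq> jump_state x m)"
  by (auto simp: has_jumps_def less_Suc_eq jump_state_def)

lemma has_jumps_mono: "has_jumps x m \<Longrightarrow> l \<le> m \<Longrightarrow> has_jumps x l"
  by (auto simp: has_jumps_def)

lemma cadlag_step_pathD:
  assumes "cadlag_step_path x" "t \<ge> 0"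
  obtains e where "e > 0" "\<And>u. t \<le> u \<Longrightarrow> u < t + e \<Longrightarrow> x u = x t"
proof -
  from assms have "eventually (\<lambda>u. x u = x t) (at_right t)" by (simp add: cadlag_step_path_def)
  then obtain b where "b > t" "\<And>y. t < y \<Longrightarrow> y < b \<Longrightarrow> x y = x t"
    by (auto simp: eventually_at_right_field)
  then show ?thesis by (intro that[of "b - t"]) (auto simp: le_less)
qed

text \<open>Right-continuity acts twice: it makes the holding interval nondegenerate, and it forces
  the path to have left the state at the infimum itself.\<close>

lemma jump_time_Suc:
  assumes x: "cadlag_step_path x" and l: "jump_time x l \<ge> 0"
    and ex: "\<exists>t>jump_time x l. x t \<noteq> jump_state x l"
  shows "jump_time x l < jump_time x (Suc l)"
    and "\<And>t. jump_time x l \<le> t \<Longrightarrow> t < jump_time x (Suc l) \<Longrightarrow> x t = jump_state x l"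
    and "jump_state x (Suc l) \<noteq> jump_state x l"
proof -
  let ?S = "{t. jump_time x l < t \<and> x t \<noteq> jump_state x l}"
  have J: "jump_time x (Suc l) = Inf ?S" by (simp add: jump_state_def jump_time.simps(2))
  have ne: "?S \<noteq> {}" using ex by auto
  have bdd: "bdd_below ?S" by (auto intro: bdd_belowI[of _ "jump_time x l"])
  obtain e where e: "e > 0" "\<And>u. jump_time x l \<le> u \<Longrightarrow> u < jump_time x l + e \<Longrightarrow> x u = jump_state x l"
    using cadlag_step_pathD[OF x l] unfolding jump_state_def by blast
  have "jump_time x l + e \<le> Inf ?S"
    using ne e(2) by (intro cInf_greatest) (auto simp: not_less[symmetric] dest: less_imp_le)
  then show lt: "jump_time x l < jump_time x (Suc l)" unfolding J using e(1) by linarith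
  show c: "x t = jump_state x l" if "jump_time x l \<le> t" "t < jump_time x (Suc l)" for t
  proof (rule ccontr)
    assume n: "x t \<noteq> jump_state x l"
    then have "jump_time x l \<noteq> t" by (auto simp: jump_state_def)
    then have "t \<in> ?S" using n that by auto
    then have "Inf ?S \<le> t" by (rule cInf_lower[OF _ bdd])
    then show False using that by (simp add: J)
  qed
  show "jump_state x (Suc l) \<noteq> jump_state x l"
  proof
    assume eq: "jump_state x (Suc l) = jump_state x l"
    let ?t = "jump_time x (Suc l)"
    obtain d where d: "d > 0" "\<And>u. ?t \<le> u \<Longrightarrow> u < ?t + d \<Longrightarrow> x u = jump_state x l"
      using cadlag_step_pathD[OF x order_trans[OF l less_imp_le[OF lt]]] eq unfolding jump_state_def by metis
    \<comment> \<open>If the path were still in the old state at the infimum, it would remain there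
      for a further time \<open>d\<close>, and the infimum would be larger.\<close>
    have "?t + d \<le> Inf ?S"
    proof (rule cInf_greatest[OF ne])
      fix u assume u: "u \<in> ?S"
      then have "\<not> u < ?t" using c[of u] by auto
      then show "?t + d \<le> u" using d(2)[of u] u by force
    qed
    then show False using d(1) by (simp add: J)
  qed
qed

lemma jump_time_nonneg:
  "cadlag_step_path x \<Longrightarrow> has_jumps x m \<Longrightarrow> l \<le> m \<Longrightarrow> jump_time x l \<ge> 0"
proof (induction l)
  case (Suc l)
  then show ?case
    using jump_time_Suc(1)[of x l] has_jumps_mono[OF Suc.prems(2), of "Suc l"]
    by (force simp: has_jumps_Suc)
qed simp

lemma has_jumpsD:
  assumes x: "cadlag_step_path x" and J: "has_jumps x m" and l: "l < m"
  shows "jump_time x l < jump_time x (Suc l)"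
    and "\<And>t. jump_time x l \<le> t \<Longrightarrow> t < jump_time x (Suc l) \<Longrightarrow> x t = jump_state x l"
    and "jump_state x (Suc l) \<noteq> jump_state x l"
proof -
  have "\<exists>t>jump_time x l. x t \<noteq> jump_state x l" using J l by (auto simp: has_jumps_def jump_state_def)
  from jump_time_Suc[OF x jump_time_nonneg[OF x J less_imp_le[OF l]] this]
  show "jump_time x l < jump_time x (Suc l)"
    and "\<And>t. jump_time x l \<le> t \<Longrightarrow> t < jump_time x (Suc l) \<Longrightarrow> x t = jump_state x l"
    and "jump_state x (Suc l) \<noteq> jump_state x l" by auto
qed

text \<open>The left limits exclude an accumulation of jumps, hence an explosion.\<close>

lemma jump_time_unbounded:
  assumes x: "cadlag_step_path x" and J: "\<And>m. has_jumps x m"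
  shows "\<exists>l. t < jump_time x l"
proof (rule ccontr)
  assume "\<not> ?thesis"
  then have bd: "jump_time x l \<le> t" for l by (auto simp: not_less)
  have inc: "jump_time x l < jump_time x (Suc l)" for l using has_jumpsD(1)[OF x J[of "Suc l"]] by simp
  then have sm: "strict_mono (jump_time x)" by (rule strict_mono_Suc_iff[THEN iffD2, rule_format])
  have bdd: "bdd_above (range (jump_time x))" using bd by (auto intro!: bdd_aboveI2)
  define s where "s = (SUP l. jump_time x l)"
  have lim: "jump_time x \<longlonglongrightarrow> s"
    unfolding s_def using bdd strict_mono_mono[OF sm] by (intro LIMSEQ_incseq_SUP)
  have lt: "jump_time x l < s" for l
    using inc[of l] cSUP_upper[OF _ bdd, of "Suc l"] unfolding s_def by simp
  have "s > 0" using lt[of 0] by simp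
  then obtain c where "eventually (\<lambda>u. x u = c) (at_left s)" using x by (auto simp: cadlag_step_path_def)
  then obtain b where b: "b < s" "\<And>y. b < y \<Longrightarrow> y < s \<Longrightarrow> x y = c"
    by (auto simp: eventually_at_left_field)
  have "eventually (\<lambda>l. b < jump_time x l) sequentially" using lim b(1) by (rule order_tendstoD)
  then obtain l where l: "b < jump_time x l" by (auto simp: eventually_sequentially)
  have "x (jump_time x l) = c" "x (jump_time x (Suc l)) = c" using b l lt inc[of l] by auto
  then show False using has_jumpsD(3)[OF x J[of "Suc l"], of l] by (simp add: jump_state_def)
qed

text \<open>The grid index at which the \<open>l\<close>-th observed jump becomes visible:
  \<open>d r\<close> steps without a change, plus the step of the jump itself.\<close>

definition grid_index :: "(nat \<Rightarrow> nat) \<Rightarrow> nat \<Rightarrow> nat" where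
  "grid_index d l = (\<Sum>r<l. Suc (d r))"

lemma grid_index_0[simp]: "grid_index d 0 = 0"
  and grid_index_Suc[simp]: "grid_index d (Suc l) = Suc (grid_index d l + d l)"
  by (simp_all add: grid_index_def)

text \<open>Seen on the grid of mesh \<open>h\<close>, the path makes its first \<open>m\<close> jumps through the states
  \<open>i 0, \<dots>, i m\<close>, and \<open>d l\<close> counts the grid steps during which it does not leave \<open>i l\<close>.\<close>

definition grid_match :: "(real \<Rightarrow> 's) \<Rightarrow> real \<Rightarrow> (nat \<Rightarrow> 's) \<Rightarrow> (nat \<Rightarrow> nat) \<Rightarrow> nat \<Rightarrow> bool" where
  "grid_match x h i d m \<longleftrightarrow>
     (\<forall>l<m. \<forall>n\<in>{grid_index d l..<grid_index d (Suc l)}. x (real n * h) = i l) \<and>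
     x (real (grid_index d m) * h) = i m"

lemma grid_match_Suc:
  "grid_match x h i d (Suc m) \<longleftrightarrow> grid_match x h i d m \<and>
     (\<forall>n\<in>{grid_index d m..grid_index d m + d m}. x (real n * h) = i m) \<and>
     x (real (grid_index d (Suc m)) * h) = i (Suc m)"
  by (auto simp: grid_match_def less_Suc_eq atLeastLessThanSuc_atLeastAtMost)

lemma grid_match_mono: "grid_match x h i d m \<Longrightarrow> l \<le> m \<Longrightarrow> grid_match x h i d l"
  by (induction m) (auto simp: le_Suc_eq grid_match_Suc)

lemma grid_match_state: "grid_match x h i d m \<Longrightarrow> x (real (grid_index d m) * h) = i m"
  by (simp add: grid_match_def)

text \<open>Since consecutive states differ, the next index is the first grid point at which the
  state has changed; a pattern that jumped later would demand the old state there. Hence at most one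
  holding pattern contributes for each path.\<close>

lemma grid_match_unique:
  assumes "grid_match x h i d m" "grid_match x h i' d' m"
    and "\<And>l. l < m \<Longrightarrow> i l \<noteq> i (Suc l)" "\<And>l. l < m \<Longrightarrow> i' l \<noteq> i' (Suc l)"
    and "l \<le> m"
  shows "grid_index d l = grid_index d' l \<and> i l = i' l"
  using \<open>l \<le> m\<close>
proof (induction l)
  case 0
  then show ?case
    using grid_match_state[OF grid_match_mono[OF assms(1), of 0]]
      grid_match_state[OF grid_match_mono[OF assms(2), of 0]] by simp
next
  case (Suc l)
  then have IH: "grid_index d l = grid_index d' l" "i l = i' l" by auto
  have key: "\<not> grid_index e (Suc l) < grid_index e' (Suc l)"
    if m: "grid_match x h j e m" "grid_match x h j' e' m" and j: "j l \<noteq> j (Suc l)"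
      and eq: "grid_index e l = grid_index e' l" "j l = j' l" for j j' e e'
  proof
    assume "grid_index e (Suc l) < grid_index e' (Suc l)"
    then have "x (real (grid_index e (Suc l)) * h) = j' l"
    proof -
      have "grid_index e (Suc l) \<in> {grid_index e' l..grid_index e' l + e' l}"
        using \<open>grid_index e (Suc l) < grid_index e' (Suc l)\<close> eq(1) by simp
      then show ?thesis using grid_match_mono[OF m(2) Suc.prems] unfolding grid_match_Suc by blast
    qed
    moreover have "x (real (grid_index e (Suc l)) * h) = j (Suc l)"
      using grid_match_state[OF grid_match_mono[OF m(1) Suc.prems]] .
    ultimately show False using j eq by simp
  qed
  have "grid_index d (Suc l) = grid_index d' (Suc l)"
    using key[OF assms(1,2) assms(3) IH] key[OF assms(2,1) assms(4) IH(1)[symmetric] IH(2)[symmetric]] Suc.prems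
    by (auto simp: not_less intro: antisym)
  then show ?case
    using grid_match_state[OF grid_match_mono[OF assms(1) Suc.prems]]
      grid_match_state[OF grid_match_mono[OF assms(2) Suc.prems]] by simp
qed

text \<open>Once the mesh is smaller than every holding time, each holding interval contains a grid
  point and no jump is missed. The first grid index at or after a jump time is its quotient by
  \<open>h\<close>, rounded up.\<close>

lemma grid_match_exists:
  assumes x: "cadlag_step_path x" and J: "has_jumps x m"
  shows "eventually (\<lambda>h. \<exists>d. (\<forall>l\<le>m. grid_index d l = nat \<lceil>jump_time x l / h\<rceil>) \<and>
    grid_match x h (jump_state x) d m) (at_right 0)"
proof -
  have t0: "jump_time x l \<ge> 0" if "l \<le> m" for l using jump_time_nonneg[OF x J that] .
  \<comment> \<open>The path may leave its \<open>m\<close>-th state soon, so a grid point must fall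
    within \<open>e\<close> after the last jump too.\<close>
  obtain e where e: "e > 0" "\<And>u. jump_time x m \<le> u \<Longrightarrow> u < jump_time x m + e \<Longrightarrow> x u = jump_state x m"
    using cadlag_step_pathD[OF x t0[OF order_refl]] unfolding jump_state_def by blast
  have ev: "eventually (\<lambda>h. h < c) (at_right (0::real))" if "c > 0" for c
    using that by (auto simp: eventually_at_right_field)
  have "eventually (\<lambda>h. \<forall>l\<in>{..<m}. h < jump_time x (Suc l) - jump_time x l) (at_right 0)"
    using has_jumpsD(1)[OF x J] by (intro eventually_ball_finite ballI ev) auto
  moreover have "eventually (\<lambda>h. h < e) (at_right 0)" using e(1) by (rule ev)
  moreover have "eventually (\<lambda>h. 0 < h) (at_right (0::real))" by (simp add: eventually_at_right_less)
  ultimately show ?thesis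
  proof eventually_elim
    case (elim h)
    define N where "N l = nat \<lceil>jump_time x l / h\<rceil>" for l
    define d where "d l = N (Suc l) - Suc (N l)" for l
    have c0: "0 \<le> \<lceil>jump_time x l / h\<rceil>" if "l \<le> m" for l
      using divide_nonneg_pos[OF t0[OF that], of h] elim by (metis ceiling_mono ceiling_zero)
    have N_le: "N l \<le> n \<longleftrightarrow> jump_time x l \<le> real n * h" if "l \<le> m" for n l
    proof -
      have "N l \<le> n \<longleftrightarrow> jump_time x l / h \<le> real n" unfolding N_def using c0[OF that] by (simp add: ceiling_le_iff nat_le_iff)
      also have "\<dots> \<longleftrightarrow> jump_time x l \<le> real n * h" using elim by (simp add: divide_simps)
      finally show ?thesis .
    qed
    have N_lt: "N l < N (Suc l)" if "l < m" for l
    proof (rule ccontr)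
      assume "\<not> ?thesis"
      then have le: "jump_time x (Suc l) \<le> real (N l) * h" using N_le[of "Suc l" "N l"] that by simp
      have "\<not> N l \<le> N l - 1 \<or> N l = 0" by auto
      then have "real (N l) * h < jump_time x l + h"
      proof
        assume "\<not> N l \<le> N l - 1"
        then have "real (N l - 1) * h < jump_time x l" "N l > 0" using N_le[of l "N l - 1"] that by auto
        then show ?thesis by (simp add: of_nat_diff left_diff_distrib)
      next
        assume "N l = 0" then show ?thesis using t0[of l] that elim by simp
      qed
      moreover have "h < jump_time x (Suc l) - jump_time x l" using elim(1) that by simp
      ultimately show False using le by linarith
    qed
    have gi: "grid_index d l = N l" if "l \<le> m" for l
      using that
    proof (induction l)
      case 0 then show ?case by (simp add: N_def)
    next
      case (Suc l)
      then show ?case using N_lt[of l] by (simp add: d_def)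
    qed
    have "grid_match x h (jump_state x) d m"
      unfolding grid_match_def
    proof (intro conjI allI impI ballI)
      fix l n assume l: "l < m" and n: "n \<in> {grid_index d l..<grid_index d (Suc l)}"
      then have "N l \<le> n" "\<not> N (Suc l) \<le> n" using gi[of l] gi[of "Suc l"] by auto
      then have "jump_time x l \<le> real n * h" "real n * h < jump_time x (Suc l)"
        using N_le[of l n] N_le[of "Suc l" n] l by auto
      then show "x (real n * h) = jump_state x l" by (rule has_jumpsD(2)[OF x J l])
    next
      have "jump_time x m \<le> real (N m) * h" using N_le[of m "N m"] by simp
      moreover have "real (N m) * h < jump_time x m + h"
      proof (cases "N m = 0")
        case True then show ?thesis using t0[of m] elim by simp
      next
        case False
        then have "\<not> N m \<le> N m - 1" by simp
        then have "real (N m - 1) * h < jump_time x m" using N_le[of m "N m - 1"] by simp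
        then show ?thesis using False by (simp add: of_nat_diff left_diff_distrib)
      qed
      ultimately show "x (real (grid_index d m) * h) = jump_state x m"
        using e(2)[of "real (N m) * h"] elim gi[of m] by simp
    qed
    then show ?case using gi by (intro exI[of _ d]) (auto simp: N_def)
  qed
qed

text \<open>A sequence that is not the true one can be seen on coarse grids only. Either a shorter
  prefix is already wrong, or the path makes no further jump and cannot show a new state, or the
  last state is wrong and the true pattern excludes it.\<close>

lemma grid_match_only_jumps:
  assumes x: "cadlag_step_path x"
  shows "(\<And>l. l < m \<Longrightarrow> i l \<noteq> i (Suc l)) \<Longrightarrow> \<not> (has_jumps x m \<and> (\<forall>l\<le>m. jump_state x l = i l)) \<Longrightarrow>
    eventually (\<lambda>h. \<forall>d. \<not> grid_match x h i d m) (at_right 0)"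
proof (induction m)
  case 0
  then show ?case by (auto simp: has_jumps_def grid_match_def jump_state_def)
next
  case (Suc m)
  show ?case
  proof (cases "has_jumps x m \<and> (\<forall>l\<le>m. jump_state x l = i l)")
    case False
    then have "eventually (\<lambda>h. \<forall>d. \<not> grid_match x h i d m) (at_right 0)" using Suc.prems by (intro Suc.IH) auto
    then show ?thesis by eventually_elim (auto simp: grid_match_Suc)
  next
    case True
    then have J: "has_jumps x m" and st: "\<And>l. l \<le> m \<Longrightarrow> jump_state x l = i l" by auto
    have pos: "eventually (\<lambda>h. 0 < h) (at_right (0::real))" by (simp add: eventually_at_right_less)
    show ?thesis
    proof (cases "\<exists>t>jump_time x m. x t \<noteq> jump_state x m")
      case False
      show ?thesis using grid_match_exists[OF x J] pos
      proof eventually_elim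
        case (elim h)
        then obtain d' where d': "grid_index d' m = nat \<lceil>jump_time x m / h\<rceil>" "grid_match x h (jump_state x) d' m" by auto
        show ?case
        proof (intro allI notI)
          fix d assume M: "grid_match x h i d (Suc m)"
          have "grid_index d m = grid_index d' m"
            using grid_match_unique[OF _ d'(2), of i d m] M Suc.prems(1) has_jumpsD(3)[OF x J]
            by (metis grid_match_Suc less_SucI order_refl)
          moreover have "jump_time x m \<le> real (nat \<lceil>jump_time x m / h\<rceil>) * h"
            using elim real_nat_ceiling_ge[of "jump_time x m / h"] by (simp add: pos_divide_le_eq)
          moreover have "real (grid_index d m) * h < real (grid_index d (Suc m)) * h" using elim by simp
          ultimately have "jump_time x m < real (grid_index d (Suc m)) * h" using d'(1) by simp
          then have "x (real (grid_index d (Suc m)) * h) = jump_state x m" using False by auto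
          then show False using grid_match_state[OF M] st[of m] Suc.prems(1)[of m] by simp
        qed
      qed
    next
      case ex: True
      then have J': "has_jumps x (Suc m)" using J by (simp add: has_jumps_Suc)
      then have ne: "jump_state x (Suc m) \<noteq> i (Suc m)" using Suc.prems(2) st by (auto simp: le_Suc_eq)
      show ?thesis using grid_match_exists[OF x J']
      proof eventually_elim
        case (elim h)
        then obtain d' where d': "grid_match x h (jump_state x) d' (Suc m)" by auto
        show ?case
        proof (intro allI notI)
          fix d assume M: "grid_match x h i d (Suc m)"
          have "i (Suc m) = jump_state x (Suc m)"
            using grid_match_unique[OF M d', of "Suc m"] Suc.prems(1) has_jumpsD(3)[OF x J'] by (metis order_refl)
          then show False using ne by simp
        qed
      qed
    qed
  qed
qed

section \<open>The mixed stable subordinator\<close>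

lemma (in prob_space) expectation_indep_set:
  fixes f g :: "'a \<Rightarrow> real"
  assumes ind: "indep_set (sets F) (sets G)" and sp: "space F = space M" "space G = space M"
    and f: "f \<in> borel_measurable F" and g: "g \<in> borel_measurable G"
    and int: "integrable M f" "integrable M g"
  shows "expectation (\<lambda>x. f x * g x) = expectation f * expectation g"
proof -
  have sub: "sets F \<subseteq> events" "sets G \<subseteq> events"
    and pr: "\<And>a b. a \<in> sets F \<Longrightarrow> b \<in> sets G \<Longrightarrow> prob (a \<inter> b) = prob a * prob b"
    using ind by (auto simp: indep_sets2_eq)
  have s: "sigma_sets (space M) {h -` A \<inter> space M |A. A \<in> sets borel} \<subseteq> sets K"
    if "h \<in> borel_measurable K" "space K = space M" for h :: "'a \<Rightarrow> real" and K
  proof -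
    have "{h -` A \<inter> space M |A. A \<in> sets borel} \<subseteq> sets K"
      using measurable_sets[OF that(1)] that(2) by auto
    from sets.sigma_sets_subset[OF this] show ?thesis by (simp only: that(2))
  qed
  have "indep_var borel f borel g"
    unfolding indep_var_eq
  proof (intro conjI)
    show "random_variable borel f" "random_variable borel g" using int by auto
    show "indep_set (sigma_sets (space M) {f -` A \<inter> space M |A. A \<in> sets borel})
      (sigma_sets (space M) {g -` A \<inter> space M |A. A \<in> sets borel})"
      using s[OF f sp(1)] s[OF g sp(2)] sub pr unfolding indep_sets2_eq by blast
  qed
  then show ?thesis by (rule indep_var_lebesgue_integral[OF _ int])
qed

locale subordinator_setup = prob_space M for M :: "'a measure" +
  fixes D :: "real \<Rightarrow> 'a \<Rightarrow> real" and a1 a2 c1 c2 :: real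
  assumes sub: "mixed_stable_subordinator M a1 a2 c1 c2 D"
    and a: "0 < a2" "a2 < a1" and c: "0 < c1" "0 \<le> c2"
begin

definition "laplace_exponent z = c1 * z powr a1 + c2 * z powr a2"

lemma laplace_exponent_0[simp]: "laplace_exponent 0 = 0" by (simp add: laplace_exponent_def)

lemma laplace_exponent_nonneg: "0 \<le> laplace_exponent z" using c by (simp add: laplace_exponent_def)

lemma laplace_exponent_pos: "0 < z \<Longrightarrow> 0 < laplace_exponent z"
  using c by (simp add: laplace_exponent_def add_pos_nonneg)

lemma laplace_exponent_at_top: "filterlim (\<lambda>n. laplace_exponent (real n)) at_top sequentially"
proof (rule filterlim_at_top_mono)
  show "filterlim (\<lambda>n. c1 * real n powr a1) at_top sequentially"
  proof -
    have "filterlim (\<lambda>x::real. exp (a1 * ln x)) at_top at_top"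
      using a by (intro filterlim_compose[OF exp_at_top] filterlim_tendsto_pos_mult_at_top[OF tendsto_const] ln_at_top) auto
    then have "filterlim (\<lambda>x::real. x powr a1) at_top at_top"
      by (rule filterlim_cong[THEN iffD1, rotated 3])
         (auto simp: powr_def intro!: eventually_mono[OF eventually_gt_at_top[of 0]])
    then show ?thesis
      using c by (intro filterlim_tendsto_pos_mult_at_top[OF tendsto_const] filterlim_compose[OF _ filterlim_real_sequentially]) auto
  qed
  show "eventually (\<lambda>n. c1 * real n powr a1 \<le> laplace_exponent (real n)) sequentially"
    using c by (simp add: laplace_exponent_def)
qed

lemma D_measurable[measurable]: "t \<ge> 0 \<Longrightarrow> D t \<in> borel_measurable M"
  and D_0: "AE \<omega> in M. D 0 \<omega> = 0"
  and D_cadlag: "AE \<omega> in M. cadlag_path (\<lambda>t. D t \<omega>)"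
  and D_mono: "AE \<omega> in M. mono_on {0..} (\<lambda>t. D t \<omega>)"
  and D_stationary: "s \<ge> 0 \<Longrightarrow> t \<ge> 0 \<Longrightarrow> distr M borel (\<lambda>\<omega>. D (s + t) \<omega> - D s \<omega>) = distr M borel (D t)"
  using sub by (auto simp: mixed_stable_subordinator_def levy_process_def)

lemma D_laplace:
  assumes "t \<ge> 0" "z \<ge> 0" shows "expectation (\<lambda>\<omega>. exp (- z * D t \<omega>)) = exp (- t * laplace_exponent z)"
proof (cases "z = 0")
  case True then show ?thesis by (simp add: prob_space)
next
  case False then show ?thesis using sub assms by (simp add: mixed_stable_subordinator_def laplace_exponent_def)
qed

lemma D_increment_laplace:
  assumes "0 \<le> s" "s \<le> t" "z \<ge> 0"
  shows "expectation (\<lambda>\<omega>. exp (- z * (D t \<omega> - D s \<omega>))) = exp (- (t - s) * laplace_exponent z)"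
proof -
  have [measurable]: "D t \<in> borel_measurable M" "D s \<in> borel_measurable M" "D (t - s) \<in> borel_measurable M" using assms by auto
  have "expectation (\<lambda>\<omega>. exp (- z * (D t \<omega> - D s \<omega>))) = (\<integral>x. exp (- z * x) \<partial>distr M borel (\<lambda>\<omega>. D (s + (t - s)) \<omega> - D s \<omega>))"
    by (subst integral_distr) auto
  also have "\<dots> = expectation (\<lambda>\<omega>. exp (- z * D (t - s) \<omega>))"
    using assms by (subst D_stationary) (auto simp: integral_distr)
  finally show ?thesis using assms D_laplace[of "t - s" z] by simp
qed

lemma D_increment_integrable:
  assumes "0 \<le> s" "s \<le> t" "z \<ge> 0"
  shows "integrable M (\<lambda>\<omega>. exp (- z * (D t \<omega> - D s \<omega>)))"
proof (rule integrable_const_bound[where B=1])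
  have [measurable]: "D t \<in> borel_measurable M" "D s \<in> borel_measurable M" using assms by auto
  show "(\<lambda>\<omega>. exp (- z * (D t \<omega> - D s \<omega>))) \<in> borel_measurable M" by measurable
  show "AE \<omega> in M. norm (exp (- z * (D t \<omega> - D s \<omega>))) \<le> 1"
    using D_mono
  proof eventually_elim
    case (elim \<omega>)
    then have "D s \<omega> \<le> D t \<omega>" using assms mono_onD[OF elim, of s t] by simp
    then show ?case using assms by (auto intro!: mult_nonpos_nonneg)
  qed
qed

lemma D_increments_laplace:
  assumes t: "0 \<le> t 0" "\<And>l. t l \<le> t (Suc l)" and z: "\<And>l. 0 \<le> z l"
  shows "expectation (\<lambda>\<omega>. \<Prod>l<n. exp (- z l * (D (t (Suc l)) \<omega> - D (t l) \<omega>))) =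
    (\<Prod>l<n. exp (- (t (Suc l) - t l) * laplace_exponent (z l)))"
proof -
  have t0: "0 \<le> t l" for l by (induction l) (use t in \<open>auto intro: order_trans\<close>)
  have "indep_vars (\<lambda>_. borel) (\<lambda>l \<omega>. D (t (Suc l)) \<omega> - D (t l) \<omega>) {..<n}"
    using sub t by (auto simp: mixed_stable_subordinator_def levy_process_def)
  then have "indep_vars (\<lambda>_. borel) (\<lambda>l \<omega>. exp (- z l * (D (t (Suc l)) \<omega> - D (t l) \<omega>))) {..<n}"
    by (rule indep_vars_compose2) auto
  then have "expectation (\<lambda>\<omega>. \<Prod>l<n. exp (- z l * (D (t (Suc l)) \<omega> - D (t l) \<omega>))) =
    (\<Prod>l<n. expectation (\<lambda>\<omega>. exp (- z l * (D (t (Suc l)) \<omega> - D (t l) \<omega>))))"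
    using t0 t z by (intro indep_vars_lebesgue_integral D_increment_integrable) auto
  also have "\<dots> = (\<Prod>l<n. exp (- (t (Suc l) - t l) * laplace_exponent (z l)))"
    using t0 t z by (intro prod.cong D_increment_laplace) auto
  finally show ?thesis .
qed

text \<open>An exponential Markov inequality. With \<open>K = 0\<close> and \<open>z\<close> tending
  to infinity it yields strict growth of \<open>D\<close>; with \<open>z = 1\<close> and
  \<open>t\<close> tending to infinity it yields unboundedness.\<close>

lemma prob_D_increment_le:
  assumes "0 \<le> s" "s \<le> t" "z \<ge> 0"
  shows "prob {\<omega> \<in> space M. D t \<omega> - D s \<omega> \<le> K} \<le> exp (z * K - (t - s) * laplace_exponent z)"
proof -
  have [measurable]: "D t \<in> borel_measurable M" "D s \<in> borel_measurable M" using assms by auto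
  have "prob {\<omega> \<in> space M. D t \<omega> - D s \<omega> \<le> K} = expectation (indicator {\<omega> \<in> space M. D t \<omega> - D s \<omega> \<le> K})" by simp
  also have "\<dots> \<le> expectation (\<lambda>\<omega>. exp (z * K) * exp (- z * (D t \<omega> - D s \<omega>)))"
  proof (rule integral_mono)
    show "integrable M (indicator {\<omega> \<in> space M. D t \<omega> - D s \<omega> \<le> K} :: _ \<Rightarrow> real)"
      by (rule integrable_const_bound[where B=1]) (auto simp: indicator_def)
    show "integrable M (\<lambda>\<omega>. exp (z * K) * exp (- z * (D t \<omega> - D s \<omega>)))"
      using D_increment_integrable[OF assms] by simp
    fix \<omega>
    show "indicator {\<omega> \<in> space M. D t \<omega> - D s \<omega> \<le> K} \<omega> \<le> exp (z * K) * exp (- z * (D t \<omega> - D s \<omega>))"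
      using mult_left_mono[of "D t \<omega> - D s \<omega>" K z] assms(3)
      by (auto simp: indicator_def exp_add[symmetric])
  qed
  also have "\<dots> = exp (z * K) * exp (- (t - s) * laplace_exponent z)"
    using D_increment_laplace[OF assms] by simp
  also have "\<dots> = exp (z * K - (t - s) * laplace_exponent z)" by (simp add: exp_add[symmetric] algebra_simps)
  finally show ?thesis .
qed

lemma D_strict_mono: "AE \<omega> in M. \<forall>s t. 0 \<le> s \<longrightarrow> s < t \<longrightarrow> D s \<omega> < D t \<omega>"
proof -
  have "AE \<omega> in M. D (real_of_rat p) \<omega> < D (real_of_rat q) \<omega>" if "0 \<le> p" "p < q" for p q
  proof -
    let ?s = "real_of_rat p" and ?t = "real_of_rat q"
    have st: "0 \<le> ?s" "?s < ?t" "0 \<le> ?t" using that by (auto simp: of_rat_less)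
    have [measurable]: "D ?t \<in> borel_measurable M" "D ?s \<in> borel_measurable M" using st by auto
    have "prob {\<omega> \<in> space M. D ?t \<omega> - D ?s \<omega> \<le> 0} \<le> 0"
    proof (rule tendsto_lowerbound[where F=sequentially])
      have "filterlim (\<lambda>n. (?t - ?s) * laplace_exponent (real n)) at_top sequentially"
        using st by (intro filterlim_tendsto_pos_mult_at_top[OF tendsto_const] laplace_exponent_at_top) auto
      then show "(\<lambda>n. exp (- ((?t - ?s) * laplace_exponent (real n)))) \<longlonglongrightarrow> 0"
        by (intro filterlim_compose[OF exp_at_bot]) (simp add: filterlim_uminus_at_top)
      show "eventually (\<lambda>n. prob {\<omega> \<in> space M. D ?t \<omega> - D ?s \<omega> \<le> 0} \<le> exp (- ((?t - ?s) * laplace_exponent (real n)))) sequentially"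
        using prob_D_increment_le[of ?s ?t _ 0] st by (auto simp: always_eventually)
    qed simp
    then have "prob {\<omega> \<in> space M. D ?t \<omega> - D ?s \<omega> \<le> 0} = 0" using measure_nonneg[of M] by (meson antisym)
    then have "AE \<omega> in M. \<not> D ?t \<omega> - D ?s \<omega> \<le> 0" by (subst (asm) prob_eq_0) auto
    then show ?thesis by eventually_elim auto
  qed
  then have "AE \<omega> in M. \<forall>p q. 0 \<le> p \<longrightarrow> p < q \<longrightarrow> D (real_of_rat p) \<omega> < D (real_of_rat q) \<omega>"
    by (auto simp: AE_all_countable)
  then show ?thesis using D_mono
  proof eventually_elim
    case (elim \<omega>)
    show ?case
    proof (intro allI impI)
      fix s t :: real assume st: "0 \<le> s" "s < t"
      \<comment> \<open>Strict growth is known almost surely for all rational pairs at once; two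
        rationals between \<open>s\<close> and \<open>t\<close> and monotonicity carry it
        over.\<close>
      obtain p where p: "s < real_of_rat p" "real_of_rat p < t" using of_rat_dense[OF st(2)] by blast
      obtain q where q: "real_of_rat p < real_of_rat q" "real_of_rat q < t" using of_rat_dense[OF p(2)] by blast
      have "0 < real_of_rat p" using p(1) st(1) by linarith
      moreover have "p < q" using q(1) by (simp add: of_rat_less)
      ultimately have pq: "0 \<le> p" "p < q" by simp_all
      then have "D (real_of_rat p) \<omega> < D (real_of_rat q) \<omega>" using elim by blast
      moreover have "D s \<omega> \<le> D (real_of_rat p) \<omega>" "D (real_of_rat q) \<omega> \<le> D t \<omega>"
        using p q st pq by (auto intro!: mono_onD[OF elim(2)])
      ultimately show "D s \<omega> < D t \<omega>" by simp
    qed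
  qed
qed

lemma D_unbounded: "AE \<omega> in M. \<forall>K. \<exists>s\<ge>0. K < D s \<omega>"
proof -
  have "AE \<omega> in M. \<exists>n. real K < D (real n) \<omega> - D 0 \<omega>" for K :: nat
  proof -
    have [measurable]: "D 0 \<in> borel_measurable M" "\<And>n. D (real n) \<in> borel_measurable M" by auto
    let ?A = "{\<omega> \<in> space M. \<forall>n. D (real n) \<omega> - D 0 \<omega> \<le> real K}"
    have "prob ?A \<le> 0"
    proof (rule tendsto_lowerbound[where F=sequentially])
      have "filterlim (\<lambda>n. - real K + laplace_exponent 1 * real n) at_top sequentially"
        by (intro filterlim_tendsto_add_at_top[OF tendsto_const] filterlim_tendsto_pos_mult_at_top[OF tendsto_const]
           filterlim_real_sequentially laplace_exponent_pos) auto
      then show "(\<lambda>n. exp (- (- real K + laplace_exponent 1 * real n))) \<longlonglongrightarrow> 0"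
        by (intro filterlim_compose[OF exp_at_bot]) (simp only: filterlim_uminus_at_top[symmetric])
      have "prob ?A \<le> exp (- (- real K + laplace_exponent 1 * real n))" for n
      proof -
        have "prob ?A \<le> prob {\<omega> \<in> space M. D (real n) \<omega> - D 0 \<omega> \<le> real K}"
          by (intro finite_measure_mono) auto
        also have "\<dots> \<le> exp (- (- real K + laplace_exponent 1 * real n))"
          using prob_D_increment_le[of 0 "real n" 1 "real K"] by (simp add: mult.commute)
        finally show ?thesis .
      qed
      then show "eventually (\<lambda>n. prob ?A \<le> exp (- (- real K + laplace_exponent 1 * real n))) sequentially" by simp
    qed simp
    then have "prob ?A = 0" using measure_nonneg[of M] by (meson antisym)
    then have "AE \<omega> in M. \<not> (\<forall>n. D (real n) \<omega> - D 0 \<omega> \<le> real K)" by (subst (asm) prob_eq_0) auto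
    then show ?thesis by eventually_elim (auto simp: not_le)
  qed
  then have "AE \<omega> in M. \<forall>K::nat. \<exists>n. real K < D (real n) \<omega> - D 0 \<omega>" by (simp add: AE_all_countable)
  then show ?thesis using D_0
  proof eventually_elim
    case (elim \<omega>)
    show ?case
    proof
      fix K :: real
      obtain k where "K < real k" using reals_Archimedean2 by blast
      moreover obtain n where "real k < D (real n) \<omega>" using elim by auto
      ultimately show "\<exists>s\<ge>0. K < D s \<omega>" by (intro exI[of _ "real n"]) auto
    qed
  qed
qed

definition "D_regular \<omega> \<longleftrightarrow> D 0 \<omega> = 0 \<and> mono_on {0..} (\<lambda>t. D t \<omega>) \<and>
   (\<forall>s t. 0 \<le> s \<longrightarrow> s < t \<longrightarrow> D s \<omega> < D t \<omega>) \<and> (\<forall>K. \<exists>s\<ge>0. K < D s \<omega>) \<and> cadlag_path (\<lambda>t. D t \<omega>)"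

lemma AE_D_regular: "AE \<omega> in M. D_regular \<omega>"
  using D_0 D_mono D_strict_mono D_unbounded D_cadlag by eventually_elim (simp add: D_regular_def)

section \<open>Recovery of the subordinator from its inverse\<close>

lemma inverse_subordinator_less_iff:
  assumes "D_regular \<omega>" "t > 0"
  shows "inverse_subordinator D t \<omega> < s \<longleftrightarrow> (\<exists>u. 0 \<le> u \<and> u < s \<and> t < D u \<omega>)"
proof -
  let ?S = "{u. 0 \<le> u \<and> D u \<omega> > t}"
  have "?S \<noteq> {}" using assms by (auto simp: D_regular_def)
  moreover have "bdd_below ?S" by (auto intro: bdd_belowI[of _ 0])
  ultimately have "Inf ?S < s \<longleftrightarrow> (\<exists>u\<in>?S. u < s)" by (rule cInf_less_iff)
  then show ?thesis using assms(2) by (auto simp: inverse_subordinator_def)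
qed

text \<open>The value of \<open>D\<close> at \<open>s\<close> is the infimum of the levels that are
  first exceeded after time \<open>s\<close>, by right-continuity. Rational levels keep the infimum
  countable, and the value infinity removes the levels that do not qualify. This carries the
  independence of the inverse over to \<open>D\<close>.\<close>

lemma D_eq_Inf_inverse:
  assumes R: "D_regular \<omega>" and s: "s \<ge> 0"
  shows "ereal (D s \<omega>) = (INF q\<in>{q::rat. 0 < q}. if s < inverse_subordinator D (real_of_rat q) \<omega> then ereal (real_of_rat q) else \<infinity>)"
    (is "_ = Inf (?f ` ?Q)")
proof (rule antisym)
  show "ereal (D s \<omega>) \<le> Inf (?f ` ?Q)"
  proof (rule INF_greatest)
    fix q assume q: "q \<in> ?Q"
    show "ereal (D s \<omega>) \<le> ?f q"
    proof (cases "D s \<omega> \<le> real_of_rat q")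
      case False
      have "inverse_subordinator D (real_of_rat q) \<omega> \<le> s"
      proof (rule ccontr)
        assume n: "\<not> ?thesis"
        then have "\<not> (\<exists>u. 0 \<le> u \<and> u < inverse_subordinator D (real_of_rat q) \<omega> \<and> real_of_rat q < D u \<omega>)"
          using inverse_subordinator_less_iff[OF R, of "real_of_rat q" "inverse_subordinator D (real_of_rat q) \<omega>"] q by simp
        then show False using n s False by (auto simp: not_le)
      qed
      then show ?thesis by simp
    qed auto
  qed
  show "Inf (?f ` ?Q) \<le> ereal (D s \<omega>)"
  proof (rule ereal_le_epsilon2)
    fix e :: real assume "e > 0"
    have "((\<lambda>t. D t \<omega>) \<longlongrightarrow> D s \<omega>) (at_right s)" using R s by (simp add: D_regular_def cadlag_path_def)
    moreover obtain q where q: "D s \<omega> < real_of_rat q" "real_of_rat q < D s \<omega> + e"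
      using of_rat_dense[of "D s \<omega>" "D s \<omega> + e"] \<open>e > 0\<close> by auto
    ultimately have "eventually (\<lambda>t. D t \<omega> < real_of_rat q) (at_right s)" by (simp add: order_tendstoD)
    then obtain b where b: "b > s" "\<And>y. s < y \<Longrightarrow> y < b \<Longrightarrow> D y \<omega> < real_of_rat q"
      by (auto simp: eventually_at_right_field)
    have D0: "D 0 \<omega> = 0" "0 \<le> D s \<omega>" using R s mono_onD[of "{0..}" "\<lambda>t. D t \<omega>" 0 s] by (auto simp: D_regular_def)
    then have q0: "real_of_rat q > 0" using q(1) by linarith
    define y where "y = (s + b) / 2"
    have y: "s < y" "y < b" using b(1) by (auto simp: y_def)
    have "\<not> inverse_subordinator D (real_of_rat q) \<omega> < y"
    proof
      assume "inverse_subordinator D (real_of_rat q) \<omega> < y"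
      then obtain u where u: "0 \<le> u" "u < y" "real_of_rat q < D u \<omega>"
        using inverse_subordinator_less_iff[OF R q0] by auto
      then have "D u \<omega> \<le> D y \<omega>" using R by (auto simp: D_regular_def intro!: less_imp_le)
      then show False using b(2)[OF y] u by simp
    qed
    then have f: "?f q = ereal (real_of_rat q)" using y by simp
    have "q \<in> ?Q" using q0 by simp
    then have "Inf (?f ` ?Q) \<le> ?f q" by (rule INF_lower)
    also have "?f q = ereal (real_of_rat q)" by (rule f)
    also have "\<dots> \<le> ereal (D s \<omega>) + ereal e" using q by simp
    finally show "Inf (?f ` ?Q) \<le> ereal (D s \<omega>) + ereal e" .
  qed
qed

text \<open>Up to a null set the increments of \<open>D\<close> are functions of the inverse, so
  they separate from an event determined by \<open>X\<close>; among themselves they are independent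
  by the Levy property.\<close>

lemma expectation_indep_increments:
  assumes ind: "independent_processes M S X borel (inverse_subordinator D)"
    and A: "A \<in> sets (vimage_algebra (space M) (\<lambda>\<omega>. \<lambda>t\<in>{0..}. X t \<omega>) (\<Pi>\<^sub>M t\<in>{0..}. S))"
    and t: "0 \<le> t 0" "\<And>l. t l \<le> t (Suc l)" and z: "\<And>l. 0 \<le> z l"
  shows "expectation (\<lambda>\<omega>. indicator A \<omega> * (\<Prod>l<n. exp (- z l * (D (t (Suc l)) \<omega> - D (t l) \<omega>)))) =
    prob A * (\<Prod>l<n. exp (- (t (Suc l) - t l) * laplace_exponent (z l)))"
proof -
  let ?Y = "inverse_subordinator D"
  let ?F = "vimage_algebra (space M) (\<lambda>\<omega>. \<lambda>t\<in>{0..}. X t \<omega>) (\<Pi>\<^sub>M t\<in>{0..}. S)"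
  let ?G = "vimage_algebra (space M) (\<lambda>\<omega>. \<lambda>t\<in>{0..}. ?Y t \<omega>) (\<Pi>\<^sub>M t\<in>{0..}. (borel :: real measure))"
  have t0: "0 \<le> t l" for l by (induction l) (use t in \<open>auto intro: order_trans\<close>)
  have ind': "indep_set (sets ?F) (sets ?G)" using ind by (simp add: independent_processes_def)
  then have sub': "sets ?F \<subseteq> events" "sets ?G \<subseteq> events" by (auto simp: indep_sets2_eq)
  have Y[measurable]: "?Y s \<in> borel_measurable ?G" if "s \<ge> 0" for s
  proof -
    have "(\<lambda>\<omega>. \<lambda>t\<in>{0..}. ?Y t \<omega>) \<in> measurable ?G (\<Pi>\<^sub>M t\<in>{0..}. borel)"
      by (rule measurable_vimage_algebra1) (auto simp: space_PiM)
    from measurable_compose[OF this measurable_component_singleton[of s]] that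
    show ?thesis by simp
  qed
  \<comment> \<open>A version of \<open>D\<close> that is measurable for the \<sigma>-algebra
    generated by the inverse; \<open>D\<close> itself agrees with it only almost surely.\<close>
  define D' where "D' s \<omega> = real_of_ereal (INF q\<in>{q::rat. 0 < q}. if s < ?Y (real_of_rat q) \<omega> then ereal (real_of_rat q) else \<infinity>)" for s \<omega>
  have D'[measurable]: "D' s \<in> borel_measurable ?G" for s
  proof -
    have "(\<lambda>\<omega>. if s < ?Y (real_of_rat q) \<omega> then ereal (real_of_rat q) else \<infinity>) \<in> borel_measurable ?G" if "0 < q" for q
    proof -
      have [measurable]: "?Y (real_of_rat q) \<in> borel_measurable ?G" using that by (intro Y) simp
      show ?thesis by measurable
    qed
    then have "(\<lambda>\<omega>. INF q\<in>{q::rat. 0 < q}. if s < ?Y (real_of_rat q) \<omega> then ereal (real_of_rat q) else \<infinity>) \<in> borel_measurable ?G"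
      by (intro borel_measurable_INF) auto
    then show ?thesis unfolding D'_def by simp
  qed
  have eq: "AE \<omega> in M. \<forall>s\<ge>0. D' s \<omega> = D s \<omega>"
    using AE_D_regular
  proof eventually_elim
    case (elim \<omega>)
    show ?case unfolding D'_def using D_eq_Inf_inverse[OF elim, symmetric] by simp
  qed
  define g where "g E \<omega> = (\<Prod>l<n. exp (- z l * (E (t (Suc l)) \<omega> - E (t l) \<omega>)))" for E :: "real \<Rightarrow> 'a \<Rightarrow> real" and \<omega>
  have gD': "g D' \<in> borel_measurable ?G" unfolding g_def[abs_def] by measurable
  then have gD'M: "g D' \<in> borel_measurable M"
    using sub'(2) by (auto simp: measurable_def)
  have gD: "g D \<in> borel_measurable M" unfolding g_def[abs_def] using t0 by measurable
  have geq: "AE \<omega> in M. g D' \<omega> = g D \<omega>" using eq by eventually_elim (use t0 in \<open>simp add: g_def\<close>)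
  have "AE \<omega> in M. norm (g D' \<omega>) \<le> 1"
    using geq AE_D_regular
  proof eventually_elim
    case (elim \<omega>)
    have "norm (exp (- z l * (D (t (Suc l)) \<omega> - D (t l) \<omega>))) \<le> 1" for l
    proof -
      have "D (t l) \<omega> \<le> D (t (Suc l)) \<omega>" using elim(2) t0[of l] t0[of "Suc l"] t(2)[of l]
        by (auto simp: D_regular_def intro: mono_onD[of "{0..}" "\<lambda>t. D t \<omega>"])
      then show ?thesis using z[of l] by (auto intro!: mult_nonpos_nonneg)
    qed
    then show ?case unfolding elim(1) by (auto simp: g_def abs_prod intro!: prod_le_1)
  qed
  then have int: "integrable M (g D')" by (intro integrable_const_bound[OF _ gD'M])
  have AM: "A \<in> events" using A sub' by auto
  have "expectation (\<lambda>\<omega>. indicator A \<omega> * g D \<omega>) = expectation (\<lambda>\<omega>. indicator A \<omega> * g D' \<omega>)"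
    using AM gD gD'M by (intro integral_cong_AE) (use geq in auto)
  also have "\<dots> = expectation (indicator A) * expectation (g D')"
    using A AM by (intro expectation_indep_set[OF ind' _ _ _ gD' _ int] integrable_real_indicator)
      (auto simp: emeasure_eq_measure)
  also have "expectation (g D') = expectation (g D)"
    using geq by (intro integral_cong_AE gD gD'M)
  also have "expectation (g D) = (\<Prod>l<n. exp (- (t (Suc l) - t l) * laplace_exponent (z l)))"
    unfolding g_def using t z by (rule D_increments_laplace)
  finally show ?thesis using AM by (simp add: g_def)
qed

end

section \<open>The Markov chain on a grid\<close>

lemma grid_index_cong: "(\<And>l. l < m \<Longrightarrow> d l = d' l) \<Longrightarrow> grid_index d m = grid_index d' m"
  by (simp add: grid_index_def)

lemma grid_match_cong:
  assumes "\<And>l. l \<le> m \<Longrightarrow> i l = i' l" "\<And>l. l < m \<Longrightarrow> d l = d' l"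
  shows "grid_match x h i d m \<longleftrightarrow> grid_match x h i' d' m"
proof -
  have "grid_index d l = grid_index d' l" if "l \<le> m" for l
    using assms(2) that by (intro grid_index_cong) auto
  then show ?thesis using assms(1) by (auto simp: grid_match_def less_imp_le Suc_leI simp del: grid_index_Suc)
qed

text \<open>A holding pattern prescribes the state at every grid point up to the last observed jump,
  so it is a cylinder event for one word \<open>w\<close>. The function \<open>p\<close> is left
  arbitrary: transition probabilities give the probability of the event, and a constant is enough
  for measurability.\<close>

lemma grid_match_word:
  fixes p :: "'s \<Rightarrow> 's \<Rightarrow> real"
  shows "\<exists>w. (\<forall>x. grid_match x h i d m \<longleftrightarrow> (\<forall>n\<le>grid_index d m. x (real n * h) = w n)) \<and>
    w (grid_index d m) = i m \<and> range w \<subseteq> range i \<and> w 0 = i 0 \<and>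
    (\<Prod>n<grid_index d m. p (w n) (w (Suc n))) = (\<Prod>l<m. p (i l) (i l) ^ d l * p (i l) (i (Suc l)))"
proof (induction m)
  case 0
  show ?case by (rule exI[of _ "\<lambda>_. i 0"]) (auto simp: grid_match_def)
next
  case (Suc m)
  let ?N = "grid_index d"
  obtain w where w: "\<And>x. grid_match x h i d m \<longleftrightarrow> (\<forall>n\<le>?N m. x (real n * h) = w n)" "w (?N m) = i m"
    "range w \<subseteq> range i" "w 0 = i 0"
    "(\<Prod>n<?N m. p (w n) (w (Suc n))) = (\<Prod>l<m. p (i l) (i l) ^ d l * p (i l) (i (Suc l)))"
    using Suc by blast
  \<comment> \<open>The word is continued by \<open>d m\<close> repetitions of \<open>i m\<close>
    and one letter \<open>i (Suc m)\<close>.\<close>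
  define v where "v n = (if n \<le> ?N m then w n else if n \<le> ?N m + d m then i m else i (Suc m))" for n
  have vm: "v n = i m" if "?N m \<le> n" "n \<le> ?N m + d m" for n
    using that w(2) by (cases "n = ?N m") (auto simp: v_def)
  have 1: "grid_match x h i d (Suc m) \<longleftrightarrow> (\<forall>n\<le>?N (Suc m). x (real n * h) = v n)" for x
  proof -
    have "(\<forall>n\<le>?N (Suc m). x (real n * h) = v n) \<longleftrightarrow> (\<forall>n\<le>?N m. x (real n * h) = v n) \<and>
        (\<forall>n\<in>{?N m..?N m + d m}. x (real n * h) = v n) \<and> x (real (?N (Suc m)) * h) = v (?N (Suc m))"
      by (auto simp: le_Suc_eq)
    moreover have "(\<forall>n\<le>?N m. x (real n * h) = v n) \<longleftrightarrow> grid_match x h i d m"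
      unfolding w(1) by (simp add: v_def)
    moreover have "(\<forall>n\<in>{?N m..?N m + d m}. x (real n * h) = v n) \<longleftrightarrow> (\<forall>n\<in>{?N m..?N m + d m}. x (real n * h) = i m)"
      using vm by auto
    moreover have "v (?N (Suc m)) = i (Suc m)" by (simp add: v_def)
    ultimately show ?thesis unfolding grid_match_Suc by simp
  qed
  have "{..<?N (Suc m)} = {..<?N m} \<union> {?N m..<?N m + d m} \<union> {?N m + d m}" by auto
  then have "(\<Prod>n<?N (Suc m). p (v n) (v (Suc n))) =
      (\<Prod>n\<in>{..<?N m} \<union> {?N m..<?N m + d m}. p (v n) (v (Suc n))) * p (v (?N m + d m)) (v (Suc (?N m + d m)))"
    by (simp only:) (subst prod.union_disjoint, auto)
  also have "(\<Prod>n\<in>{..<?N m} \<union> {?N m..<?N m + d m}. p (v n) (v (Suc n))) =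
      (\<Prod>n<?N m. p (v n) (v (Suc n))) * (\<Prod>n\<in>{?N m..<?N m + d m}. p (v n) (v (Suc n)))"
    by (rule prod.union_disjoint) auto
  also have "(\<Prod>n\<in>{?N m..<?N m + d m}. p (v n) (v (Suc n))) = (\<Prod>n\<in>{?N m..<?N m + d m}. p (i m) (i m))"
    using vm by (intro prod.cong) auto
  also have "(\<Prod>n<?N m. p (v n) (v (Suc n))) = (\<Prod>n<?N m. p (w n) (w (Suc n)))"
    by (intro prod.cong) (auto simp: v_def)
  also have "p (v (?N m + d m)) (v (Suc (?N m + d m))) = p (i m) (i (Suc m))"
    using vm[of "?N m + d m"] by (simp add: v_def)
  finally have 2: "(\<Prod>n<?N (Suc m). p (v n) (v (Suc n))) = (\<Prod>l<Suc m. p (i l) (i l) ^ d l * p (i l) (i (Suc l)))"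
    unfolding w(5) by simp
  have "v 0 = i 0" using w(4) by (simp add: v_def)
  moreover have "range v \<subseteq> range i" using w(3) by (auto simp: v_def)
  ultimately show ?case using 1 2 by (intro exI[of _ v] conjI allI) (simp_all add: v_def)
qed

text \<open>The sum over all holding patterns factorizes into one geometric series per jump.
  Extensional functions are used so that each pattern on the indices below \<open>m\<close> is
  counted exactly once.\<close>

lemma nn_integral_PiE_powers:
  fixes a b :: "nat \<Rightarrow> real"
  assumes "\<And>l. l < m \<Longrightarrow> 0 \<le> a l \<and> a l < 1" "\<And>l. l < m \<Longrightarrow> 0 \<le> b l"
  shows "(\<integral>\<^sup>+d. ennreal (\<Prod>l<m. a l ^ d l * b l) \<partial>count_space (PiE {..<m} (\<lambda>_. UNIV :: nat set))) =
    ennreal (\<Prod>l<m. b l / (1 - a l))"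
proof -
  interpret product_sigma_finite "\<lambda>_::nat. count_space (UNIV :: nat set)"
    by (intro product_sigma_finite.intro sigma_finite_measure_count_space_countable) auto
  have geo: "(\<integral>\<^sup>+n. ennreal (a l ^ n * b l) \<partial>count_space UNIV) = ennreal (b l / (1 - a l))" if "l < m" for l
  proof -
    have "(\<lambda>n. a l ^ n * b l) sums (1 / (1 - a l) * b l)"
      using assms(1)[OF that] by (intro sums_mult2 geometric_sums) auto
    then show ?thesis
      using assms that by (simp add: nn_integral_count_space_nat suminf_ennreal2 sums_iff)
  qed
  have "(\<integral>\<^sup>+d. ennreal (\<Prod>l<m. a l ^ d l * b l) \<partial>count_space (PiE {..<m} (\<lambda>_. UNIV :: nat set))) =
     (\<integral>\<^sup>+d. (\<Prod>l<m. ennreal (a l ^ d l * b l)) \<partial>PiM {..<m} (\<lambda>_. count_space UNIV))"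
    using assms by (subst count_space_PiM_finite) (auto intro!: nn_integral_cong prod_ennreal[symmetric])
  also have "\<dots> = (\<Prod>l<m. \<integral>\<^sup>+n. ennreal (a l ^ n * b l) \<partial>count_space UNIV)"
    by (rule product_nn_integral_prod) auto
  also have "\<dots> = ennreal (\<Prod>l<m. b l / (1 - a l))"
    using assms by (subst prod_ennreal[symmetric]) (auto intro!: prod.cong simp: geo less_imp_le)
  finally show ?thesis .
qed

text \<open>Path functionals are reached only as almost sure limits, and their values on the
  exceptional null set are uncontrolled; in the completion this does no harm to
  measurability.\<close>

lemma borel_measurable_completion_AE_lim:
  fixes f :: "nat \<Rightarrow> 'a \<Rightarrow> ennreal"
  assumes f[measurable]: "\<And>n. f n \<in> borel_measurable (completion M)"
    and lim: "AE x in completion M. (\<lambda>n. f n x) \<longlonglongrightarrow> g x"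
  shows "g \<in> borel_measurable (completion M)"
proof -
  have m: "(\<lambda>x. liminf (\<lambda>n. f n x)) \<in> borel_measurable (completion M)" by measurable
  have eq: "AE x in completion M. liminf (\<lambda>n. f n x) = g x"
    using lim by eventually_elim (simp add: lim_imp_Liminf)
  show ?thesis
  proof (rule measurableI)
    fix A :: "ennreal set" assume A: "A \<in> sets borel"
    have A': "(\<lambda>x. liminf (\<lambda>n. f n x)) -` A \<inter> space (completion M) \<in> sets (completion M)"
      using m A by (rule measurable_sets)
    have "AE x in completion M. x \<in> (\<lambda>x. liminf (\<lambda>n. f n x)) -` A \<inter> space (completion M) \<longleftrightarrow>
        x \<in> g -` A \<inter> space (completion M)"
      using eq by eventually_elim auto
    from completion.in_sets_AE[OF this A'] show "g -` A \<inter> space (completion M) \<in> sets (completion M)"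
      by auto
  qed simp
qed

text \<open>For a nondecreasing path with \<open>x 0 = 0\<close> this is the left limit at \<open>\<tau> > 0\<close>; the inserted \<open>0\<close>
  keeps the supremum meaningful at \<open>\<tau> = 0\<close>.\<close>

definition left_value :: "(real \<Rightarrow> real) \<Rightarrow> real \<Rightarrow> real" where
  "left_value x \<tau> = Sup (insert 0 (x ` {0..<\<tau>}))"

lemma left_value_less_iff:
  assumes "mono_on {0..} x"
  shows "s < left_value x \<tau> \<longleftrightarrow> s < 0 \<or> (\<exists>u. 0 \<le> u \<and> u < \<tau> \<and> s < x u)"
proof -
  have "bdd_above (insert 0 (x ` {0..<\<tau>}))"
    by (auto intro!: bdd_aboveI2[of _ _ "x \<tau>"] mono_onD[OF assms])
  then show ?thesis unfolding left_value_def by (subst less_cSup_iff) auto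
qed

text \<open>The evaluation point is the last grid point strictly before \<open>\<tau>\<close>, at
  distance at most \<open>h\<close>. By monotonicity the values approach the supremum over earlier
  times.\<close>

lemma left_grid_tendsto:
  assumes m: "mono_on {0..} x" and "x 0 = 0" and "\<tau> > 0"
  shows "((\<lambda>h. x (real (nat \<lceil>\<tau> / h\<rceil> - 1) * h)) \<longlongrightarrow> left_value x \<tau>) (at_right 0)"
proof -
  define y where "y h = real (nat \<lceil>\<tau> / h\<rceil> - 1) * h" for h
  have pos: "eventually (\<lambda>h. 0 < h) (at_right (0::real))" by (simp add: eventually_at_right_less)
  have g: "y h < \<tau>" "\<tau> - h \<le> y h" "0 \<le> y h" if "h > 0" for h
  proof -
    \<comment> \<open>As \<open>\<tau> > 0\<close>, the subtraction of 1 on the natural numbers is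
      not truncated.\<close>
    have c: "\<lceil>\<tau> / h\<rceil> \<ge> 1" using that assms(3) by (simp add: one_le_ceiling)
    have "real (nat n - 1) = of_int n - 1" if "1 \<le> n" for n :: int using that by (simp add: of_nat_diff)
    note r = this[OF c]
    have "of_int \<lceil>\<tau> / h\<rceil> - 1 < \<tau> / h" "\<tau> / h \<le> of_int \<lceil>\<tau> / h\<rceil>" by linarith+
    then show "y h < \<tau>" "\<tau> - h \<le> y h"
      unfolding y_def r using that by (simp_all only: pos_less_divide_eq pos_divide_le_eq left_diff_distrib)
    show "0 \<le> y h" using that by (simp add: y_def)
  qed
  have "((\<lambda>h. x (y h)) \<longlongrightarrow> left_value x \<tau>) (at_right 0)"
  proof (rule order_tendstoI)
    fix s assume "s < left_value x \<tau>"
    have "\<exists>u. 0 \<le> u \<and> u < \<tau> \<and> s < x u"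
    proof (cases "s < 0")
      case True
      then show ?thesis using assms(2,3) by (intro exI[of _ 0]) auto
    next
      case False
      then show ?thesis using left_value_less_iff[OF m, of s \<tau>] \<open>s < left_value x \<tau>\<close> by simp
    qed
    then obtain u where u: "0 \<le> u" "u < \<tau>" "s < x u" by blast
    have "eventually (\<lambda>h. h < \<tau> - u) (at_right (0::real))"
      unfolding eventually_at_right_field by (intro exI[of _ "\<tau> - u"]) (use u in auto)
    then show "eventually (\<lambda>h. s < x (y h)) (at_right 0)"
      using pos
    proof eventually_elim
      case (elim h)
      have "x u \<le> x (y h)"
        using g[OF elim(2)] elim u by (intro mono_onD[OF m]) auto
      then show ?case using u by simp
    qed
  next
    fix s assume s: "left_value x \<tau> < s"
    show "eventually (\<lambda>h. x (y h) < s) (at_right 0)"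
      using pos
    proof eventually_elim
      case (elim h)
      show ?case
      proof (rule ccontr)
        assume "\<not> ?thesis"
        then have le: "s \<le> x (y h)" by simp
        have "left_value x \<tau> < x (y h)" using s le by simp
        then have "left_value x \<tau> < left_value x \<tau>"
          using left_value_less_iff[OF m, of "left_value x \<tau>" \<tau>] g(1,3)[OF elim] by auto
        then show False by simp
      qed
    qed
  qed
  then show ?thesis by (simp add: y_def)
qed

locale chain_setup = subordinator_setup M D a1 a2 c1 c2
  for M :: "'a measure" and D a1 a2 c1 c2 +
  fixes Q :: "real \<Rightarrow> 'a \<Rightarrow> 's" and I :: "'s set" and i0 :: 's and P :: "real \<Rightarrow> 's \<Rightarrow> 's pmf"
    and q :: "'s \<Rightarrow> 's \<Rightarrow> real" and r :: "'s \<Rightarrow> real"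
  assumes Q_measurable: "t \<ge> 0 \<Longrightarrow> Q t \<in> measurable M (count_space I)"
    and Q_0: "AE \<omega> in M. Q 0 \<omega> = i0"
    and Q_cadlag: "AE \<omega> in M. cadlag_step_path (\<lambda>t. Q t \<omega>)"
    and Q_markov: "0 \<le> ts 0 \<Longrightarrow> (\<forall>m\<le>n. ts m < ts (Suc m)) \<Longrightarrow> (\<forall>m\<le>Suc n. i m \<in> I) \<Longrightarrow>
           measure M {\<omega> \<in> space M. \<forall>m\<le>Suc n. Q (ts m) \<omega> = i m} =
             measure M {\<omega> \<in> space M. \<forall>m\<le>n. Q (ts m) \<omega> = i m} *
             pmf (P (ts (Suc n) - ts n) (i n)) (i (Suc n))"
    and P_rate: "i' \<in> I \<Longrightarrow> j \<in> I \<Longrightarrow> i' \<noteq> j \<Longrightarrow> ((\<lambda>h. pmf (P h i') j / h) \<longlongrightarrow> q i' j) (at_right 0)"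
    and P_exit: "i' \<in> I \<Longrightarrow> ((\<lambda>h. (1 - pmf (P h i') i') / h) \<longlongrightarrow> r i') (at_right 0)"
    and r_pos: "i' \<in> I \<Longrightarrow> 0 < r i'"
    and indep: "independent_processes M (count_space I) Q borel (inverse_subordinator D)"
begin

lemma prob_grid_path:
  assumes h: "h > 0" and w: "\<And>n. w n \<in> I"
  shows "prob {\<omega> \<in> space M. \<forall>n\<le>K. Q (real n * h) \<omega> = w n} =
    (if w 0 = i0 then 1 else 0) * (\<Prod>n<K. pmf (P h (w n)) (w (Suc n)))"
proof (induction K)
  case 0
  have [measurable]: "Q 0 \<in> measurable M (count_space I)" by (rule Q_measurable) simp
  show ?case
  proof (cases "w 0 = i0")
    case True
    then have "AE \<omega> in M. Q 0 \<omega> = w 0" using Q_0 by simp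
    then show ?thesis using True by (simp add: prob_eq_1)
  next
    case False
    have "AE \<omega> in M. \<not> Q 0 \<omega> = w 0" using Q_0 by eventually_elim (use False in auto)
    then show ?thesis using False by (simp add: prob_eq_0)
  qed
next
  case (Suc K)
  have "prob {\<omega> \<in> space M. \<forall>n\<le>Suc K. Q (real n * h) \<omega> = w n} =
     prob {\<omega> \<in> space M. \<forall>n\<le>K. Q (real n * h) \<omega> = w n} *
     pmf (P (real (Suc K) * h - real K * h) (w K)) (w (Suc K))"
    using h w by (intro Q_markov[of "\<lambda>n. real n * h"]) auto
  also have "real (Suc K) * h - real K * h = h" by (simp add: algebra_simps)
  finally show ?case unfolding Suc by simp
qed

abbreviation "Q_algebra \<equiv> vimage_algebra (space M) (\<lambda>\<omega>. \<lambda>t\<in>{0..}. Q t \<omega>) (\<Pi>\<^sub>M t\<in>{0..}. count_space I)"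

lemma Q_in_I: "t \<ge> 0 \<Longrightarrow> \<omega> \<in> space M \<Longrightarrow> Q t \<omega> \<in> I"
  using measurable_space[OF Q_measurable] by simp

lemma Q_measurable_algebra: "t \<ge> 0 \<Longrightarrow> Q t \<in> measurable Q_algebra (count_space I)"
proof -
  assume t: "t \<ge> 0"
  have "(\<lambda>\<omega>. \<lambda>t\<in>{0..}. Q t \<omega>) \<in> measurable Q_algebra (\<Pi>\<^sub>M t\<in>{0..}. count_space I)"
    by (rule measurable_vimage_algebra1) (auto simp: space_PiM Q_in_I)
  from measurable_compose[OF this measurable_component_singleton[of t]] t
  show ?thesis by simp
qed

lemma grid_match_sets:
  assumes h: "h > 0" and i: "\<And>l. i l \<in> I"
  shows "{\<omega> \<in> space M. grid_match (\<lambda>t. Q t \<omega>) h i d m} \<in> sets Q_algebra"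
proof -
  obtain w where w: "\<And>x. grid_match x h i d m \<longleftrightarrow> (\<forall>n\<le>grid_index d m. x (real n * h) = w n)" "range w \<subseteq> range i"
    using grid_match_word[where p="\<lambda>_ _. 0" and h=h and i=i and d=d and m=m] by blast
  have "{\<omega> \<in> space M. grid_match (\<lambda>t. Q t \<omega>) h i d m} = (\<Inter>n\<in>{..grid_index d m}. Q (real n * h) -` {w n} \<inter> space Q_algebra)"
    unfolding w(1) by auto
  also have "\<dots> \<in> sets Q_algebra"
  proof (rule sets.finite_INT)
    fix n
    have "w n \<in> range i" using w(2) by auto
    then have "w n \<in> I" using i by auto
    then show "Q (real n * h) -` {w n} \<inter> space Q_algebra \<in> sets Q_algebra"
      using h by (intro measurable_sets[OF Q_measurable_algebra]) auto
  qed auto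
  finally show ?thesis .
qed

lemma Q_algebra_sub: "sets Q_algebra \<subseteq> events"
  using indep by (auto simp: independent_processes_def indep_sets2_eq)

lemma prob_grid_match:
  assumes h: "h > 0" and i: "\<And>l. i l \<in> I" "i 0 = i0"
  shows "prob {\<omega> \<in> space M. grid_match (\<lambda>t. Q t \<omega>) h i d m} =
    (\<Prod>l<m. pmf (P h (i l)) (i l) ^ d l * pmf (P h (i l)) (i (Suc l)))"
proof -
  obtain w where w: "\<And>x. grid_match x h i d m \<longleftrightarrow> (\<forall>n\<le>grid_index d m. x (real n * h) = w n)" "range w \<subseteq> range i"
    "w 0 = i 0" "(\<Prod>n<grid_index d m. pmf (P h (w n)) (w (Suc n))) = (\<Prod>l<m. pmf (P h (i l)) (i l) ^ d l * pmf (P h (i l)) (i (Suc l)))"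
    using grid_match_word[where p="\<lambda>a b. pmf (P h a) b" and h=h and i=i and d=d and m=m] by blast
  have wI: "w n \<in> I" for n
  proof -
    have "w n \<in> range i" using w(2) by auto
    then show ?thesis using i by auto
  qed
  show ?thesis unfolding w(1) prob_grid_path[of h w, OF h wI] w(4) using w(3) i(2) by simp
qed

text \<open>Evaluating \<open>D\<close> at the grid point before each observed jump leads to the left limits of \<open>D\<close>
  at the jump times when the mesh tends to \<open>0\<close>.\<close>

definition grid_weight :: "real \<Rightarrow> (nat \<Rightarrow> real) \<Rightarrow> (nat \<Rightarrow> nat) \<Rightarrow> nat \<Rightarrow> 'a \<Rightarrow> real" where
  "grid_weight h z d m \<omega> = (\<Prod>l<m. exp (- z l * (D (real (grid_index d (Suc l) - 1) * h) \<omega> -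
     D (real (grid_index d l - 1) * h) \<omega>)))"

lemma grid_weight_measurable: "h > 0 \<Longrightarrow> grid_weight h z d m \<in> borel_measurable M"
  unfolding grid_weight_def[abs_def] by (intro borel_measurable_prod borel_measurable_exp borel_measurable_times
    borel_measurable_diff borel_measurable_const D_measurable) auto

lemma grid_weight_bounds:
  assumes "h > 0" "\<And>l. 0 \<le> z l" "mono_on {0..} (\<lambda>t. D t \<omega>)"
  shows "0 \<le> grid_weight h z d m \<omega>" "grid_weight h z d m \<omega> \<le> 1"
proof -
  have "D (real (grid_index d l - 1) * h) \<omega> \<le> D (real (grid_index d (Suc l) - 1) * h) \<omega>" for l
    using assms(1) by (intro mono_onD[OF assms(3)]) (auto intro!: mult_right_mono)
  then show "grid_weight h z d m \<omega> \<le> 1"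
    unfolding grid_weight_def using assms(2) by (intro prod_le_1) (auto intro!: mult_nonpos_nonneg)
  show "0 \<le> grid_weight h z d m \<omega>" unfolding grid_weight_def by (intro prod_nonneg) auto
qed

text \<open>Independence splits the pattern probability from the Laplace factor of the increments.
  Regrouping by jumps shows a power \<open>d l\<close> of the staying probability damped by
  \<open>exp (- h * laplace_exponent (z l))\<close>, ready for geometric summation.\<close>

lemma expectation_grid_match:
  assumes h: "h > 0" and i: "\<And>l. i l \<in> I" "i 0 = i0" and z: "\<And>l. 0 \<le> z l" "z 0 = 0"
  shows "(\<integral>\<^sup>+\<omega>. ennreal (indicator {\<omega> \<in> space M. grid_match (\<lambda>t. Q t \<omega>) h i d m} \<omega> * grid_weight h z d m \<omega>) \<partial>M) =
    ennreal (\<Prod>l<m. (pmf (P h (i l)) (i l) * exp (- h * laplace_exponent (z l))) ^ d l *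
      (pmf (P h (i l)) (i (Suc l)) * exp (- h * laplace_exponent (z l))))"
proof -
  let ?A = "{\<omega> \<in> space M. grid_match (\<lambda>t. Q t \<omega>) h i d m}"
  define T where "T l = real (grid_index d l - 1) * h" for l
  have T: "0 \<le> T 0" "T l \<le> T (Suc l)" for l
    using h by (auto simp: T_def intro!: mult_right_mono)
  have A: "?A \<in> sets Q_algebra" by (rule grid_match_sets[OF h i(1)])
  then have [measurable]: "?A \<in> events" using Q_algebra_sub by auto
  have [measurable]: "grid_weight h z d m \<in> borel_measurable M" using h by (rule grid_weight_measurable)
  have b: "AE \<omega> in M. 0 \<le> grid_weight h z d m \<omega> \<and> grid_weight h z d m \<omega> \<le> 1"
    using D_mono by eventually_elim (use grid_weight_bounds[of h z] h z in auto)
  have int: "integrable M (\<lambda>\<omega>. indicator ?A \<omega> * grid_weight h z d m \<omega>)"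
  proof (rule integrable_const_bound[where B=1])
    show "AE \<omega> in M. norm (indicator ?A \<omega> * grid_weight h z d m \<omega>) \<le> 1"
      using b by eventually_elim (auto simp: indicator_def)
  qed measurable
  have "(\<integral>\<^sup>+\<omega>. ennreal (indicator ?A \<omega> * grid_weight h z d m \<omega>) \<partial>M) = ennreal (expectation (\<lambda>\<omega>. indicator ?A \<omega> * grid_weight h z d m \<omega>))"
    using b by (intro nn_integral_eq_integral[OF int]) (auto elim!: eventually_mono)
  also have "expectation (\<lambda>\<omega>. indicator ?A \<omega> * grid_weight h z d m \<omega>) =
      prob ?A * (\<Prod>l<m. exp (- (T (Suc l) - T l) * laplace_exponent (z l)))"
    unfolding grid_weight_def T_def[symmetric]
    using T z by (intro expectation_indep_increments[OF indep A]) auto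
  also have "(\<Prod>l<m. exp (- (T (Suc l) - T l) * laplace_exponent (z l))) =
      (\<Prod>l<m. exp (- h * laplace_exponent (z l)) ^ Suc (d l))"
  proof (rule prod.cong[OF refl])
    fix l
    show "exp (- (T (Suc l) - T l) * laplace_exponent (z l)) = exp (- h * laplace_exponent (z l)) ^ Suc (d l)"
    proof (cases l)
      \<comment> \<open>The evaluation point at index 0 stays at time 0 by truncated subtraction, so
        the first increment covers \<open>d 0\<close> steps instead of \<open>Suc (d 0)\<close>. The
        factor is 1 on both sides because \<open>z 0 = 0\<close>.\<close>
      case 0 then show ?thesis using z by simp
    next
      case (Suc k)
      have "T (Suc l) - T l = real (Suc (d l)) * h"
        by (simp add: T_def Suc algebra_simps)
      then show ?thesis by (simp only: exp_of_nat_mult[symmetric]) (simp add: algebra_simps)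
    qed
  qed
  also have "prob ?A * (\<Prod>l<m. exp (- h * laplace_exponent (z l)) ^ Suc (d l)) =
     (\<Prod>l<m. (pmf (P h (i l)) (i l) * exp (- h * laplace_exponent (z l))) ^ d l *
      (pmf (P h (i l)) (i (Suc l)) * exp (- h * laplace_exponent (z l))))"
    unfolding prob_grid_match[of h i, OF h i] prod.distrib[symmetric]
    by (intro prod.cong) (auto simp: power_mult_distrib mult_ac)
  finally show ?thesis .
qed

text \<open>Over all holding patterns at most one term is nonzero when consecutive states differ, so
  along a path this is a bounded functional, while its expectation is an explicit product of
  geometric sums.\<close>

definition grid_sum :: "real \<Rightarrow> (nat \<Rightarrow> 's) \<Rightarrow> (nat \<Rightarrow> real) \<Rightarrow> nat \<Rightarrow> 'a \<Rightarrow> ennreal" where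
  "grid_sum h i z m \<omega> = (\<integral>\<^sup>+d. ennreal (indicator {\<omega> \<in> space M. grid_match (\<lambda>t. Q t \<omega>) h i d m} \<omega> *
     grid_weight h z d m \<omega>) \<partial>count_space (PiE {..<m} (\<lambda>_. UNIV)))"

lemma countable_grid: "countable (PiE {..<m::nat} (\<lambda>_. UNIV :: nat set))"
  by (intro countable_PiE) auto

lemma grid_term_measurable:
  assumes "h > 0" "\<And>l. i l \<in> I"
  shows "(\<lambda>\<omega>. ennreal (indicator {\<omega> \<in> space M. grid_match (\<lambda>t. Q t \<omega>) h i d m} \<omega> * grid_weight h z d m \<omega>)) \<in> borel_measurable M"
proof -
  have [measurable]: "{\<omega> \<in> space M. grid_match (\<lambda>t. Q t \<omega>) h i d m} \<in> events"
    by (rule subsetD[OF Q_algebra_sub grid_match_sets[of h i, OF assms]])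
  have [measurable]: "grid_weight h z d m \<in> borel_measurable M" using assms(1) by (rule grid_weight_measurable)
  show ?thesis by measurable
qed

lemma grid_sum_measurable:
  assumes "h > 0" "\<And>l. i l \<in> I"
  shows "grid_sum h i z m \<in> borel_measurable M"
proof -
  interpret sigma_finite_measure "count_space (PiE {..<m} (\<lambda>_. UNIV :: nat set))"
    by (rule sigma_finite_measure_count_space_countable[OF countable_grid])
  show ?thesis
    unfolding grid_sum_def[abs_def]
  proof (rule borel_measurable_nn_integral)
    show "(\<lambda>(\<omega>, d). ennreal (indicator {\<omega> \<in> space M. grid_match (\<lambda>t. Q t \<omega>) h i d m} \<omega> * grid_weight h z d m \<omega>)) \<in>
      borel_measurable (M \<Otimes>\<^sub>M count_space (PiE {..<m} (\<lambda>_. UNIV)))"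
      using measurable_pair_swap[OF measurable_pair_measure_countable1[OF countable_grid, where f="\<lambda>(d, \<omega>). ennreal (indicator {\<omega> \<in> space M. grid_match (\<lambda>t. Q t \<omega>) h i d m} \<omega> * grid_weight h z d m \<omega>)"]]
        grid_term_measurable[OF assms] by simp
  qed
qed

lemma nn_integral_grid_sum:
  assumes h: "h > 0" and i: "\<And>l. i l \<in> I" "i 0 = i0" and z: "\<And>l. 0 \<le> z l" "z 0 = 0"
    and lt: "\<And>l. l < m \<Longrightarrow> pmf (P h (i l)) (i l) < 1"
  shows "(\<integral>\<^sup>+\<omega>. grid_sum h i z m \<omega> \<partial>M) = ennreal (\<Prod>l<m. pmf (P h (i l)) (i (Suc l)) * exp (- h * laplace_exponent (z l)) /
     (1 - pmf (P h (i l)) (i l) * exp (- h * laplace_exponent (z l))))"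
proof -
  have e: "exp (- h * laplace_exponent (z l)) \<le> 1" for l
    using h laplace_exponent_nonneg[of "z l"] by (auto intro!: mult_nonpos_nonneg)
  have "(\<integral>\<^sup>+\<omega>. grid_sum h i z m \<omega> \<partial>M) =
     (\<integral>\<^sup>+d. \<integral>\<^sup>+\<omega>. ennreal (indicator {\<omega> \<in> space M. grid_match (\<lambda>t. Q t \<omega>) h i d m} \<omega> *
     grid_weight h z d m \<omega>) \<partial>M \<partial>count_space (PiE {..<m} (\<lambda>_. UNIV)))"
    unfolding grid_sum_def by (rule nn_integral_count_space_nn_integral[OF countable_grid grid_term_measurable[OF h i(1)]])
  also have "\<dots> = ennreal (\<Prod>l<m. pmf (P h (i l)) (i (Suc l)) * exp (- h * laplace_exponent (z l)) /
     (1 - pmf (P h (i l)) (i l) * exp (- h * laplace_exponent (z l))))"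
    unfolding expectation_grid_match[of h i z, OF h i z]
  proof (rule nn_integral_PiE_powers)
    fix l assume "l < m"
    have "pmf (P h (i l)) (i l) * exp (- h * laplace_exponent (z l)) \<le> pmf (P h (i l)) (i l) * 1"
      by (rule mult_left_mono[OF e]) simp
    then show "0 \<le> pmf (P h (i l)) (i l) * exp (- h * laplace_exponent (z l)) \<and>
      pmf (P h (i l)) (i l) * exp (- h * laplace_exponent (z l)) < 1"
      using lt[OF \<open>l < m\<close>] by simp
  qed simp
  finally show ?thesis .
qed

text \<open>Numerator and denominator of every geometric factor are divided by \<open>h\<close>: the
  first tends to the jump rate, the second to the exit rate plus the Laplace exponent. Positivity of
  the exit rate keeps the ratio of the geometric series below 1 for small \<open>h\<close>.\<close>

lemma grid_integral_tendsto:
  assumes i: "\<And>l. i l \<in> I" "i 0 = i0" and ne: "\<And>l. l < m \<Longrightarrow> i l \<noteq> i (Suc l)" and z: "\<And>l. 0 \<le> z l" "z 0 = 0"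
  shows "((\<lambda>h. \<integral>\<^sup>+\<omega>. grid_sum h i z m \<omega> \<partial>M) \<longlongrightarrow>
    ennreal (\<Prod>l<m. q (i l) (i (Suc l)) / (r (i l) + laplace_exponent (z l)))) (at_right 0)"
proof -
  have pos: "eventually (\<lambda>h. 0 < h) (at_right (0::real))" by (simp add: eventually_at_right_less)
  have lt: "eventually (\<lambda>h. pmf (P h (i l)) (i l) < 1) (at_right 0)" for l
  proof -
    have "eventually (\<lambda>h. 0 < (1 - pmf (P h (i l)) (i l)) / h) (at_right 0)"
      using order_tendstoD(1)[OF P_exit[OF i(1)] r_pos[OF i(1)]] .
    then show ?thesis using pos by eventually_elim (simp add: zero_less_divide_iff)
  qed
  have factor: "((\<lambda>h. pmf (P h (i l)) (i (Suc l)) * exp (- h * laplace_exponent (z l)) /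
     (1 - pmf (P h (i l)) (i l) * exp (- h * laplace_exponent (z l)))) \<longlongrightarrow>
     q (i l) (i (Suc l)) / (r (i l) + laplace_exponent (z l))) (at_right 0)" if l: "l < m" for l
  proof -
    let ?c = "laplace_exponent (z l)" and ?p = "\<lambda>h. pmf (P h (i l)) (i l)"
    have e1: "((\<lambda>h. exp (- h * ?c)) \<longlongrightarrow> 1) (at_right 0)"
    proof -
      have "((\<lambda>h. exp (- h * ?c)) \<longlongrightarrow> exp (- 0 * ?c)) (at_right 0)" by (intro tendsto_intros)
      then show ?thesis by simp
    qed
    have "((\<lambda>x. exp (- ?c * x)) has_field_derivative (- ?c)) (at 0)"
      by (auto intro!: derivative_eq_intros)
    then have "((\<lambda>h. (exp (- ?c * (0 + h)) - exp (- ?c * 0)) / h) \<longlongrightarrow> - ?c) (at 0)"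
      by (simp only: DERIV_def)
    then have "((\<lambda>h. (exp (- h * ?c) - 1) / h) \<longlongrightarrow> - ?c) (at_right 0)"
      by (intro tendsto_mono[OF at_le[of "{0<..}" UNIV 0]]) (auto simp: mult.commute)
    then have e2: "((\<lambda>h. (1 - exp (- h * ?c)) / h) \<longlongrightarrow> ?c) (at_right 0)"
    proof -
      assume "((\<lambda>h. (exp (- h * ?c) - 1) / h) \<longlongrightarrow> - ?c) (at_right 0)"
      from tendsto_minus[OF this] have "((\<lambda>h. - ((exp (- h * ?c) - 1) / h)) \<longlongrightarrow> ?c) (at_right 0)" by simp
      moreover have "- ((exp (- h * ?c) - 1) / h) = (1 - exp (- h * ?c)) / h" for h
        by (simp add: diff_divide_distrib)
      ultimately show ?thesis by simp
    qed
    \<comment> \<open>Leaving the state and being damped are separated, so that each difference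
      quotient has its own limit.\<close>
    have "((\<lambda>h. (1 - ?p h) / h * exp (- h * ?c) + (1 - exp (- h * ?c)) / h) \<longlongrightarrow> r (i l) * 1 + ?c) (at_right 0)"
      by (intro tendsto_intros P_exit i e1 e2)
    moreover have "(1 - ?p h) / h * exp (- h * ?c) + (1 - exp (- h * ?c)) / h = (1 - ?p h * exp (- h * ?c)) / h" for h
      by (simp add: diff_divide_distrib left_diff_distrib)
    ultimately have D: "((\<lambda>h. (1 - ?p h * exp (- h * ?c)) / h) \<longlongrightarrow> r (i l) + ?c) (at_right 0)" by simp
    have "((\<lambda>h. pmf (P h (i l)) (i (Suc l)) / h * exp (- h * ?c)) \<longlongrightarrow> q (i l) (i (Suc l)) * 1) (at_right 0)"
      by (intro tendsto_mult P_rate i ne l e1)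
    from tendsto_divide[OF this D]
    have "((\<lambda>h. (pmf (P h (i l)) (i (Suc l)) / h * exp (- h * ?c)) / ((1 - ?p h * exp (- h * ?c)) / h)) \<longlongrightarrow>
       q (i l) (i (Suc l)) / (r (i l) + ?c)) (at_right 0)"
      using r_pos[OF i(1), of l] laplace_exponent_nonneg[of "z l"] by simp
    then show ?thesis
      by (rule Lim_transform_eventually) (use pos in \<open>eventually_elim, simp\<close>)
  qed
  have "((\<lambda>h. ennreal (\<Prod>l<m. pmf (P h (i l)) (i (Suc l)) * exp (- h * laplace_exponent (z l)) /
     (1 - pmf (P h (i l)) (i l) * exp (- h * laplace_exponent (z l))))) \<longlongrightarrow>
     ennreal (\<Prod>l<m. q (i l) (i (Suc l)) / (r (i l) + laplace_exponent (z l)))) (at_right 0)"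
    by (intro tendsto_ennrealI tendsto_prod factor) auto
  moreover have "eventually (\<lambda>h. \<forall>l\<in>{..<m}. pmf (P h (i l)) (i l) < 1) (at_right 0)"
    by (intro eventually_ball_finite ballI lt) auto
  then have "eventually (\<lambda>h. ennreal (\<Prod>l<m. pmf (P h (i l)) (i (Suc l)) * exp (- h * laplace_exponent (z l)) /
     (1 - pmf (P h (i l)) (i l) * exp (- h * laplace_exponent (z l)))) = (\<integral>\<^sup>+\<omega>. grid_sum h i z m \<omega> \<partial>M)) (at_right 0)"
    using pos by eventually_elim (rule nn_integral_grid_sum[of _ i z, OF _ i z, symmetric], auto)
  ultimately show ?thesis by (rule Lim_transform_eventually)
qed

end

section \<open>The limit of vanishing mesh\<close>

context chain_setup
begin

definition jump_clock :: "'a \<Rightarrow> nat \<Rightarrow> real" where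
  "jump_clock \<omega> l = left_value (\<lambda>t. D t \<omega>) (jump_time (\<lambda>t. Q t \<omega>) l)"

definition jumps_through :: "(nat \<Rightarrow> 's) \<Rightarrow> nat \<Rightarrow> 'a \<Rightarrow> bool" where
  "jumps_through i m \<omega> \<longleftrightarrow> has_jumps (\<lambda>t. Q t \<omega>) m \<and> (\<forall>l\<le>m. jump_state (\<lambda>t. Q t \<omega>) l = i l)"

definition jump_weight :: "(nat \<Rightarrow> 's) \<Rightarrow> (nat \<Rightarrow> real) \<Rightarrow> nat \<Rightarrow> 'a \<Rightarrow> real" where
  "jump_weight i z m \<omega> = (if jumps_through i m \<omega>
     then \<Prod>l<m. exp (- z l * (jump_clock \<omega> (Suc l) - jump_clock \<omega> l)) else 0)"

lemma grid_sum_eq: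
  assumes \<omega>: "\<omega> \<in> space M" and ne: "\<And>l. l < m \<Longrightarrow> i l \<noteq> i (Suc l)"
    and d: "grid_match (\<lambda>t. Q t \<omega>) h i d m"
  shows "grid_sum h i z m \<omega> = ennreal (grid_weight h z d m \<omega>)"
proof -
  \<comment> \<open>The representative of the pattern among the extensional functions over which the
    sum runs.\<close>
  define e where "e = restrict d {..<m}"
  have e: "e \<in> PiE {..<m} (\<lambda>_. UNIV)" by (simp add: e_def)
  have de: "e l = d l" if "l < m" for l using that by (simp add: e_def)
  have me: "grid_match (\<lambda>t. Q t \<omega>) h i e m"
    using d grid_match_cong[of m i i e d "\<lambda>t. Q t \<omega>" h] de by simp
  have we: "grid_weight h z e m \<omega> = grid_weight h z d m \<omega>"
  proof -
    have "grid_index e l = grid_index d l" if "l \<le> m" for l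
      using de that by (intro grid_index_cong) auto
    then show ?thesis unfolding grid_weight_def by (intro prod.cong) (auto simp del: grid_index_Suc)
  qed
  have uniq: "d' = e" if "d' \<in> PiE {..<m} (\<lambda>_. UNIV)" "grid_match (\<lambda>t. Q t \<omega>) h i d' m" for d'
  proof (rule PiE_ext[OF that(1) e])
    have g: "grid_index d' l = grid_index e l" if "l \<le> m" for l
      using grid_match_unique[OF \<open>grid_match (\<lambda>t. Q t \<omega>) h i d' m\<close> me ne ne that] by simp
    fix l assume "l \<in> {..<m}"
    then show "d' l = e l" using g[of l] g[of "Suc l"] by simp
  qed
  let ?f = "\<lambda>d. ennreal (indicator {\<omega> \<in> space M. grid_match (\<lambda>t. Q t \<omega>) h i d m} \<omega> * grid_weight h z d m \<omega>)"
  have "grid_sum h i z m \<omega> = (\<integral>\<^sup>+d. ?f d \<partial>count_space {e})"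
    unfolding grid_sum_def using uniq e by (intro nn_integral_count_space_eq) (auto simp: indicator_def)
  also have "\<dots> = ?f e" by (simp add: nn_integral_count_space_finite)
  also have "\<dots> = ennreal (grid_weight h z d m \<omega>)" using me \<omega> we by simp
  finally show ?thesis .
qed

lemma grid_sum_eq_0:
  assumes "\<And>d. \<not> grid_match (\<lambda>t. Q t \<omega>) h i d m" shows "grid_sum h i z m \<omega> = 0"
  using assms by (simp add: grid_sum_def)

lemma grid_sum_le_1:
  assumes "\<omega> \<in> space M" "mono_on {0..} (\<lambda>t. D t \<omega>)" "\<And>l. l < m \<Longrightarrow> i l \<noteq> i (Suc l)" "h > 0" "\<And>l. 0 \<le> z l"
  shows "grid_sum h i z m \<omega> \<le> 1"
proof (cases "\<exists>d. grid_match (\<lambda>t. Q t \<omega>) h i d m")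
  case True
  then obtain d where "grid_match (\<lambda>t. Q t \<omega>) h i d m" by blast
  then have "grid_sum h i z m \<omega> = ennreal (grid_weight h z d m \<omega>)" using assms by (intro grid_sum_eq) auto
  then show ?thesis using grid_weight_bounds(2)[of h z] assms by (simp add: ennreal_le_1)
next
  case False
  then show ?thesis by (simp add: grid_sum_eq_0)
qed

lemma grid_sum_tendsto:
  assumes \<omega>: "\<omega> \<in> space M" and R: "D_regular \<omega>" and c: "cadlag_step_path (\<lambda>t. Q t \<omega>)"
    and ne: "\<And>l. l < m \<Longrightarrow> i l \<noteq> i (Suc l)" and z: "z 0 = 0"
  shows "((\<lambda>h. grid_sum h i z m \<omega>) \<longlongrightarrow> ennreal (jump_weight i z m \<omega>)) (at_right 0)"
proof (cases "jumps_through i m \<omega>")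
  case False
  then have "eventually (\<lambda>h. \<forall>d. \<not> grid_match (\<lambda>t. Q t \<omega>) h i d m) (at_right 0)"
    by (intro grid_match_only_jumps[OF c] ne) (auto simp: jumps_through_def)
  then have "eventually (\<lambda>h. grid_sum h i z m \<omega> = 0) (at_right 0)"
    by eventually_elim (simp add: grid_sum_eq_0)
  then show ?thesis using False by (simp add: jump_weight_def tendsto_eventually)
next
  case True
  let ?x = "\<lambda>t. Q t \<omega>"
  have J: "has_jumps ?x m" and st: "\<And>l. l \<le> m \<Longrightarrow> jump_state ?x l = i l"
    using True by (auto simp: jumps_through_def)
  have D: "mono_on {0..} (\<lambda>t. D t \<omega>)" "D 0 \<omega> = 0" using R by (auto simp: D_regular_def)
  let ?y = "\<lambda>l h. D (real (nat \<lceil>jump_time ?x l / h\<rceil> - 1) * h) \<omega>"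
  have lim: "((\<lambda>h. \<Prod>l<m. exp (- z l * (?y (Suc l) h - ?y l h))) \<longlongrightarrow>
      (\<Prod>l<m. exp (- z l * (jump_clock \<omega> (Suc l) - jump_clock \<omega> l)))) (at_right 0)"
  proof (rule tendsto_prod)
    fix l assume l: "l \<in> {..<m}"
    have y: "(?y l' \<longlongrightarrow> jump_clock \<omega> l') (at_right 0)" if "0 < l'" "l' \<le> m" for l'
    proof -
      have "0 < jump_time ?x l'"
        using has_jumpsD(1)[OF c J, of "l' - 1"] jump_time_nonneg[OF c J, of "l' - 1"] that
        by (cases l') auto
      then show ?thesis unfolding jump_clock_def by (rule left_grid_tendsto[OF D])
    qed
    show "((\<lambda>h. exp (- z l * (?y (Suc l) h - ?y l h))) \<longlongrightarrow> exp (- z l * (jump_clock \<omega> (Suc l) - jump_clock \<omega> l))) (at_right 0)"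
    proof (cases "l = 0")
      \<comment> \<open>Convergence to the left limit is available at positive jump times;
        \<open>z 0 = 0\<close> removes the one factor that involves the jump time 0.\<close>
      case True then show ?thesis using z by simp
    next
      case False
      then show ?thesis using l by (intro tendsto_intros y) auto
    qed
  qed
  have "eventually (\<lambda>h. (\<Prod>l<m. exp (- z l * (?y (Suc l) h - ?y l h))) = enn2real (grid_sum h i z m \<omega>) \<and> grid_sum h i z m \<omega> < top) (at_right 0)"
    using grid_match_exists[OF c J]
  proof eventually_elim
    case (elim h)
    then obtain d where d: "\<forall>l\<le>m. grid_index d l = nat \<lceil>jump_time ?x l / h\<rceil>" "grid_match ?x h (jump_state ?x) d m" by blast
    have "grid_match ?x h i d m"
      using d(2) grid_match_cong[of m "jump_state ?x" i d d ?x h] st by simp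
    then have "grid_sum h i z m \<omega> = ennreal (grid_weight h z d m \<omega>)" using \<omega> ne by (intro grid_sum_eq) auto
    moreover have "grid_weight h z d m \<omega> = (\<Prod>l<m. exp (- z l * (?y (Suc l) h - ?y l h)))"
      unfolding grid_weight_def using d(1) by (intro prod.cong) (auto simp del: grid_index_Suc)
    ultimately show ?case by (simp add: prod_nonneg)
  qed
  then have "eventually (\<lambda>h. ennreal (\<Prod>l<m. exp (- z l * (?y (Suc l) h - ?y l h))) = grid_sum h i z m \<omega>) (at_right 0)"
    by eventually_elim (metis ennreal_enn2real)
  moreover have "((\<lambda>h. ennreal (\<Prod>l<m. exp (- z l * (?y (Suc l) h - ?y l h)))) \<longlongrightarrow> ennreal (jump_weight i z m \<omega>)) (at_right 0)"
    using tendsto_ennrealI[OF lim] True by (simp add: jump_weight_def)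
  ultimately show ?thesis by (rule Lim_transform_eventually[rotated])
qed

text \<open>Grid sums converge to the weight almost surely and are bounded by 1, so dominated
  convergence along the meshes \<open>1 / real (Suc n)\<close> identifies the expectation with the
  limit of the grid expectations.\<close>

theorem jump_weight_integral:
  assumes i: "\<And>l. i l \<in> I" "i 0 = i0" and ne: "\<And>l. l < m \<Longrightarrow> i l \<noteq> i (Suc l)" and z: "\<And>l. 0 \<le> z l" "z 0 = 0"
  shows "(\<lambda>\<omega>. ennreal (jump_weight i z m \<omega>)) \<in> borel_measurable (completion M)"
    and "(\<integral>\<^sup>+\<omega>. ennreal (jump_weight i z m \<omega>) \<partial>completion M) =
      ennreal (\<Prod>l<m. q (i l) (i (Suc l)) / (r (i l) + laplace_exponent (z l)))"
proof -
  define h where "h n = 1 / real (Suc n)" for n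
  have h0: "h n > 0" for n by (simp add: h_def)
  have hl: "filterlim h (at_right 0) sequentially"
    unfolding filterlim_at
    using h0 LIMSEQ_inverse_real_of_nat by (auto simp: h_def[abs_def] inverse_eq_divide intro!: always_eventually)
  have lim: "AE \<omega> in M. (\<lambda>n. grid_sum (h n) i z m \<omega>) \<longlonglongrightarrow> ennreal (jump_weight i z m \<omega>)"
    using AE_D_regular Q_cadlag AE_space
  proof eventually_elim
    case (elim \<omega>)
    from grid_sum_tendsto[of \<omega> m i z, OF elim(3,1,2) ne z(2)] hl show ?case by (rule filterlim_compose)
  qed
  have m: "grid_sum (h n) i z m \<in> borel_measurable M" for n by (rule grid_sum_measurable[OF h0 i(1)])
  show W: "(\<lambda>\<omega>. ennreal (jump_weight i z m \<omega>)) \<in> borel_measurable (completion M)"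
    by (rule borel_measurable_completion_AE_lim[OF measurable_completion[OF m] AE_completion[OF lim]])
  have "(\<lambda>n. \<integral>\<^sup>+\<omega>. grid_sum (h n) i z m \<omega> \<partial>completion M) \<longlonglongrightarrow> (\<integral>\<^sup>+\<omega>. ennreal (jump_weight i z m \<omega>) \<partial>completion M)"
  proof (rule nn_integral_dominated_convergence[where w="\<lambda>_. 1"])
    show "grid_sum (h n) i z m \<in> borel_measurable (completion M)" for n by (intro measurable_completion m)
    show "AE \<omega> in completion M. grid_sum (h n) i z m \<omega> \<le> 1" for n
      using AE_completion[OF AE_conjI[OF D_mono AE_space]] by eventually_elim (intro grid_sum_le_1 ne h0 z, auto)
    show "(\<integral>\<^sup>+\<omega>. 1 \<partial>completion M) < \<infinity>"
      by (simp add: emeasure_space_1)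
    show "AE \<omega> in completion M. (\<lambda>n. grid_sum (h n) i z m \<omega>) \<longlonglongrightarrow> ennreal (jump_weight i z m \<omega>)"
      by (rule AE_completion[OF lim])
  qed (use W in simp_all)
  then have "(\<lambda>n. \<integral>\<^sup>+\<omega>. grid_sum (h n) i z m \<omega> \<partial>M) \<longlonglongrightarrow> (\<integral>\<^sup>+\<omega>. ennreal (jump_weight i z m \<omega>) \<partial>completion M)"
    by (simp add: nn_integral_completion)
  moreover have "(\<lambda>n. \<integral>\<^sup>+\<omega>. grid_sum (h n) i z m \<omega> \<partial>M) \<longlonglongrightarrow>
      ennreal (\<Prod>l<m. q (i l) (i (Suc l)) / (r (i l) + laplace_exponent (z l)))"
    by (rule filterlim_compose[OF grid_integral_tendsto[of i m z, OF i ne z] hl])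
  ultimately show "(\<integral>\<^sup>+\<omega>. ennreal (jump_weight i z m \<omega>) \<partial>completion M) =
      ennreal (\<Prod>l<m. q (i l) (i (Suc l)) / (r (i l) + laplace_exponent (z l)))"
    by (rule LIMSEQ_unique)
qed

text \<open>The inverse lies below the \<open>k\<close>-th jump time of the chain exactly when
  \<open>t\<close> lies below the left limit of \<open>D\<close> there, since both say that
  \<open>D\<close> exceeds \<open>t\<close> before that time. The half-open holding intervals of the
  chain are thereby carried to those of the time-changed path.\<close>

lemma time_changed_path:
  assumes R: "D_regular \<omega>" and c: "cadlag_step_path (\<lambda>t. Q t \<omega>)" and J: "\<And>m. has_jumps (\<lambda>t. Q t \<omega>) m"
  shows "jump_clock \<omega> 0 = 0" and "jump_clock \<omega> l < jump_clock \<omega> (Suc l)"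
    and "\<exists>l. t < jump_clock \<omega> l"
    and "jump_clock \<omega> l \<le> t \<Longrightarrow> t < jump_clock \<omega> (Suc l) \<Longrightarrow>
      time_changed Q (inverse_subordinator D) t \<omega> = jump_state (\<lambda>t. Q t \<omega>) l"
proof -
  let ?x = "\<lambda>t. Q t \<omega>" and ?D = "\<lambda>t. D t \<omega>"
  have D: "mono_on {0..} ?D" "D 0 \<omega> = 0" "\<And>s t. 0 \<le> s \<Longrightarrow> s < t \<Longrightarrow> D s \<omega> < D t \<omega>" "\<And>K. \<exists>s\<ge>0. K < D s \<omega>"
    using R by (auto simp: D_regular_def)
  note lv = left_value_less_iff[OF D(1)]
  have \<tau>: "jump_time ?x l < jump_time ?x (Suc l)" "0 \<le> jump_time ?x l" for l
    using has_jumpsD(1)[OF c J[of "Suc l"]] jump_time_nonneg[OF c J order_refl] by auto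
  show 0: "jump_clock \<omega> 0 = 0" by (simp add: jump_clock_def left_value_def)
  show inc: "jump_clock \<omega> l < jump_clock \<omega> (Suc l)" for l
  proof -
    \<comment> \<open>An intermediate time: strict growth of \<open>D\<close> up to \<open>a\<close>
      separates consecutive left limits, even if \<open>D\<close> jumps at the later chain
      jump.\<close>
    define a where "a = (jump_time ?x l + jump_time ?x (Suc l)) / 2"
    have a: "jump_time ?x l < a" "a < jump_time ?x (Suc l)" "0 < a"
      using \<tau>[of l] by (auto simp: a_def)
    have "jump_clock \<omega> l \<le> D (jump_time ?x l) \<omega>"
    proof (rule ccontr)
      assume "\<not> ?thesis"
      then have "D (jump_time ?x l) \<omega> < left_value ?D (jump_time ?x l)" by (simp add: jump_clock_def)
      then obtain u where u: "0 \<le> u" "u < jump_time ?x l" "D (jump_time ?x l) \<omega> < D u \<omega>"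
        using lv mono_onD[OF D(1), of 0 "jump_time ?x l"] \<tau>(2)[of l] D(2) by auto
      then show False using D(3)[OF u(1,2)] by simp
    qed
    also have "D (jump_time ?x l) \<omega> < left_value ?D (jump_time ?x (Suc l))"
      using lv a D(3)[OF \<tau>(2) a(1)] by (metis less_imp_le)
    finally show ?thesis by (simp add: jump_clock_def)
  qed
  show "\<exists>l. t < jump_clock \<omega> l"
  proof -
    obtain s where s: "s \<ge> 0" "t < D s \<omega>" using D(4) by blast
    obtain l where "s < jump_time ?x l" using jump_time_unbounded[OF c J] by blast
    then show ?thesis using s lv by (auto simp: jump_clock_def)
  qed
  show "time_changed Q (inverse_subordinator D) t \<omega> = jump_state ?x l"
    if t: "jump_clock \<omega> l \<le> t" "t < jump_clock \<omega> (Suc l)"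
  proof -
    have "0 \<le> jump_clock \<omega> l" by (induction l) (use 0 inc in \<open>auto intro: order_trans less_imp_le\<close>)
    then have t0: "t \<ge> 0" using t by simp
    have iff: "inverse_subordinator D t \<omega> < jump_time ?x k \<longleftrightarrow> t < jump_clock \<omega> k" if "0 < k" for k
    \<comment> \<open>At \<open>t = 0\<close> the inverse is set to 0 by convention, outside the
      infimum formula.\<close>
    proof (cases "t = 0")
      case True
      have k: "0 < jump_time ?x k" using \<tau>[of "k - 1"] that by simp
      then have "D 0 \<omega> < D (jump_time ?x k / 2) \<omega>" by (intro D(3)) auto
      then have "0 < left_value ?D (jump_time ?x k)"
        using lv k D(2) by (intro lv[THEN iffD2] disjI2 exI[of _ "jump_time ?x k / 2"]) auto
      then show ?thesis using True k by (simp add: inverse_subordinator_def jump_clock_def)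
    next
      case False
      then show ?thesis using t0 inverse_subordinator_less_iff[OF R, of t] lv by (auto simp: jump_clock_def)
    qed
    have "inverse_subordinator D t \<omega> < jump_time ?x (Suc l)" using iff t by simp
    moreover have "jump_time ?x l \<le> inverse_subordinator D t \<omega>"
    proof (cases "l = 0")
      case True
      have "\<not> inverse_subordinator D t \<omega> < 0"
        using inverse_subordinator_less_iff[OF R, of t 0] t0 by (cases "t = 0") (auto simp: inverse_subordinator_def)
      then show ?thesis using True by simp
    next
      case False
      then show ?thesis using iff[of l] t by auto
    qed
    ultimately show ?thesis unfolding time_changed_def using has_jumpsD(2)[OF c J[of "Suc l"]] by blast
  qed
qed

end

section \<open>Sequences of states of the Erlang queue\<close>

definition completion_target :: "nat \<Rightarrow> nat \<times> nat \<Rightarrow> nat \<times> nat" where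
  "completion_target k p = (if snd p \<ge> 2 then (fst p, snd p - 1) else if fst p \<ge> 2 then (fst p - 1, k) else (0, 0))"

definition erlang_succ :: "nat \<Rightarrow> nat \<times> nat \<Rightarrow> (nat \<times> nat) set" where
  "erlang_succ k p = (if p = (0, 0) then {(1, k)} else {(fst p + 1, snd p), completion_target k p})"

definition erlang_exit_rate :: "real \<Rightarrow> real \<Rightarrow> nat \<Rightarrow> nat \<times> nat \<Rightarrow> real" where
  "erlang_exit_rate lam mu k p = (if p = (0, 0) then lam else lam + real k * mu)"

lemma phase_completes_iff:
  "p \<in> erlang_states k \<Longrightarrow> phase_completes k p p' \<longleftrightarrow> p \<noteq> (0, 0) \<and> p' = completion_target k p"
  by (cases p) (auto simp: phase_completes_def completion_target_def erlang_states_def)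

lemma completion_target_ne: "p \<in> erlang_states k \<Longrightarrow> p \<noteq> (0, 0) \<Longrightarrow> completion_target k p \<noteq> p"
  by (cases p) (auto simp: completion_target_def erlang_states_def)

lemma completion_target_ne_arrival: "completion_target k p \<noteq> (fst p + 1, snd p)"
  by (auto simp: completion_target_def)

lemma erlang_succ_states:
  "k \<ge> 1 \<Longrightarrow> p \<in> erlang_states k \<Longrightarrow> erlang_succ k p \<subseteq> erlang_states k - {p}"
  using completion_target_ne[of p k]
  by (cases p) (auto simp: erlang_succ_def erlang_states_def completion_target_def split: if_splits)

lemma erlang_rate_simps:
  assumes "p \<in> erlang_states k"
  shows "erlang_rate lam mu k (0, 0) (1, k) = lam"
    and "p \<noteq> (0, 0) \<Longrightarrow> erlang_rate lam mu k p (fst p + 1, snd p) = lam"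
    and "p \<noteq> (0, 0) \<Longrightarrow> erlang_rate lam mu k p (completion_target k p) = real k * mu"
    and "p' \<notin> erlang_succ k p \<Longrightarrow> erlang_rate lam mu k p p' = 0"
proof -
  show "erlang_rate lam mu k (0, 0) (1, k) = lam" by (simp add: erlang_rate_def)
  show "p \<noteq> (0, 0) \<Longrightarrow> erlang_rate lam mu k p (fst p + 1, snd p) = lam"
    unfolding erlang_rate_def by simp
  show "p \<noteq> (0, 0) \<Longrightarrow> erlang_rate lam mu k p (completion_target k p) = real k * mu"
    unfolding erlang_rate_def phase_completes_iff[OF assms]
    using completion_target_ne_arrival[of k p] by simp
  show "p' \<notin> erlang_succ k p \<Longrightarrow> erlang_rate lam mu k p p' = 0"
    unfolding erlang_rate_def phase_completes_iff[OF assms] erlang_succ_def by (cases "p = (0, 0)") auto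
qed

lemma sum_erlang_succ:
  assumes "p \<in> erlang_states k"
  shows "(\<Sum>j\<in>erlang_succ k p. f j) = (if p = (0, 0) then f (1, k) else f (fst p + 1, snd p) + f (completion_target k p))"
  using completion_target_ne_arrival[of k p] by (auto simp: erlang_succ_def)

lemma erlang_exit_rate_infsum:
  assumes k: "k \<ge> 1" and p: "p \<in> erlang_states k"
  shows "(\<Sum>\<^sub>\<infinity>j\<in>erlang_states k - {p}. erlang_rate lam mu k p j) = erlang_exit_rate lam mu k p"
proof -
  have "(\<Sum>\<^sub>\<infinity>j\<in>erlang_states k - {p}. erlang_rate lam mu k p j) = (\<Sum>\<^sub>\<infinity>j\<in>erlang_succ k p. erlang_rate lam mu k p j)"
    using erlang_succ_states[OF k p] erlang_rate_simps(4)[OF p] by (intro infsum_cong_neutral) auto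
  also have "\<dots> = (\<Sum>j\<in>erlang_succ k p. erlang_rate lam mu k p j)"
    by (intro infsum_finite) (simp add: erlang_succ_def)
  also have "\<dots> = erlang_exit_rate lam mu k p"
    unfolding sum_erlang_succ[OF p] erlang_exit_rate_def using erlang_rate_simps(1-3)[OF p] by simp
  finally show ?thesis .
qed

text \<open>In a busy state this is the number of the phase being served, counted from 0; in the
  idle state it is the number of the phase to be started next.\<close>

definition completions :: "nat \<Rightarrow> (nat \<Rightarrow> nat \<times> nat) \<Rightarrow> nat \<Rightarrow> nat" where
  "completions k i m = card {l. l < m \<and> phase_completes k (i l) (i (Suc l))}"

lemma completions_0[simp]: "completions k i 0 = 0" by (simp add: completions_def)

lemma completions_Suc: "completions k i (Suc m) = completions k i m + (if phase_completes k (i m) (i (Suc m)) then 1 else 0)"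
proof -
  have "{l. l < Suc m \<and> phase_completes k (i l) (i (Suc l))} =
    (if phase_completes k (i m) (i (Suc m)) then insert m {l. l < m \<and> phase_completes k (i l) (i (Suc l))}
     else {l. l < m \<and> phase_completes k (i l) (i (Suc l))})"
    by (auto simp: less_Suc_eq)
  then show ?thesis by (simp add: completions_def)
qed

lemma completions_mono: "l \<le> m \<Longrightarrow> completions k i l \<le> completions k i m"
  by (rule lift_Suc_mono_le[of "completions k i"]) (simp_all add: completions_Suc)

lemma completions_cong: "(\<And>l. l \<le> m \<Longrightarrow> i l = i' l) \<Longrightarrow> completions k i m = completions k i' m"
  by (induction m) (auto simp: completions_Suc)

text \<open>The possible sequences of states up to the \<open>m\<close>-th jump, padded with \<open>(0, 0)\<close>.\<close>

primrec erlang_paths :: "nat \<Rightarrow> nat \<Rightarrow> (nat \<Rightarrow> nat \<times> nat) set" where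
  "erlang_paths k 0 = {\<lambda>_. (0, 0)}"
| "erlang_paths k (Suc m) = (\<Union>i\<in>erlang_paths k m. (\<lambda>j. i(Suc m := j)) ` erlang_succ k (i m))"

lemma erlang_paths_props:
  assumes k: "k \<ge> 1"
  shows "i \<in> erlang_paths k m \<Longrightarrow> i 0 = (0, 0) \<and> (\<forall>l>m. i l = (0, 0)) \<and> (\<forall>l. i l \<in> erlang_states k) \<and>
    (\<forall>l<m. i (Suc l) \<in> erlang_succ k (i l))"
proof (induction m arbitrary: i)
  case 0
  then show ?case by (auto simp: erlang_states_def)
next
  case (Suc m)
  then obtain i' j where i': "i' \<in> erlang_paths k m" "i = i'(Suc m := j)" "j \<in> erlang_succ k (i' m)" by auto
  note IH = Suc.IH[OF i'(1)]
  have "j \<in> erlang_states k" using i'(3) erlang_succ_states[OF k, of "i' m"] IH by auto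
  then show ?case using IH i'(2,3) by (auto simp: less_Suc_eq)
qed

lemma finite_erlang_paths: "finite (erlang_paths k m)"
  by (induction m) (auto simp: erlang_succ_def)

lemma erlang_paths_eqI:
  assumes "k \<ge> 1" "i \<in> erlang_paths k m" "i' \<in> erlang_paths k m" "\<And>l. l \<le> m \<Longrightarrow> i l = i' l"
  shows "i = i'"
proof
  fix l show "i l = i' l"
    using assms erlang_paths_props[OF assms(1,2)] erlang_paths_props[OF assms(1,3)] by (cases "l \<le> m") auto
qed

lemma sum_erlang_paths_Suc:
  assumes k: "k \<ge> 1"
  shows "(\<Sum>i\<in>erlang_paths k (Suc m). f i) = (\<Sum>i\<in>erlang_paths k m. \<Sum>j\<in>erlang_succ k (i m). f (i(Suc m := j)))"
proof -
  have dis: "(\<lambda>j. i(Suc m := j)) ` erlang_succ k (i m) \<inter> (\<lambda>j. i'(Suc m := j)) ` erlang_succ k (i' m) = {}"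
    if "i \<in> erlang_paths k m" "i' \<in> erlang_paths k m" "i \<noteq> i'" for i i'
  proof (rule ccontr)
    assume "\<not> ?thesis"
    then obtain j j' where e: "i(Suc m := j) = i'(Suc m := j')" by blast
    have "i l = i' l" if "l \<le> m" for l using fun_cong[OF e, of l] that by simp
    then have "i = i'" by (rule erlang_paths_eqI[OF k that(1,2)])
    then show False using that by simp
  qed
  have "(\<Sum>i\<in>erlang_paths k (Suc m). f i) = (\<Sum>i\<in>erlang_paths k m. sum f ((\<lambda>j. i(Suc m := j)) ` erlang_succ k (i m)))"
    unfolding erlang_paths.simps
    by (intro sum.UNION_disjoint ballI impI finite_erlang_paths dis) (auto simp: erlang_succ_def)
  also have "\<dots> = (\<Sum>i\<in>erlang_paths k m. \<Sum>j\<in>erlang_succ k (i m). f (i(Suc m := j)))"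
  proof (rule sum.cong[OF refl])
    fix i :: "nat \<Rightarrow> nat \<times> nat"
    have "inj (\<lambda>j. i(Suc m := j))"
    proof (rule injI)
      fix j j' assume "i(Suc m := j) = i(Suc m := j')"
      from fun_cong[OF this, of "Suc m"] show "j = j'" by simp
    qed
    then show "sum f ((\<lambda>j. i(Suc m := j)) ` erlang_succ k (i m)) = (\<Sum>j\<in>erlang_succ k (i m). f (i(Suc m := j)))"
      by (subst sum.reindex) (auto intro: inj_on_subset)
  qed
  finally show ?thesis .
qed

text \<open>Along a sequence of jumps, the Laplace parameter \<open>z c\<close> is charged while phase number \<open>c\<close> is
  being served; idle periods are not charged.\<close>

definition phase_charge :: "(nat \<Rightarrow> real) \<Rightarrow> nat \<times> nat \<Rightarrow> nat \<Rightarrow> real" where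
  "phase_charge z p c = (if p = (0, 0) then 0 else z c)"

definition path_charge :: "nat \<Rightarrow> (nat \<Rightarrow> real) \<Rightarrow> (nat \<Rightarrow> nat \<times> nat) \<Rightarrow> nat \<Rightarrow> real" where
  "path_charge k z i l = phase_charge z (i l) (completions k i l)"

section \<open>Weighted sums over state sequences and their one-step operator\<close>

context
  fixes lam mu :: real and k :: nat and \<psi> :: "real \<Rightarrow> real" and z :: "nat \<Rightarrow> real"
  assumes lam: "lam > 0" and mu: "mu > 0" and k: "k \<ge> 1" and psi0: "\<psi> 0 = 0" and psi: "\<And>x. 0 \<le> \<psi> x"
begin

definition path_factor :: "nat \<times> nat \<Rightarrow> nat \<Rightarrow> nat \<times> nat \<Rightarrow> real" where
  "path_factor p c j = erlang_rate lam mu k p j / (erlang_exit_rate lam mu k p + \<psi> (phase_charge z p c))"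

text \<open>Expectation of \<open>g\<close> after \<open>m\<close> jumps of the embedded chain,
  damped by the charges. Finitely many sequences are possible, so it is a plain sum and no chain has
  to be constructed.\<close>

definition path_expectation :: "nat \<Rightarrow> (nat \<times> nat \<Rightarrow> nat \<Rightarrow> real) \<Rightarrow> real" where
  "path_expectation m g = (\<Sum>i\<in>erlang_paths k m. (\<Prod>l<m. path_factor (i l) (completions k i l) (i (Suc l))) * g (i m) (completions k i m))"

definition path_step :: "(nat \<times> nat \<Rightarrow> nat \<Rightarrow> real) \<Rightarrow> nat \<times> nat \<Rightarrow> nat \<Rightarrow> real" where
  "path_step g p c = (\<Sum>j\<in>erlang_succ k p. path_factor p c j * g j (c + (if phase_completes k p j then 1 else 0)))"

lemma path_expectation_0: "path_expectation 0 g = g (0, 0) 0"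
  by (simp add: path_expectation_def)

text \<open>The last jump is summed out. Earlier factors depend only on the states and the number of
  completions before it.\<close>

lemma path_expectation_Suc: "path_expectation (Suc m) g = path_expectation m (path_step g)"
proof -
  have "path_expectation (Suc m) g = (\<Sum>i\<in>erlang_paths k m. \<Sum>j\<in>erlang_succ k (i m).
      (\<Prod>l<Suc m. path_factor ((i(Suc m := j)) l) (completions k (i(Suc m := j)) l) ((i(Suc m := j)) (Suc l))) *
      g j (completions k (i(Suc m := j)) (Suc m)))"
    unfolding path_expectation_def sum_erlang_paths_Suc[OF k] by simp
  also have "\<dots> = (\<Sum>i\<in>erlang_paths k m. \<Sum>j\<in>erlang_succ k (i m).
      (\<Prod>l<m. path_factor (i l) (completions k i l) (i (Suc l))) *
      (path_factor (i m) (completions k i m) j * g j (completions k i m + (if phase_completes k (i m) j then 1 else 0))))"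
  proof (intro sum.cong refl)
    fix i :: "nat \<Rightarrow> nat \<times> nat" and j
    have c: "completions k (i(Suc m := j)) l = completions k i l" if "l \<le> m" for l
      using that by (intro completions_cong) auto
    have "(\<Prod>l<m. path_factor ((i(Suc m := j)) l) (completions k (i(Suc m := j)) l) ((i(Suc m := j)) (Suc l))) =
      (\<Prod>l<m. path_factor (i l) (completions k i l) (i (Suc l)))"
      using c by (intro prod.cong) auto
    then show "(\<Prod>l<Suc m. path_factor ((i(Suc m := j)) l) (completions k (i(Suc m := j)) l) ((i(Suc m := j)) (Suc l))) *
      g j (completions k (i(Suc m := j)) (Suc m)) = (\<Prod>l<m. path_factor (i l) (completions k i l) (i (Suc l))) *
      (path_factor (i m) (completions k i m) j * g j (completions k i m + (if phase_completes k (i m) j then 1 else 0)))"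
      using c[of m] by (simp add: completions_Suc)
  qed
  also have "\<dots> = path_expectation m (path_step g)"
    by (simp add: path_expectation_def path_step_def sum_distrib_left)
  finally show ?thesis .
qed

lemma exit_rate_pos: "0 < erlang_exit_rate lam mu k p"
  using lam mu by (simp add: erlang_exit_rate_def add_pos_nonneg)

lemma path_factor_nonneg: "0 \<le> path_factor p c j"
proof -
  have "0 \<le> erlang_rate lam mu k p j" using lam mu by (simp add: erlang_rate_def)
  moreover have "0 \<le> erlang_exit_rate lam mu k p + \<psi> (phase_charge z p c)"
    using psi[of "phase_charge z p c"] exit_rate_pos[of p] by linarith
  ultimately show ?thesis unfolding path_factor_def by (rule divide_nonneg_nonneg)
qed

lemma path_expectation_mono:
  assumes "\<And>p c. p \<in> erlang_states k \<Longrightarrow> g p c \<le> g' p c"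
  shows "path_expectation m g \<le> path_expectation m g'"
  unfolding path_expectation_def
proof (rule sum_mono)
  fix i assume "i \<in> erlang_paths k m"
  then have "i m \<in> erlang_states k" using erlang_paths_props[OF k] by blast
  from assms[OF this]
  show "(\<Prod>l<m. path_factor (i l) (completions k i l) (i (Suc l))) * g (i m) (completions k i m) \<le>
    (\<Prod>l<m. path_factor (i l) (completions k i l) (i (Suc l))) * g' (i m) (completions k i m)"
    by (intro mult_left_mono prod_nonneg ballI path_factor_nonneg)
qed

text \<open>In the idle state the charge is 0, so the only possible jump has factor
  \<open>lam / lam\<close>. In a busy state an arrival keeps the count of completions and a service
  jump raises it by one.\<close>

lemma path_step_eq:
  assumes p: "p \<in> erlang_states k"
  shows "path_step g p c = (if p = (0, 0) then g (1, k) c else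
    (lam * g (fst p + 1, snd p) c + real k * mu * g (completion_target k p) (Suc c)) / (lam + real k * mu + \<psi> (z c)))"
proof (cases "p = (0, 0)")
  case True
  then show ?thesis using lam p
    by (simp add: path_step_def sum_erlang_succ path_factor_def erlang_exit_rate_def phase_charge_def psi0
        erlang_rate_simps(1)[OF p, simplified] phase_completes_iff)
next
  case False
  then show ?thesis using p completion_target_ne_arrival[of k p]
    by (simp add: path_step_def sum_erlang_succ path_factor_def erlang_exit_rate_def phase_charge_def
        erlang_rate_simps(2,3)[OF p False, simplified] phase_completes_iff add_divide_distrib)
qed

lemma path_expectation_harmonic:
  assumes g: "\<And>p c. p \<in> erlang_states k \<Longrightarrow> path_step g p c = g p c"
  shows "path_expectation m g = g (0, 0) 0"
proof (induction m)
  case (Suc m)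
  have "path_expectation m (path_step g) = path_expectation m g"
    using path_expectation_mono[of "path_step g" g m] path_expectation_mono[of g "path_step g" m] g by (simp add: antisym)
  then show ?case using Suc by (simp add: path_expectation_Suc)
qed (simp add: path_expectation_0)

text \<open>Arrivals do not change the product, and a completion removes exactly the factor of the
  phase just served. The definition of that factor makes the weighted average over the two jumps
  reproduce the product.\<close>

lemma path_expectation_phases:
  assumes "\<And>c. n \<le> c \<Longrightarrow> z c = 0"
  shows "path_expectation m (\<lambda>p c. \<Prod>j\<in>{c..<n}. real k * mu / (real k * mu + \<psi> (z j))) =
    (\<Prod>j<n. real k * mu / (real k * mu + \<psi> (z j)))"
proof -
  let ?g = "\<lambda>(p::nat \<times> nat) c. \<Prod>j\<in>{c..<n}. real k * mu / (real k * mu + \<psi> (z j))"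
  have km: "real k * mu > 0" using k mu by simp
  have "path_step ?g p c = ?g p c" if p: "p \<in> erlang_states k" for p c
  proof (cases "p = (0, 0)")
    case True then show ?thesis unfolding path_step_eq[OF p] by simp
  next
    case False
    let ?s = "real k * mu + \<psi> (z c)"
    have s: "?s > 0" "lam + ?s > 0" using km psi[of "z c"] lam by auto
    show ?thesis
    proof (cases "c < n")
      case True
      then have "{c..<n} = insert c {Suc c..<n}" by auto
      then have e: "?g p c = real k * mu / ?s * ?g p (Suc c)" by simp
      have "path_step ?g p c = (lam * ?g p c + real k * mu * ?g p (Suc c)) / (lam + ?s)"
        unfolding path_step_eq[OF p] using False by (simp add: add.assoc)
      also have "real k * mu * ?g p (Suc c) = ?s * ?g p c" unfolding e using s by simp
      also have "(lam * ?g p c + ?s * ?g p c) / (lam + ?s) = ?g p c"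
        using s by (simp add: distrib_right[symmetric])
      finally show ?thesis .
    next
      \<comment> \<open>No factor is left and the charge is 0, so the one-step weights add up to
        1.\<close>
      case n: False
      then have "z c = 0" using assms by simp
      then show ?thesis unfolding path_step_eq[OF p] using False n km lam psi0 by simp
    qed
  qed
  from path_expectation_harmonic[of ?g, OF this] show ?thesis by (simp add: lessThan_atLeast0)
qed

text \<open>A Lyapunov function: the factor 2 at an idle state pays for the jump out of it, at which no
  phase is completed.\<close>

lemma path_expectation_power:
  assumes z: "\<And>c. z c = 0"
  defines "\<eta> \<equiv> (lam + real k * mu / 2) / (lam + real k * mu)"
  shows "path_expectation m (\<lambda>p c. (1 / 4) ^ c) \<le> 2 * \<eta> ^ m" and "\<eta> < 1" "0 \<le> \<eta>"
proof -
  have km: "real k * mu > 0" using k mu by simp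
  let ?g = "\<lambda>(p::nat \<times> nat) c. (if p = (0, 0) then 2 else 1) * (1 / 4 :: real) ^ c"
  \<comment> \<open>The idle state needs this bound: its jump lowers the weight from 2 to 1 at an
    unchanged count.\<close>
  have eta: "1 / 2 \<le> \<eta>" unfolding \<eta>_def using km lam by (subst pos_le_divide_eq) auto
  show "\<eta> < 1" unfolding \<eta>_def using km lam by (subst pos_divide_less_eq) (linarith, simp add: mult.commute)
  show "0 \<le> \<eta>" using eta by simp
  have step: "path_step ?g p c \<le> \<eta> * ?g p c" if p: "p \<in> erlang_states k" for p c
  proof (cases "p = (0, 0)")
    case True then show ?thesis unfolding path_step_eq[OF p] using eta by simp
  next
    case False
    have "path_step ?g p c = (lam * (1 / 4) ^ c + real k * mu * ?g (completion_target k p) (Suc c)) / (lam + real k * mu)"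
      unfolding path_step_eq[OF p] using False z psi0 by simp
    \<comment> \<open>A completion multiplies the power by \<open>1 / 4\<close> and reaches a state
      of weight at most 2, hence the factor \<open>1 / 2\<close> that defines
      \<open>\<eta>\<close>.\<close>
    also have "\<dots> \<le> (lam * (1 / 4) ^ c + real k * mu * (1 / 2 * (1 / 4) ^ c)) / (lam + real k * mu)"
      using km lam by (intro divide_right_mono add_left_mono mult_left_mono) auto
    also have "\<dots> = \<eta> * ?g p c" using False by (simp add: \<eta>_def add_divide_distrib distrib_right)
    finally show ?thesis .
  qed
  have scale: "path_expectation m (\<lambda>p c. a * h p c) = a * path_expectation m h" for a h m
    by (simp add: path_expectation_def sum_distrib_left mult_ac)
  have "path_expectation m ?g \<le> 2 * \<eta> ^ m"
  proof (induction m)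
    case 0 then show ?case by (simp add: path_expectation_0)
  next
    case (Suc m)
    have "path_expectation (Suc m) ?g \<le> path_expectation m (\<lambda>p c. \<eta> * ?g p c)"
      unfolding path_expectation_Suc by (rule path_expectation_mono[OF step])
    also have "\<dots> = \<eta> * path_expectation m ?g" by (rule scale)
    also have "\<dots> \<le> \<eta> * (2 * \<eta> ^ m)" using eta by (intro mult_left_mono Suc) auto
    finally show ?case by simp
  qed
  moreover have "path_expectation m (\<lambda>p c. (1 / 4) ^ c) \<le> path_expectation m ?g"
    by (rule path_expectation_mono) auto
  ultimately show "path_expectation m (\<lambda>p c. (1 / 4) ^ c) \<le> 2 * \<eta> ^ m" by linarith
qed

end

section \<open>Phases along a path\<close>

text \<open>A deterministic setting: a jump sequence with its jump times and the path they describe.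
  The phase functionals are evaluated here, apart from all probability.\<close>

locale queue_path =
  fixes k :: nat and J :: "nat \<Rightarrow> nat \<times> nat" and \<theta> :: "nat \<Rightarrow> real" and x :: "real \<Rightarrow> nat \<times> nat"
  assumes k: "k \<ge> 1" and J_0: "J 0 = (0, 0)" and J_states: "\<And>l. J l \<in> erlang_states k"
    and J_succ: "\<And>l. J (Suc l) \<in> erlang_succ k (J l)"
    and J_completions: "\<And>c. \<exists>m. c \<le> completions k J m"
    and \<theta>_0: "\<theta> 0 = 0" and \<theta>_Suc: "\<And>l. \<theta> l < \<theta> (Suc l)" and \<theta>_unbounded: "\<And>t. \<exists>l. t < \<theta> l"
    and x: "\<And>l t. \<theta> l \<le> t \<Longrightarrow> t < \<theta> (Suc l) \<Longrightarrow> x t = J l"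
begin

lemma \<theta>_less_iff: "\<theta> l < \<theta> m \<longleftrightarrow> l < m"
  using strict_mono_Suc_iff[of \<theta>] \<theta>_Suc strict_mono_less[of \<theta> l m] by simp

lemma \<theta>_le_iff: "\<theta> l \<le> \<theta> m \<longleftrightarrow> l \<le> m"
  using \<theta>_less_iff[of m l] by auto

lemma J_ne: "J (Suc l) \<noteq> J l"
  using J_succ[of l] erlang_succ_states[OF k J_states[of l]] by auto

lemma jump_at_iff: "jump_at x t p p' \<longleftrightarrow> (\<exists>l. t = \<theta> (Suc l) \<and> p = J l \<and> p' = J (Suc l))"
proof
  assume "\<exists>l. t = \<theta> (Suc l) \<and> p = J l \<and> p' = J (Suc l)"
  then obtain l where l: "t = \<theta> (Suc l)" "p = J l" "p' = J (Suc l)" by blast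
  have "eventually (\<lambda>u. x u = p) (at_left t)"
    unfolding eventually_at_left_field using l \<theta>_Suc[of l] x[of l] by (intro exI[of _ "\<theta> l"]) auto
  moreover have "x t = p'" using l x[of "Suc l" t] \<theta>_Suc by simp
  moreover have "0 < t" using l \<theta>_less_iff[of 0 "Suc l"] \<theta>_0 by simp
  ultimately show "jump_at x t p p'" using l J_ne[of l] by (simp add: jump_at_def)
next
  assume "jump_at x t p p'"
  then have t: "0 < t" "eventually (\<lambda>u. x u = p) (at_left t)" "x t = p'" "p \<noteq> p'" by (auto simp: jump_at_def)
  define m where "m = (LEAST l. t < \<theta> l)"
  have m: "t < \<theta> m" unfolding m_def using \<theta>_unbounded by (rule LeastI_ex)
  have "m \<noteq> 0" using m t \<theta>_0 by (metis less_asym)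
  then obtain l where l: "m = Suc l" by (cases m) auto
  have "\<theta> l \<le> t" using not_less_Least[of l "\<lambda>l. t < \<theta> l"] l unfolding m_def by simp
  obtain b where b: "b < t" "\<And>y. b < y \<Longrightarrow> y < t \<Longrightarrow> x y = p" using t(2) by (auto simp: eventually_at_left_field)
  have left: "p = J r" if "\<theta> r < t" "t \<le> \<theta> (Suc r)" for r
  proof -
    define y where "y = (max b (\<theta> r) + t) / 2"
    have "max b (\<theta> r) < y" "y < t" using b(1) that by (auto simp: y_def)
    then show ?thesis using b(2)[of y] x[of r y] that by auto
  qed
  have xt: "x t = J l" using x[of l t] \<open>\<theta> l \<le> t\<close> m l by simp
  have tl: "t = \<theta> l"
  proof (rule ccontr)
    assume "t \<noteq> \<theta> l"
    then have "p = J l" using left[of l] \<open>\<theta> l \<le> t\<close> m l by simp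
    then show False using xt t by simp
  qed
  have "l \<noteq> 0" using tl t(1) \<theta>_0 by (metis less_irrefl)
  then obtain r where r: "l = Suc r" by (cases l) auto
  have "p = J r" using left[of r] \<theta>_Suc[of r] tl r by simp
  then show "\<exists>l. t = \<theta> (Suc l) \<and> p = J l \<and> p' = J (Suc l)"
    using xt t(3) tl r by (intro exI[of _ r]) simp
qed

section \<open>Jump indices at which phases start and end\<close>

definition "completes l \<longleftrightarrow> l > 0 \<and> phase_completes k (J (l - 1)) (J l)"
definition "starts l \<longleftrightarrow> l > 0 \<and> phase_starts k (J (l - 1)) (J l)"

lemma times_of_jumps: "{t. \<exists>p p'. jump_at x t p p' \<and> R p p'} = \<theta> ` {l. l > 0 \<and> R (J (l - 1)) (J l)}"
proof (intro set_eqI iffI)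
  fix t assume "t \<in> {t. \<exists>p p'. jump_at x t p p' \<and> R p p'}"
  then obtain l where "t = \<theta> (Suc l)" "R (J l) (J (Suc l))" unfolding jump_at_iff by blast
  then show "t \<in> \<theta> ` {l. l > 0 \<and> R (J (l - 1)) (J l)}" by (intro image_eqI[of _ _ "Suc l"]) simp_all
next
  fix t assume "t \<in> \<theta> ` {l. l > 0 \<and> R (J (l - 1)) (J l)}"
  then obtain l where l: "t = \<theta> l" "l > 0" "R (J (l - 1)) (J l)" by blast
  then obtain r where "l = Suc r" by (cases l) auto
  then show "t \<in> {t. \<exists>p p'. jump_at x t p p' \<and> R p p'}"
    using l unfolding jump_at_iff mem_Collect_eq
    by (intro exI[of _ "J r"] exI[of _ "J (Suc r)"] conjI exI[of _ r]) simp_all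
qed

lemma completion_times: "phase_completion_times k x = \<theta> ` {l. completes l}"
  unfolding phase_completion_times_def completes_def by (rule times_of_jumps)

lemma start_times: "phase_start_times k x = \<theta> ` {l. starts l}"
  unfolding phase_start_times_def starts_def by (rule times_of_jumps)

lemma Inf_times:
  assumes "P a" "\<And>l. P l \<Longrightarrow> a \<le> l" shows "Inf (\<theta> ` {l. P l}) = \<theta> a"
  using assms \<theta>_le_iff by (intro cInf_eq_minimum) auto

lemma completions_step: "completions k J (Suc l) = completions k J l + (if completes (Suc l) then 1 else 0)"
  by (simp add: completions_Suc completes_def)

lemma starts_iff: "starts (Suc l) \<longleftrightarrow> J (Suc l) \<noteq> (0, 0) \<and> (J l = (0, 0) \<or> completes (Suc l))"
proof -
  have "J l = (0, 0) \<Longrightarrow> J (Suc l) = (1, k)" using J_succ[of l] by (simp add: erlang_succ_def)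
  then show ?thesis using k by (auto simp: starts_def phase_starts_def completes_def)
qed

lemma completes_busy: "completes (Suc l) \<Longrightarrow> J l \<noteq> (0, 0)"
  using phase_completes_iff[OF J_states[of l]] by (auto simp: completes_def)

lemma stays_busy: "J l \<noteq> (0, 0) \<Longrightarrow> \<not> completes (Suc l) \<Longrightarrow> J (Suc l) \<noteq> (0, 0)"
  using J_succ[of l] phase_completes_iff[OF J_states[of l], of "J (Suc l)"] by (auto simp: completes_def erlang_succ_def)

text \<open>A completion follows because their number is unbounded; before it the server cannot
  become idle, since only a completion can empty the system.\<close>

lemma next_completion:
  assumes a: "J a \<noteq> (0, 0)"
  obtains b where "a < b" "completes b" "\<And>l. completes l \<Longrightarrow> a < l \<Longrightarrow> b \<le> l"
    "\<And>l. a \<le> l \<Longrightarrow> l < b \<Longrightarrow> J l \<noteq> (0, 0) \<and> completions k J l = completions k J a"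
    "completions k J b = Suc (completions k J a)"
proof -
  have ex: "\<exists>l. a < l \<and> completes l"
  proof (rule ccontr)
    assume n: "\<not> ?thesis"
    have "completions k J (a + r) = completions k J a" for r
      using n by (induction r) (auto simp: completions_step)
    then have "completions k J m \<le> completions k J a" for m
      using completions_mono[of m "a + m" k J] by simp
    moreover obtain m where "Suc (completions k J a) \<le> completions k J m" using J_completions by blast
    ultimately show False by (metis not_less_eq_eq)
  qed
  define b where "b = (LEAST l. a < l \<and> completes l)"
  have b: "a < b" "completes b" using LeastI_ex[OF ex] by (auto simp: b_def)
  have least: "b \<le> l" if "completes l" "a < l" for l unfolding b_def using that by (intro Least_le) auto
  have run: "J l \<noteq> (0, 0) \<and> completions k J l = completions k J a" if "a \<le> l" "l < b" for l
    using that
  proof (induction l rule: dec_induct)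
    case (step l)
    then have "\<not> completes (Suc l)" using least[of "Suc l"] by auto
    then show ?case using step stays_busy[of l] by (simp add: completions_step)
  qed (use a in simp)
  obtain b' where b': "b = Suc b'" using b(1) by (cases b) auto
  then have "completions k J b = Suc (completions k J a)" using run[of b'] b by (simp add: completions_step)
  then show ?thesis using that[OF b least run] by blast
qed

text \<open>Phase \<open>j\<close> occupies the consecutive jump indices at which the count of
  completions is \<open>j\<close> and the server is busy. After a completion the next phase starts
  at the same jump if a customer is present, otherwise at the next jump.\<close>

lemma phase_times:
  "\<exists>a b. phase_start k x j = \<theta> a \<and> phase_end k x j = \<theta> b \<and> a < b \<and>
    {l. completions k J l = j \<and> J l \<noteq> (0, 0)} = {a..<b} \<and> completes b \<and> completions k J b = Suc j"
proof -
  \<comment> \<open>Everything about phase \<open>j\<close> once its starting index is known; it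
    serves both within the induction on starting indices and after it.\<close>
  have fin: "phase_end k x j = \<theta> b \<and> {l. completions k J l = j \<and> J l \<noteq> (0, 0)} = {a..<b} \<and> completions k J b = Suc j"
    if s: "phase_start k x j = \<theta> a" and a: "completions k J a = j" "\<And>l. l < a \<Longrightarrow> completions k J l < j \<or> J l = (0, 0)"
      and b: "a < b" "completes b" "\<And>l. completes l \<Longrightarrow> a < l \<Longrightarrow> b \<le> l"
        "\<And>l. a \<le> l \<Longrightarrow> l < b \<Longrightarrow> J l \<noteq> (0, 0) \<and> completions k J l = completions k J a"
        "completions k J b = Suc (completions k J a)" for a b j
  proof (intro conjI)
    have "phase_completion_times k x \<inter> {\<theta> a<..} = \<theta> ` {l. completes l \<and> a < l}"
      unfolding completion_times using \<theta>_less_iff by auto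
    moreover have "Inf (\<theta> ` {l. completes l \<and> a < l}) = \<theta> b" using b(1,2,3) by (intro Inf_times) auto
    ultimately show "phase_end k x j = \<theta> b" by (simp add: phase_end_def s)
    show "{l. completions k J l = j \<and> J l \<noteq> (0, 0)} = {a..<b}"
    proof (intro set_eqI iffI)
      fix l assume "l \<in> {l. completions k J l = j \<and> J l \<noteq> (0, 0)}"
      then show "l \<in> {a..<b}"
        using a(2)[of l] completions_mono[of b l k J] b(5) a(1) by (cases "l < a"; cases "b \<le> l") auto
    next
      fix l assume "l \<in> {a..<b}"
      then show "l \<in> {l. completions k J l = j \<and> J l \<noteq> (0, 0)}" using b(4)[of l] a(1) by auto
    qed
    show "completions k J b = Suc j" using b(5) a(1) by simp
  qed
  have "\<exists>a. phase_start k x j = \<theta> a \<and> completions k J a = j \<and> J a \<noteq> (0, 0) \<and>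
    (\<forall>l<a. completions k J l < j \<or> J l = (0, 0))" for j
  proof (induction j)
    case 0
    have J1: "J 1 = (1, k)" using J_succ[of 0] J_0 by (simp add: erlang_succ_def)
    have "starts 1" using starts_iff[of 0] J1 J_0 by simp
    moreover have "1 \<le> l" if "starts l" for l using that by (simp add: starts_def)
    ultimately have "phase_start k x 0 = \<theta> 1"
      using Inf_times[of starts 1] by (simp add: start_times)
    moreover have "completions k J 1 = 0" using completes_busy[of 0] J_0 completions_step[of 0] by auto
    ultimately show ?case using J1 J_0 by (intro exI[of _ 1]) auto
  next
    case (Suc j)
    then obtain a where a: "phase_start k x j = \<theta> a" "completions k J a = j" "J a \<noteq> (0, 0)"
      "\<And>l. l < a \<Longrightarrow> completions k J l < j \<or> J l = (0, 0)" by blast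
    obtain b where b: "a < b" "completes b" "\<And>l. completes l \<Longrightarrow> a < l \<Longrightarrow> b \<le> l"
        "\<And>l. a \<le> l \<Longrightarrow> l < b \<Longrightarrow> J l \<noteq> (0, 0) \<and> completions k J l = completions k J a"
        "completions k J b = Suc (completions k J a)"
      using next_completion[OF a(3)] by metis
    have e: "phase_end k x j = \<theta> b" using fin[OF a(1,2,4) b] by blast
    have "phase_start_times k x \<inter> {\<theta> b..} = \<theta> ` {l. starts l \<and> b \<le> l}"
      unfolding start_times using \<theta>_le_iff by auto
    then have ps: "phase_start k x (Suc j) = Inf (\<theta> ` {l. starts l \<and> b \<le> l})"
      using e by (simp add: phase_end_def)
    obtain b' where b': "b = Suc b'" using b(1) by (cases b) auto
    have lt_b: "completions k J l < Suc j" if "l < b" for l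
      using completions_mono[of l b' k J] b(4)[of b'] that b' b(1) a(2) by auto
    show ?case
    proof (cases "J b = (0, 0)")
      case False
      then have "starts b" using starts_iff[of b'] b(2) b' by simp
      then have "phase_start k x (Suc j) = \<theta> b"
        unfolding ps by (intro Inf_times) auto
      then show ?thesis using False b(5) a(2) lt_b by (intro exI[of _ b]) auto
    next
      case True
      \<comment> \<open>From the empty system only an arrival is possible, so the idle period is a
        single index and the next phase starts at \<open>Suc b\<close>.\<close>
      then have J1: "J (Suc b) = (1, k)" using J_succ[of b] by (simp add: erlang_succ_def)
      have "starts (Suc b)" "\<not> starts b" using starts_iff[of b] starts_iff[of b'] True J1 b' by auto
      then have "phase_start k x (Suc j) = \<theta> (Suc b)"
        unfolding ps by (intro Inf_times) (auto simp: Suc_le_eq le_less)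
      moreover have "completions k J (Suc b) = Suc j"
        using completes_busy[of b] True completions_step[of b] b(5) a(2) by auto
      ultimately show ?thesis using J1 True lt_b by (intro exI[of _ "Suc b"]) (auto simp: less_Suc_eq)
    qed
  qed
  then obtain a where a: "phase_start k x j = \<theta> a" "completions k J a = j" "J a \<noteq> (0, 0)"
      "\<And>l. l < a \<Longrightarrow> completions k J l < j \<or> J l = (0, 0)" by blast
  obtain b where b: "a < b" "completes b" "\<And>l. completes l \<Longrightarrow> a < l \<Longrightarrow> b \<le> l"
        "\<And>l. a \<le> l \<Longrightarrow> l < b \<Longrightarrow> J l \<noteq> (0, 0) \<and> completions k J l = completions k J a"
        "completions k J b = Suc (completions k J a)"
    using next_completion[OF a(3)] by metis
  show ?thesis using fin[OF a(1,2,4) b] a(1) b(1,2) by blast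
qed

lemma inter_phase_time_nonneg: "0 \<le> inter_phase_time k x j"
  using phase_times[of j] \<theta>_less_iff by (auto simp: inter_phase_time_def intro: less_imp_le)

text \<open>The sum telescopes over the indices of phase \<open>j\<close>. The busy condition
  excludes an idle period preceding the phase, during which the count is \<open>j\<close> as
  well.\<close>

lemma inter_phase_time_sum:
  assumes m: "j < completions k J m"
  shows "inter_phase_time k x j = (\<Sum>l<m. if completions k J l = j \<and> J l \<noteq> (0, 0) then \<theta> (Suc l) - \<theta> l else 0)"
proof -
  obtain a b where ab: "phase_start k x j = \<theta> a" "phase_end k x j = \<theta> b" "a < b"
    "{l. completions k J l = j \<and> J l \<noteq> (0, 0)} = {a..<b}" "completions k J b = Suc j" "completes b"
    using phase_times[of j] by blast
  have iff: "completions k J l = j \<and> J l \<noteq> (0, 0) \<longleftrightarrow> a \<le> l \<and> l < b" for l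
    using ab(4) by (auto simp: set_eq_iff)
  have "b \<le> m"
  proof (rule ccontr)
    assume "\<not> b \<le> m"
    then have "m \<le> b - 1" by simp
    then have "completions k J m \<le> completions k J (b - 1)" by (rule completions_mono)
    also have "\<dots> = j" using iff[of "b - 1"] ab(3) by auto
    finally show False using m by simp
  qed
  have "(\<Sum>l<m. if completions k J l = j \<and> J l \<noteq> (0, 0) then \<theta> (Suc l) - \<theta> l else 0) = (\<Sum>l\<in>{a..<b}. \<theta> (Suc l) - \<theta> l)"
    unfolding iff using \<open>b \<le> m\<close> by (intro sum.mono_neutral_cong_right) auto
  also have "\<dots> = \<theta> b - \<theta> a" using ab(3) by (intro sum_Suc_diff') simp
  finally show ?thesis using ab by (simp add: inter_phase_time_def)
qed

text \<open>Every busy holding interval belongs to exactly one phase, so the two sums can be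
  exchanged; idle intervals and the phases from \<open>n\<close> on carry no charge.\<close>

lemma prod_path_charge:
  assumes m: "n \<le> completions k J m" and z: "\<And>c. n \<le> c \<Longrightarrow> z c = 0"
  shows "(\<Prod>l<m. exp (- path_charge k z J l * (\<theta> (Suc l) - \<theta> l))) = (\<Prod>j<n. exp (- z j * inter_phase_time k x j))"
proof -
  have "(\<Sum>j<n. - z j * inter_phase_time k x j) = (\<Sum>j<n. \<Sum>l<m. if completions k J l = j \<and> J l \<noteq> (0, 0) then - z j * (\<theta> (Suc l) - \<theta> l) else 0)"
  proof (rule sum.cong[OF refl])
    fix j assume "j \<in> {..<n}"
    then have "j < completions k J m" using m by simp
    then show "- z j * inter_phase_time k x j = (\<Sum>l<m. if completions k J l = j \<and> J l \<noteq> (0, 0) then - z j * (\<theta> (Suc l) - \<theta> l) else 0)"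
      by (subst inter_phase_time_sum) (auto simp: sum_distrib_left intro!: sum.cong)
  qed
  also have "\<dots> = (\<Sum>l<m. \<Sum>j<n. if completions k J l = j \<and> J l \<noteq> (0, 0) then - z j * (\<theta> (Suc l) - \<theta> l) else 0)"
    by (rule sum.swap)
  also have "\<dots> = (\<Sum>l<m. - path_charge k z J l * (\<theta> (Suc l) - \<theta> l))"
  proof (rule sum.cong[OF refl])
    fix l
    have "(\<Sum>j<n. if completions k J l = j \<and> J l \<noteq> (0, 0) then - z j * (\<theta> (Suc l) - \<theta> l) else 0) =
       (\<Sum>j<n. if completions k J l = j then (if J l \<noteq> (0, 0) then - z j * (\<theta> (Suc l) - \<theta> l) else 0) else 0)"
      by (intro sum.cong) auto
    also have "\<dots> = (if completions k J l < n then (if J l \<noteq> (0, 0) then - z (completions k J l) * (\<theta> (Suc l) - \<theta> l) else 0) else 0)"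
      by (subst sum.delta') auto
    also have "\<dots> = - path_charge k z J l * (\<theta> (Suc l) - \<theta> l)"
      using z[of "completions k J l"] by (auto simp: path_charge_def phase_charge_def)
    finally show "(\<Sum>j<n. if completions k J l = j \<and> J l \<noteq> (0, 0) then - z j * (\<theta> (Suc l) - \<theta> l) else 0) =
       - path_charge k z J l * (\<theta> (Suc l) - \<theta> l)" .
  qed
  finally show ?thesis by (simp add: exp_sum[symmetric])
qed

end

section \<open>Inter-phase and service times\<close>

locale erlang_setup = chain_setup M D a1 a2 c1 c2 Q "erlang_states k" "(0, 0)" P "erlang_rate lam mu k" "erlang_exit_rate lam mu k"
  for M :: "'a measure" and D a1 a2 c1 c2 Q P lam mu k +
  assumes lam: "0 < lam" and mu: "0 < mu" and k: "1 \<le> k"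
begin

sublocale C: prob_space "completion M" by (rule prob_space_completion)

abbreviation "J \<omega> \<equiv> jump_state (\<lambda>t. Q t \<omega>)"
abbreviation "expected z m g \<equiv> path_expectation lam mu k laplace_exponent z m g"

lemma charge_nonneg: "(\<And>c. 0 \<le> z c) \<Longrightarrow> 0 \<le> path_charge k z i l"
  by (simp add: path_charge_def phase_charge_def)

lemma erlang_path_weight:
  assumes i: "i \<in> erlang_paths k m" and z: "\<And>c. 0 \<le> z c"
  shows "(\<lambda>\<omega>. ennreal (jump_weight i (path_charge k z i) m \<omega>)) \<in> borel_measurable (completion M)"
    and "(\<integral>\<^sup>+\<omega>. ennreal (jump_weight i (path_charge k z i) m \<omega>) \<partial>completion M) =
      ennreal (\<Prod>l<m. path_factor lam mu k laplace_exponent z (i l) (completions k i l) (i (Suc l)))"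
proof -
  have p: "i l \<in> erlang_states k" "i 0 = (0, 0)" "l < m \<Longrightarrow> i l \<noteq> i (Suc l)" for l
    using erlang_paths_props[OF k i] erlang_succ_states[OF k, of "i l"] by auto
  have "path_charge k z i 0 = 0" using p(2) by (simp add: path_charge_def phase_charge_def)
  note W = jump_weight_integral[of i m "path_charge k z i", OF p charge_nonneg[OF z] this]
  show "(\<lambda>\<omega>. ennreal (jump_weight i (path_charge k z i) m \<omega>)) \<in> borel_measurable (completion M)" by (rule W(1))
  show "(\<integral>\<^sup>+\<omega>. ennreal (jump_weight i (path_charge k z i) m \<omega>) \<partial>completion M) =
      ennreal (\<Prod>l<m. path_factor lam mu k laplace_exponent z (i l) (completions k i l) (i (Suc l)))"
  proof -
    have "path_factor lam mu k laplace_exponent z (i l) (completions k i l) (i (Suc l)) =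
        erlang_rate lam mu k (i l) (i (Suc l)) / (erlang_exit_rate lam mu k (i l) + laplace_exponent (path_charge k z i l))" for l
      by (simp add: path_factor_def[of lam mu k laplace_exponent, OF lam mu k laplace_exponent_0 laplace_exponent_nonneg] path_charge_def)
    then show ?thesis by (simp only: W(2))
  qed
qed

lemma factor_nonneg: "0 \<le> path_factor lam mu k laplace_exponent z p c j"
  by (rule path_factor_nonneg[of lam mu k laplace_exponent, OF lam mu k laplace_exponent_0 laplace_exponent_nonneg])

lemma nn_integral_erlang_paths:
  assumes z: "\<And>c. 0 \<le> z c" and g: "\<And>p c. 0 \<le> g p c"
  shows "(\<integral>\<^sup>+\<omega>. (\<Sum>i\<in>erlang_paths k m. ennreal (jump_weight i (path_charge k z i) m \<omega>) * ennreal (g (i m) (completions k i m))) \<partial>completion M) =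
    ennreal (expected z m g)"
proof -
  have "(\<integral>\<^sup>+\<omega>. (\<Sum>i\<in>erlang_paths k m. ennreal (jump_weight i (path_charge k z i) m \<omega>) * ennreal (g (i m) (completions k i m))) \<partial>completion M) =
    (\<Sum>i\<in>erlang_paths k m. ennreal (\<Prod>l<m. path_factor lam mu k laplace_exponent z (i l) (completions k i l) (i (Suc l))) * ennreal (g (i m) (completions k i m)))"
    using erlang_path_weight[OF _ z] by (subst nn_integral_sum) (auto simp: nn_integral_multc intro!: sum.cong)
  also have "\<dots> = ennreal (expected z m g)"
    unfolding path_expectation_def[of lam mu k laplace_exponent, OF lam mu k laplace_exponent_0 laplace_exponent_nonneg]
    by (subst sum_ennreal[symmetric]) (auto simp: ennreal_mult prod_nonneg factor_nonneg g)
  finally show ?thesis .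
qed

lemma erlang_paths_unique:
  assumes "i' \<in> erlang_paths k m" "jumps_through i' m \<omega>" "i \<in> erlang_paths k m" "jumps_through i m \<omega>"
  shows "i' = i"
  by (rule erlang_paths_eqI[OF k assms(1,3)]) (use assms(2,4) in \<open>simp add: jumps_through_def\<close>)

text \<open>With zero charges the weights are indicators of disjoint events, and their expectations
  add up to 1 because the constant 1 is harmonic. So almost surely the chain makes \<open>m\<close>
  jumps, all along permitted transitions.\<close>

lemma AE_jumps_through: "AE \<omega> in completion M. \<exists>i\<in>erlang_paths k m. jumps_through i m \<omega>"
proof -
  let ?W = "\<lambda>i \<omega>. ennreal (jump_weight i (path_charge k (\<lambda>_. 0) i) m \<omega>)"
  have c0: "path_charge k (\<lambda>_. 0) i l = 0" for i l by (simp add: path_charge_def phase_charge_def)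
  have W: "?W i \<omega> = (if jumps_through i m \<omega> then 1 else 0)" for i \<omega> by (simp add: jump_weight_def c0)
  let ?A = "{\<omega> \<in> space (completion M). \<exists>i\<in>erlang_paths k m. jumps_through i m \<omega>}"
  have [measurable]: "?W i \<in> borel_measurable (completion M)" if "i \<in> erlang_paths k m" for i
    using erlang_path_weight(1)[OF that] by simp
  have "{\<omega> \<in> space (completion M). jumps_through i m \<omega>} \<in> sets (completion M)" if "i \<in> erlang_paths k m" for i
  proof -
    have "{\<omega> \<in> space (completion M). jumps_through i m \<omega>} = {\<omega> \<in> space (completion M). ?W i \<omega> = 1}" by (auto simp: W)
    also have "\<dots> \<in> sets (completion M)" using that by measurable
    finally show ?thesis .
  qed
  moreover have "?A = (\<Union>i\<in>erlang_paths k m. {\<omega> \<in> space (completion M). jumps_through i m \<omega>})" by auto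
  ultimately have A: "?A \<in> sets (completion M)" using finite_erlang_paths by (auto intro!: sets.finite_UN)
  have "1 = ennreal (expected (\<lambda>_. 0) m (\<lambda>_ _. 1))"
  proof -
    have "expected (\<lambda>_. 0) m (\<lambda>_ _. 1) = 1"
    proof (rule path_expectation_harmonic[of lam mu k laplace_exponent, OF lam mu k laplace_exponent_0 laplace_exponent_nonneg])
      fix p :: "nat \<times> nat" and c :: nat assume "p \<in> erlang_states k"
      moreover have "0 < real k * mu" using k mu by simp
      ultimately show "path_step lam mu k laplace_exponent (\<lambda>_. 0) (\<lambda>_ _. 1) p c = 1"
        using lam by (subst path_step_eq[of lam mu k laplace_exponent, OF lam mu k laplace_exponent_0 laplace_exponent_nonneg]) auto
    qed
    then show ?thesis by simp
  qed
  also have "\<dots> = (\<integral>\<^sup>+\<omega>. (\<Sum>i\<in>erlang_paths k m. ?W i \<omega>) \<partial>completion M)"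
    using nn_integral_erlang_paths[of "\<lambda>_. 0" "\<lambda>_ _. 1" m] by simp
  also have "\<dots> \<le> (\<integral>\<^sup>+\<omega>. indicator ?A \<omega> \<partial>completion M)"
  proof (rule nn_integral_mono)
    fix \<omega> assume \<omega>: "\<omega> \<in> space (completion M)"
    show "(\<Sum>i\<in>erlang_paths k m. ?W i \<omega>) \<le> indicator ?A \<omega>"
    proof (cases "\<exists>i\<in>erlang_paths k m. jumps_through i m \<omega>")
      case True
      then obtain i where i: "i \<in> erlang_paths k m" "jumps_through i m \<omega>" by blast
      have "\<not> jumps_through i' m \<omega>" if "i' \<in> erlang_paths k m - {i}" for i'
        using erlang_paths_unique[OF _ _ i] that by blast
      then have "(\<Sum>i\<in>erlang_paths k m. ?W i \<omega>) = (\<Sum>i'\<in>{i}. ?W i' \<omega>)"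
        using i by (intro sum.mono_neutral_right finite_erlang_paths) (simp_all add: W)
      also have "\<dots> = 1" using i by (simp add: W)
      also have "\<dots> \<le> indicator ?A \<omega>" using True \<omega> by simp
      finally show ?thesis .
    next
      case False
      then have "(\<Sum>i\<in>erlang_paths k m. ?W i \<omega>) = 0" by (intro sum.neutral) (auto simp: W)
      then show ?thesis by simp
    qed
  qed
  also have "\<dots> = emeasure (completion M) ?A" using A by (rule nn_integral_indicator)
  finally have "1 \<le> C.prob ?A" by (simp add: C.emeasure_eq_measure)
  then have "C.prob ?A = 1" using C.prob_le_1[of ?A] by (rule antisym[rotated])
  then show ?thesis using C.prob_eq_1[OF A] by simp
qed

definition regular :: "'a \<Rightarrow> bool" where
  "regular \<omega> \<longleftrightarrow> \<omega> \<in> space M \<and> D_regular \<omega> \<and> cadlag_step_path (\<lambda>t. Q t \<omega>) \<and> (\<forall>m. \<exists>i\<in>erlang_paths k m. jumps_through i m \<omega>)"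

lemma AE_regular: "AE \<omega> in completion M. regular \<omega>"
proof -
  have "AE \<omega> in completion M. \<forall>m. \<exists>i\<in>erlang_paths k m. jumps_through i m \<omega>"
    using AE_jumps_through by (simp add: AE_all_countable)
  then show ?thesis
    using AE_completion[OF AE_D_regular] AE_completion[OF Q_cadlag] AE_space[of "completion M"]
    by eventually_elim (auto simp: regular_def)
qed

lemma regularD:
  assumes "regular \<omega>"
  shows "has_jumps (\<lambda>t. Q t \<omega>) m" "J \<omega> 0 = (0, 0)" "J \<omega> l \<in> erlang_states k" "J \<omega> (Suc l) \<in> erlang_succ k (J \<omega> l)"
    "jump_clock \<omega> l < jump_clock \<omega> (Suc l)"
proof -
  have "\<forall>m. \<exists>i. i \<in> erlang_paths k m \<and> jumps_through i m \<omega>" using assms unfolding regular_def by blast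
  then obtain i where i: "\<And>m. i m \<in> erlang_paths k m" "\<And>m. jumps_through (i m) m \<omega>" by metis
  show J: "has_jumps (\<lambda>t. Q t \<omega>) m" for m using i(2)[of m] by (simp add: jumps_through_def)
  note p = erlang_paths_props[OF k i(1)[of "Suc l"]]
  have e: "J \<omega> r = i (Suc l) r" if "r \<le> Suc l" for r using i(2)[of "Suc l"] that by (simp add: jumps_through_def)
  show "J \<omega> 0 = (0, 0)" "J \<omega> l \<in> erlang_states k" "J \<omega> (Suc l) \<in> erlang_succ k (J \<omega> l)" using p e by auto
  show "jump_clock \<omega> l < jump_clock \<omega> (Suc l)"
    using assms J by (intro time_changed_path(2)) (auto simp: regular_def)
qed

text \<open>The random variable whose expectation is the weighted sum over state sequences: on a
  regular path only the term of the actual sequence survives.\<close>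

definition path_value :: "(nat \<Rightarrow> real) \<Rightarrow> (nat \<times> nat \<Rightarrow> nat \<Rightarrow> real) \<Rightarrow> nat \<Rightarrow> 'a \<Rightarrow> real" where
  "path_value z g m \<omega> = (\<Prod>l<m. exp (- path_charge k z (J \<omega>) l * (jump_clock \<omega> (Suc l) - jump_clock \<omega> l))) *
     g (J \<omega> m) (completions k (J \<omega>) m)"

lemma path_value_eq_sum:
  assumes R: "regular \<omega>" and g: "\<And>p c. 0 \<le> g p c"
  shows "(\<Sum>i\<in>erlang_paths k m. ennreal (jump_weight i (path_charge k z i) m \<omega>) * ennreal (g (i m) (completions k i m))) =
    ennreal (path_value z g m \<omega>)"
proof -
  obtain i where i: "i \<in> erlang_paths k m" "jumps_through i m \<omega>" using R by (auto simp: regular_def)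
  have e: "i l = J \<omega> l" if "l \<le> m" for l using i(2) that by (simp add: jumps_through_def)
  have c: "completions k i l = completions k (J \<omega>) l" if "l \<le> m" for l
    using that e by (intro completions_cong) auto
  have "\<not> jumps_through i' m \<omega>" if "i' \<in> erlang_paths k m - {i}" for i'
    using erlang_paths_unique[OF _ _ i] that by blast
  then have "(\<Sum>i\<in>erlang_paths k m. ennreal (jump_weight i (path_charge k z i) m \<omega>) * ennreal (g (i m) (completions k i m))) =
     (\<Sum>i\<in>{i}. ennreal (jump_weight i (path_charge k z i) m \<omega>) * ennreal (g (i m) (completions k i m)))"
    using i by (intro sum.mono_neutral_right finite_erlang_paths) (simp_all add: jump_weight_def)
  also have "\<dots> = ennreal (jump_weight i (path_charge k z i) m \<omega> * g (i m) (completions k i m))"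
    by (simp add: ennreal_mult g jump_weight_def prod_nonneg)
  also have "jump_weight i (path_charge k z i) m \<omega> =
      (\<Prod>l<m. exp (- path_charge k z (J \<omega>) l * (jump_clock \<omega> (Suc l) - jump_clock \<omega> l)))"
    using i(2) e c by (auto simp: jump_weight_def path_charge_def intro!: prod.cong)
  finally show ?thesis using e[of m] c[of m] by (simp add: path_value_def)
qed

lemma path_value_integral:
  assumes z: "\<And>c. 0 \<le> z c" and g: "\<And>p c. 0 \<le> g p c"
  shows "(\<lambda>\<omega>. ennreal (path_value z g m \<omega>)) \<in> borel_measurable (completion M)"
    and "(\<integral>\<^sup>+\<omega>. ennreal (path_value z g m \<omega>) \<partial>completion M) = ennreal (expected z m g)"
proof -
  let ?S = "\<lambda>\<omega>. \<Sum>i\<in>erlang_paths k m. ennreal (jump_weight i (path_charge k z i) m \<omega>) * ennreal (g (i m) (completions k i m))"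
  have S: "?S \<in> borel_measurable (completion M)"
    using erlang_path_weight(1)[OF _ z] by (intro borel_measurable_sum borel_measurable_times_ennreal) auto
  have e: "AE \<omega> in completion M. ?S \<omega> = ennreal (path_value z g m \<omega>)"
    using AE_regular by eventually_elim (rule path_value_eq_sum[OF _ g])
  show "(\<lambda>\<omega>. ennreal (path_value z g m \<omega>)) \<in> borel_measurable (completion M)"
    by (rule borel_measurable_completion_AE_lim[OF S]) (use e in \<open>eventually_elim, simp\<close>)
  show "(\<integral>\<^sup>+\<omega>. ennreal (path_value z g m \<omega>) \<partial>completion M) = ennreal (expected z m g)"
    unfolding nn_integral_erlang_paths[OF z g, symmetric] using e by (intro nn_integral_cong_AE) auto
qed

text \<open>The power \<open>(1 / 4) ^ c\<close> of the number of completions has expectation at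
  most \<open>2 * \<eta> ^ m\<close> after \<open>m\<close> jumps. Its infimum over \<open>m\<close>
  therefore vanishes almost surely, which a bounded number of completions would prevent.\<close>

lemma AE_completions_unbounded: "AE \<omega> in completion M. \<forall>c. \<exists>m. c \<le> completions k (J \<omega>) m"
proof -
  let ?g = "\<lambda>(p::nat \<times> nat) c. (1 / 4 :: real) ^ c"
  let ?G = "\<lambda>m \<omega>. ennreal (path_value (\<lambda>_. 0) ?g m \<omega>)"
  have v: "path_value (\<lambda>_. 0) ?g m \<omega> = (1 / 4) ^ completions k (J \<omega>) m" for m \<omega>
    by (simp add: path_value_def path_charge_def phase_charge_def)
  have m: "?G m \<in> borel_measurable (completion M)" for m by (rule path_value_integral(1)) auto
  then have I: "(\<lambda>\<omega>. INF m. ?G m \<omega>) \<in> borel_measurable (completion M)" by (intro borel_measurable_INF) auto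
  define \<eta> where "\<eta> = (lam + real k * mu / 2) / (lam + real k * mu)"
  note P = path_expectation_power[of lam mu k laplace_exponent "\<lambda>_. 0", OF lam mu k laplace_exponent_0 laplace_exponent_nonneg refl, folded \<eta>_def]
  have "(\<integral>\<^sup>+\<omega>. (INF m. ?G m \<omega>) \<partial>completion M) \<le> ennreal (2 * \<eta> ^ m)" for m
  proof -
    have "(\<integral>\<^sup>+\<omega>. (INF m. ?G m \<omega>) \<partial>completion M) \<le> (\<integral>\<^sup>+\<omega>. ?G m \<omega> \<partial>completion M)"
      by (intro nn_integral_mono INF_lower) auto
    also have "\<dots> = ennreal (expected (\<lambda>_. 0) m ?g)" by (rule path_value_integral(2)) auto
    also have "\<dots> \<le> ennreal (2 * \<eta> ^ m)" using P(1) by (rule ennreal_leI)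
    finally show ?thesis .
  qed
  moreover have "(\<lambda>m. ennreal (2 * \<eta> ^ m)) \<longlonglongrightarrow> ennreal (2 * 0)"
    using P(2,3) by (intro tendsto_ennrealI tendsto_mult tendsto_const LIMSEQ_power_zero) auto
  ultimately have "(\<integral>\<^sup>+\<omega>. (INF m. ?G m \<omega>) \<partial>completion M) \<le> ennreal (2 * 0)"
    by (intro LIMSEQ_le_const) auto
  then have "(\<integral>\<^sup>+\<omega>. (INF m. ?G m \<omega>) \<partial>completion M) = 0" by simp
  then have "AE \<omega> in completion M. (INF m. ?G m \<omega>) = 0" using nn_integral_0_iff_AE[OF I] by simp
  then show ?thesis
  proof eventually_elim
    case (elim \<omega>)
    show ?case
    proof (rule ccontr)
      assume "\<not> ?thesis"
      then obtain c where c: "\<And>m. completions k (J \<omega>) m \<le> c" by (meson nat_le_linear)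
      have "ennreal ((1 / 4) ^ c) \<le> (INF m. ?G m \<omega>)"
        unfolding v using c by (intro INF_greatest ennreal_leI power_decreasing) auto
      then show False using elim by simp
    qed
  qed
qed

section \<open>The joint Laplace transform of the inter-phase times\<close>

abbreviation "QY \<equiv> time_changed Q (inverse_subordinator D)"
abbreviation "X j \<omega> \<equiv> inter_phase_time k (\<lambda>t. QY t \<omega>) j"

lemma AE_queue_path: "AE \<omega> in completion M. regular \<omega> \<and> queue_path k (J \<omega>) (jump_clock \<omega>) (\<lambda>t. QY t \<omega>)"
  using AE_regular AE_completions_unbounded
proof eventually_elim
  case (elim \<omega>)
  have "D_regular \<omega>" "cadlag_step_path (\<lambda>t. Q t \<omega>)" using elim(1) by (auto simp: regular_def)
  note T = time_changed_path[OF this regularD(1)[OF elim(1)]]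
  have "queue_path k (J \<omega>) (jump_clock \<omega>) (\<lambda>t. QY t \<omega>)"
  proof (rule queue_path.intro)
    show "1 \<le> k" by (rule k)
    show "\<exists>m. c \<le> completions k (J \<omega>) m" for c using elim(2) by blast
    show "QY t \<omega> = J \<omega> l" if "jump_clock \<omega> l \<le> t" "t < jump_clock \<omega> (Suc l)" for l t
      using T(4)[OF that] .
  qed (use regularD[OF elim(1)] T(1,3) in auto)
  then show ?case using elim(1) by simp
qed

lemma AE_inter_phase_time_nonneg: "AE \<omega> in completion M. 0 \<le> X j \<omega>"
  using AE_queue_path by eventually_elim (auto intro: queue_path.inter_phase_time_nonneg)

definition phase_laplace :: "real \<Rightarrow> real" where
  "phase_laplace z = real k * mu / (real k * mu + laplace_exponent z)"

lemma phase_laplace_bounds: "0 \<le> phase_laplace z" "phase_laplace z \<le> 1" "phase_laplace 0 = 1"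
proof -
  define \<kappa> where "\<kappa> = real k * mu"
  have "0 < \<kappa>" using k mu by (simp add: \<kappa>_def)
  then show "0 \<le> phase_laplace z" "phase_laplace z \<le> 1" "phase_laplace 0 = 1"
    unfolding phase_laplace_def \<kappa>_def[symmetric] using laplace_exponent_nonneg[of z] by auto
qed

text \<open>After \<open>m\<close> jumps the expected path value does not depend on
  \<open>m\<close>, by harmonicity. Once \<open>n\<close> phases are completed, the product of
  future factors is empty and the path value equals the exponential of the inter-phase times, so
  dominated convergence closes the argument.\<close>

lemma phases_laplace_aux:
  assumes z: "\<And>c. 0 \<le> z c" "\<And>c. n \<le> c \<Longrightarrow> z c = 0"
  shows "(\<lambda>\<omega>. ennreal (\<Prod>j<n. exp (- z j * X j \<omega>))) \<in> borel_measurable (completion M)"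
    and "(\<integral>\<^sup>+\<omega>. ennreal (\<Prod>j<n. exp (- z j * X j \<omega>)) \<partial>completion M) = ennreal (\<Prod>j<n. phase_laplace (z j))"
proof -
  let ?g = "\<lambda>(p::nat \<times> nat) c. \<Prod>j\<in>{c..<n}. real k * mu / (real k * mu + laplace_exponent (z j))"
  have g: "0 \<le> ?g p c" "?g p c \<le> 1" for p c
    using phase_laplace_bounds unfolding phase_laplace_def by (auto intro!: prod_nonneg prod_le_1)
  note V = path_value_integral[of z ?g, OF z(1) g(1)]
  have lim: "AE \<omega> in completion M. (\<lambda>m. ennreal (path_value z ?g m \<omega>)) \<longlonglongrightarrow> ennreal (\<Prod>j<n. exp (- z j * X j \<omega>))"
    using AE_queue_path
  proof eventually_elim
    case (elim \<omega>)
    then interpret queue_path k "J \<omega>" "jump_clock \<omega>" "\<lambda>t. QY t \<omega>" by simp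
    obtain m0 where m0: "n \<le> completions k (J \<omega>) m0" using J_completions by blast
    have "path_value z ?g m \<omega> = (\<Prod>j<n. exp (- z j * X j \<omega>))" if "m \<ge> m0" for m
    proof -
      have n: "n \<le> completions k (J \<omega>) m" using m0 completions_mono[OF that, of k "J \<omega>"] by simp
      have "(\<Prod>l<m. exp (- path_charge k z (J \<omega>) l * (jump_clock \<omega> (Suc l) - jump_clock \<omega> l))) =
          (\<Prod>j<n. exp (- z j * X j \<omega>))"
        using n z(2) by (rule prod_path_charge)
      then show ?thesis unfolding path_value_def using n by simp
    qed
    then have "eventually (\<lambda>m. ennreal (path_value z ?g m \<omega>) = ennreal (\<Prod>j<n. exp (- z j * X j \<omega>))) sequentially"
      by (intro eventually_sequentiallyI[of m0]) (simp only:)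
    then show ?case by (rule tendsto_eventually)
  qed
  show m: "(\<lambda>\<omega>. ennreal (\<Prod>j<n. exp (- z j * X j \<omega>))) \<in> borel_measurable (completion M)"
    by (rule borel_measurable_completion_AE_lim[OF V(1) lim])
  have "(\<lambda>m. \<integral>\<^sup>+\<omega>. ennreal (path_value z ?g m \<omega>) \<partial>completion M) \<longlonglongrightarrow>
      (\<integral>\<^sup>+\<omega>. ennreal (\<Prod>j<n. exp (- z j * X j \<omega>)) \<partial>completion M)"
  proof (rule nn_integral_dominated_convergence[OF V(1) m _ _ _ lim, where w="\<lambda>_. 1"])
    show "AE \<omega> in completion M. ennreal (path_value z ?g m \<omega>) \<le> 1" for m
      using AE_regular
    proof eventually_elim
      case (elim \<omega>)
      have "exp (- path_charge k z (J \<omega>) l * (jump_clock \<omega> (Suc l) - jump_clock \<omega> l)) \<le> 1" for l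
        using regularD(5)[OF elim, of l] charge_nonneg[of z "J \<omega>" l] z(1) by (auto intro!: mult_nonpos_nonneg)
      then have "(\<Prod>l<m. exp (- path_charge k z (J \<omega>) l * (jump_clock \<omega> (Suc l) - jump_clock \<omega> l))) \<le> 1"
        by (intro prod_le_1) simp
      then have "path_value z ?g m \<omega> \<le> 1 * 1"
        unfolding path_value_def by (rule mult_mono[OF _ g(2) _ g(1)]) simp
      then show ?case by (simp add: ennreal_le_1)
    qed
    show "(\<integral>\<^sup>+\<omega>. 1 \<partial>completion M) < \<infinity>" by (simp add: emeasure_space_1)
  qed simp
  moreover have "(\<integral>\<^sup>+\<omega>. ennreal (path_value z ?g m \<omega>) \<partial>completion M) = ennreal (\<Prod>j<n. phase_laplace (z j))" for m
    unfolding V(2) phase_laplace_def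
    using path_expectation_phases[of lam mu k laplace_exponent n z m, OF lam mu k laplace_exponent_0 laplace_exponent_nonneg z(2)] by simp
  ultimately show "(\<integral>\<^sup>+\<omega>. ennreal (\<Prod>j<n. exp (- z j * X j \<omega>)) \<partial>completion M) = ennreal (\<Prod>j<n. phase_laplace (z j))"
    by (simp add: LIMSEQ_const_iff)
qed

text \<open>Almost sure limits give measurability of the exponential of each inter-phase time, and a
  logarithm transfers it to the time itself.\<close>

lemma X_measurable[measurable]: "X j \<in> borel_measurable (completion M)"
proof -
  define z where "z c = (if c = j then 1 else 0 :: real)" for c
  have "(\<Prod>i<Suc j. exp (- z i * X i \<omega>)) = exp (- X j \<omega>)" for \<omega>
    by (simp add: z_def cong: prod.cong_simp)
  then have [measurable]: "(\<lambda>\<omega>. ennreal (exp (- X j \<omega>))) \<in> borel_measurable (completion M)"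
    using phases_laplace_aux(1)[of z "Suc j"] by (simp add: z_def)
  have "X j = (\<lambda>\<omega>. - ln (enn2real (ennreal (exp (- X j \<omega>)))))" by simp
  also have "\<dots> \<in> borel_measurable (completion M)" by measurable
  finally show ?thesis .
qed

lemma phases_laplace:
  assumes z: "\<And>c. 0 \<le> z c"
  shows "C.expectation (\<lambda>\<omega>. \<Prod>j<n. exp (- z j * X j \<omega>)) = (\<Prod>j<n. phase_laplace (z j))"
proof -
  \<comment> \<open>Truncation meets the condition that phases from \<open>n\<close> on are
    uncharged and leaves the first \<open>n\<close> factors unchanged.\<close>
  define z' where "z' c = (if c < n then z c else 0)" for c
  have "(\<integral>\<^sup>+\<omega>. ennreal (\<Prod>j<n. exp (- z' j * X j \<omega>)) \<partial>completion M) = ennreal (\<Prod>j<n. phase_laplace (z' j))"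
    using z by (intro phases_laplace_aux) (auto simp: z'_def)
  then have "(\<integral>\<^sup>+\<omega>. ennreal (\<Prod>j<n. exp (- z j * X j \<omega>)) \<partial>completion M) = ennreal (\<Prod>j<n. phase_laplace (z j))"
    by (simp add: z'_def)
  then show ?thesis using phase_laplace_bounds(1)
    by (subst integral_eq_nn_integral) (auto simp: prod_nonneg)
qed

lemma phase_laplace_single: "z \<ge> 0 \<Longrightarrow> C.expectation (\<lambda>\<omega>. exp (- z * X j \<omega>)) = phase_laplace z"
proof -
  assume z: "z \<ge> 0"
  define y where "y c = (if c = j then z else 0)" for c
  have "(\<Prod>i<Suc j. exp (- y i * X i \<omega>)) = exp (- z * X j \<omega>)" for \<omega>
    by (simp add: y_def cong: prod.cong_simp)
  moreover have "(\<Prod>i<Suc j. phase_laplace (y i)) = phase_laplace z"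
    using phase_laplace_bounds(3) by (simp add: y_def cong: prod.cong_simp)
  ultimately show ?thesis using phases_laplace[of y "Suc j"] z by (simp add: y_def)
qed

section \<open>Service times as blocks of phases\<close>

abbreviation "S m \<omega> \<equiv> service_time k (\<lambda>t. QY t \<omega>) m"

lemma S_measurable[measurable]: "S m \<in> borel_measurable (completion M)"
  unfolding service_time_def[abs_def] by measurable

lemma AE_service_time_nonneg: "AE \<omega> in completion M. 0 \<le> S m \<omega>"
proof -
  have "AE \<omega> in completion M. \<forall>j. 0 \<le> X j \<omega>" using AE_inter_phase_time_nonneg by (simp add: AE_all_countable)
  then show ?thesis by eventually_elim (auto simp: service_time_def intro: sum_nonneg)
qed

text \<open>Phase \<open>j\<close> belongs to service \<open>j div k\<close>, so giving all phases
  of a service the same parameter turns the joint transform of phases into that of services.\<close>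

lemma services_laplace:
  assumes z: "\<And>c. 0 \<le> z c"
  shows "C.expectation (\<lambda>\<omega>. \<Prod>m<n. exp (- z m * S m \<omega>)) = (\<Prod>m<n. phase_laplace (z m) ^ k)"
proof -
  have blocks: "(\<Prod>j<n * k. f (j div k) j) = (\<Prod>m<n. \<Prod>i<k. f m (m * k + i))" for f :: "nat \<Rightarrow> nat \<Rightarrow> real"
  proof -
    have "(\<Prod>j\<in>{m * k..<m * k + k}. f (j div k) j) = (\<Prod>i<k. f m (m * k + i))" for m
    proof -
      have "(\<Prod>j\<in>{0 + m * k..<k + m * k}. f (j div k) j) = (\<Prod>i\<in>{0..<k}. f ((i + m * k) div k) (i + m * k))"
        by (rule prod.shift_bounds_nat_ivl)
      also have "\<dots> = (\<Prod>i\<in>{0..<k}. f m (m * k + i))" by (intro prod.cong) (auto simp: add.commute)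
      finally show ?thesis by (simp add: add.commute lessThan_atLeast0)
    qed
    then show ?thesis using prod.nat_group[of "\<lambda>j. f (j div k) j" k n] by simp
  qed
  have "(\<Prod>m<n. exp (- z m * S m \<omega>)) = (\<Prod>j<n * k. exp (- z (j div k) * X j \<omega>))" for \<omega>
    unfolding blocks[of "\<lambda>m j. exp (- z m * X j \<omega>)"]
    by (intro prod.cong) (auto simp: service_time_def sum_distrib_left exp_sum sum_negf[symmetric])
  then have "C.expectation (\<lambda>\<omega>. \<Prod>m<n. exp (- z m * S m \<omega>)) = (\<Prod>j<n * k. phase_laplace (z (j div k)))"
    using phases_laplace[of "\<lambda>j. z (j div k)" "n * k"] z by simp
  also have "\<dots> = (\<Prod>m<n. phase_laplace (z m) ^ k)"
    unfolding blocks[of "\<lambda>m j. phase_laplace (z m)"] by simp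
  finally show ?thesis .
qed

lemma service_laplace_single: "z \<ge> 0 \<Longrightarrow> C.expectation (\<lambda>\<omega>. exp (- z * S m \<omega>)) = phase_laplace z ^ k"
proof -
  assume z: "z \<ge> 0"
  define y where "y c = (if c = m then z else 0)" for c
  have "(\<Prod>i<Suc m. exp (- y i * S i \<omega>)) = exp (- z * S m \<omega>)" for \<omega>
    by (simp add: y_def cong: prod.cong_simp)
  moreover have "(\<Prod>i<Suc m. phase_laplace (y i) ^ k) = phase_laplace z ^ k"
    using phase_laplace_bounds(3) by (simp add: y_def cong: prod.cong_simp)
  ultimately show ?thesis using services_laplace[of y "Suc m"] z by (simp add: y_def)
qed

lemma services_indep: "C.indep_vars (\<lambda>_. borel) S UNIV"
  by (rule C.indep_vars_laplace[OF S_measurable AE_service_time_nonneg])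
     (simp only: services_laplace service_laplace_single)

section \<open>Identification of the densities\<close>

abbreviation "f \<equiv> inter_phase_density a1 a2 c1 c2 mu k"

lemma f_facts:
  shows f_measurable: "f \<in> borel_measurable borel" and f_neg: "t \<le> 0 \<Longrightarrow> f t = 0"
    and f_cont: "continuous_on {0<..} f"
    and f_laplace: "eventually (\<lambda>z. integrable lborel (\<lambda>t. exp (- z * t) * f t) \<and>
      (\<integral>t. exp (- z * t) * f t \<partial>lborel) = phase_laplace z) at_top"
    and f_terms: "t > 0 \<Longrightarrow> summable (inter_phase_term a1 a2 c1 c2 mu k t)"
proof -
  have par: "a2 < a1" "0 < a1" "0 < c1" "0 \<le> c2" "0 < mu" "k \<ge> 1" using a c mu k by auto
  show "f \<in> borel_measurable borel" by (rule borel_measurable_inter_phase_density[OF par])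
  show "t \<le> 0 \<Longrightarrow> f t = 0" by (simp add: inter_phase_density_def)
  show "continuous_on {0<..} f" by (rule continuous_on_inter_phase_density[OF par])
  show "eventually (\<lambda>z. integrable lborel (\<lambda>t. exp (- z * t) * f t) \<and>
      (\<integral>t. exp (- z * t) * f t \<partial>lborel) = phase_laplace z) at_top"
    using inter_phase_density_laplace_eventually[OF par]
    by eventually_elim (simp add: phase_laplace_def laplace_exponent_def add.assoc)
  show "t > 0 \<Longrightarrow> summable (inter_phase_term a1 a2 c1 c2 mu k t)" by (rule inter_phase_term_summable[OF par])
qed

lemma f_large:
  obtains w where "w \<ge> 0" "\<And>n::nat. integrable lborel (\<lambda>t. exp (- (w + real n) * t) * f t)"
    "\<And>n::nat. (\<integral>t. exp (- (w + real n) * t) * f t \<partial>lborel) = phase_laplace (w + real n)"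
proof -
  obtain w where w: "\<And>z. z \<ge> w \<Longrightarrow> integrable lborel (\<lambda>t. exp (- z * t) * f t) \<and>
      (\<integral>t. exp (- z * t) * f t \<partial>lborel) = phase_laplace z"
    using f_laplace by (auto simp: eventually_at_top_linorder)
  have w': "w \<le> max 0 w + real n" for n by simp
  show ?thesis by (rule that[of "max 0 w"]) (simp, rule conjunct1[OF w[OF w']], rule conjunct2[OF w[OF w']])
qed

text \<open>Positivity comes from probability: beyond a threshold \<open>f\<close> has the Laplace
  transform of a nonnegative random variable, which excludes a negative part up to a null set, and
  continuity removes the null set.\<close>

lemma f_nonneg: "0 \<le> f t"
proof (cases "t > 0")
  case True
  obtain w where w: "w \<ge> 0" "\<And>n::nat. integrable lborel (\<lambda>t. exp (- (w + real n) * t) * f t)"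
    "\<And>n::nat. (\<integral>t. exp (- (w + real n) * t) * f t \<partial>lborel) = phase_laplace (w + real n)" by (rule f_large, rule that)
  have "AE t in lborel. 0 \<le> f t"
  proof (rule C.nonneg_laplaceI[OF X_measurable[of 0] AE_inter_phase_time_nonneg f_measurable f_neg w(1,2)])
    fix n :: nat
    have "0 \<le> w + real n" using w(1) by simp
    then show "(\<integral>t. exp (- (w + real n) * t) * f t \<partial>lborel) = C.expectation (\<lambda>\<omega>. exp (- (w + real n) * X 0 \<omega>))"
      unfolding w(3) by (rule phase_laplace_single[symmetric])
  qed
  then show ?thesis using f_cont True by (rule AE_nonneg_imp_nonneg)
qed (simp add: f_neg)

lemma X_distributed: "distributed (completion M) lborel (X j) (\<lambda>t. ennreal (f t))"
proof -
  obtain w where w: "w \<ge> 0" "\<And>n::nat. integrable lborel (\<lambda>t. exp (- (w + real n) * t) * f t)"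
    "\<And>n::nat. (\<integral>t. exp (- (w + real n) * t) * f t \<partial>lborel) = phase_laplace (w + real n)" by (rule f_large, rule that)
  show ?thesis
  proof (rule C.distributed_laplaceI[OF X_measurable AE_inter_phase_time_nonneg f_measurable f_nonneg f_neg w(1)])
    fix n :: nat
    have "(\<integral>\<^sup>+t. ennreal (exp (- (w + real n) * t) * f t) \<partial>lborel) = ennreal (phase_laplace (w + real n))"
      unfolding w(3)[symmetric] by (rule nn_integral_eq_integral[OF w(2)]) (simp add: f_nonneg)
    moreover have "0 \<le> w + real n" using w(1) by simp
    ultimately show "(\<integral>\<^sup>+t. ennreal (exp (- (w + real n) * t) * f t) \<partial>lborel) = ennreal (C.expectation (\<lambda>\<omega>. exp (- (w + real n) * X j \<omega>)))"
      by (simp only: phase_laplace_single)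
  qed
qed

text \<open>As \<open>f\<close> is now the density of an inter-phase time, its transform is known at
  every \<open>z \<ge> 0\<close>, including the points at which the double series cannot be
  integrated termwise.\<close>

lemma f_nn_laplace:
  assumes "z \<ge> 0" shows "(\<integral>\<^sup>+t. ennreal (exp (- z * t) * f t) \<partial>lborel) = ennreal (phase_laplace z)"
proof -
  have "(\<integral>\<^sup>+t. ennreal (exp (- z * t) * f t) \<partial>lborel) = (\<integral>\<^sup>+t. ennreal (f t) * ennreal (exp (- z * t)) \<partial>lborel)"
    by (intro nn_integral_cong) (simp add: ennreal_mult f_nonneg mult.commute)
  also have "\<dots> = (\<integral>\<^sup>+\<omega>. ennreal (exp (- z * X 0 \<omega>)) \<partial>completion M)"
    by (rule distributed_nn_integral[OF X_distributed]) measurable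
  also have "\<dots> = ennreal (C.expectation (\<lambda>\<omega>. exp (- z * X 0 \<omega>)))"
  proof (rule nn_integral_eq_integral)
    show "integrable (completion M) (\<lambda>\<omega>. exp (- z * X 0 \<omega>))"
      using AE_inter_phase_time_nonneg[of 0] assms
      by (intro C.integrable_const_bound[where B=1]) (auto elim!: eventually_mono intro!: mult_nonpos_nonneg)
  qed simp
  finally show ?thesis using assms by (simp only: phase_laplace_single)
qed

abbreviation "fS \<equiv> service_density a1 a2 c1 c2 mu k"

lemma fS_facts:
  shows fS_measurable: "fS \<in> borel_measurable borel" and fS_nonneg: "0 \<le> fS t" and fS_neg: "t \<le> 0 \<Longrightarrow> fS t = 0"
    and fS_nn_laplace: "z \<ge> 0 \<Longrightarrow> (\<integral>\<^sup>+t. ennreal (exp (- z * t) * fS t) \<partial>lborel) = ennreal (phase_laplace z ^ k)"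
proof -
  note C = conv_power_laplace[of f k, OF f_measurable f_nonneg f_neg k, folded service_density_def]
  show "fS \<in> borel_measurable borel" "0 \<le> fS t" "t \<le> 0 \<Longrightarrow> fS t = 0" using C by auto
  assume z: "z \<ge> 0"
  have "(\<integral>\<^sup>+t. ennreal (exp (- z * t) * f t) \<partial>lborel) < \<infinity>" unfolding f_nn_laplace[OF z] by simp
  then have "(\<integral>\<^sup>+t. ennreal (exp (- z * t) * fS t) \<partial>lborel) = (\<integral>\<^sup>+t. ennreal (exp (- z * t) * f t) \<partial>lborel) ^ k"
    using C by blast
  then show "(\<integral>\<^sup>+t. ennreal (exp (- z * t) * fS t) \<partial>lborel) = ennreal (phase_laplace z ^ k)"
    unfolding f_nn_laplace[OF z] by (simp add: ennreal_power phase_laplace_bounds)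
qed

text \<open>The shift is 0 here, because the transform of the convolution power is known down to
  \<open>z = 0\<close>.\<close>

lemma S_distributed: "distributed (completion M) lborel (S m) (\<lambda>t. ennreal (fS t))"
proof (rule C.distributed_laplaceI[OF S_measurable AE_service_time_nonneg fS_measurable fS_nonneg fS_neg, of 0])
  fix n :: nat
  have "0 \<le> 0 + real n" by simp
  then show "(\<integral>\<^sup>+t. ennreal (exp (- (0 + real n) * t) * fS t) \<partial>lborel) = ennreal (C.expectation (\<lambda>\<omega>. exp (- (0 + real n) * S m \<omega>)))"
    by (simp only: fS_nn_laplace service_laplace_single)
qed auto

lemma laplace_transform_fS: "z \<ge> 0 \<Longrightarrow> laplace_transform fS z = phase_laplace z ^ k"
  by (simp only: laplace_transform_nonneg[OF fS_measurable fS_nonneg fS_neg] fS_nn_laplace)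
     (simp add: phase_laplace_bounds)

end

theorem mainTheorem10:
  fixes M :: "'a measure"
    and lam mu \<alpha>\<^sub>1 \<alpha>\<^sub>2 c\<^sub>1 c\<^sub>2 :: real
    and k :: nat
    and Q QY :: "real \<Rightarrow> 'a \<Rightarrow> nat \<times> nat"
    and D Y :: "real \<Rightarrow> 'a \<Rightarrow> real"
  assumes "prob_space M"
    and "lam > 0" and "mu > 0" and "k \<ge> 1"
    and "0 < \<alpha>\<^sub>2" and "\<alpha>\<^sub>2 < \<alpha>\<^sub>1" and "\<alpha>\<^sub>1 < 1"
    and "c\<^sub>1 > 0" and "c\<^sub>2 \<ge> 0" and "c\<^sub>1 + c\<^sub>2 = 1"
    and "erlang_queue M lam mu k Q"
    and "mixed_stable_subordinator M \<alpha>\<^sub>1 \<alpha>\<^sub>2 c\<^sub>1 c\<^sub>2 D"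
    and "Y = inverse_subordinator D"
    and "independent_processes M (count_space (erlang_states k)) Q borel Y"
    and "QY = time_changed Q Y"
  shows "prob_space.indep_vars (completion M) (\<lambda>_. borel)
           (\<lambda>m \<omega>. service_time k (\<lambda>t. QY t \<omega>) m) UNIV \<and>
         (\<forall>m. has_pdf (completion M) (\<lambda>\<omega>. service_time k (\<lambda>t. QY t \<omega>) m)
            (service_density \<alpha>\<^sub>1 \<alpha>\<^sub>2 c\<^sub>1 c\<^sub>2 mu k)) \<and>
         (\<forall>j. has_pdf (completion M) (\<lambda>\<omega>. inter_phase_time k (\<lambda>t. QY t \<omega>) j)
            (inter_phase_density \<alpha>\<^sub>1 \<alpha>\<^sub>2 c\<^sub>1 c\<^sub>2 mu k)) \<and>
         (\<forall>t>0. summable (inter_phase_term \<alpha>\<^sub>1 \<alpha>\<^sub>2 c\<^sub>1 c\<^sub>2 mu k t)) \<and>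
         (\<forall>z>0. laplace_transform (service_density \<alpha>\<^sub>1 \<alpha>\<^sub>2 c\<^sub>1 c\<^sub>2 mu k) z =
            (real k * mu / (real k * mu + c\<^sub>1 * z powr \<alpha>\<^sub>1 + c\<^sub>2 * z powr \<alpha>\<^sub>2)) ^ k)"
proof -
  interpret prob_space M by fact
  interpret subordinator_setup M D \<alpha>\<^sub>1 \<alpha>\<^sub>2 c\<^sub>1 c\<^sub>2
    using assms by unfold_locales auto
  have Q: "markov_chain_with_rates M Q (erlang_states k) (0, 0) (erlang_rate lam mu k)"
    using assms by (simp add: erlang_queue_def)
  then obtain P :: "real \<Rightarrow> nat \<times> nat \<Rightarrow> (nat \<times> nat) pmf" where P:
    "\<And>(n::nat) (t :: nat \<Rightarrow> real) (i :: nat \<Rightarrow> nat \<times> nat).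
       0 \<le> t 0 \<and> (\<forall>m\<le>n. t m < t (Suc m)) \<and> (\<forall>m\<le>Suc n. i m \<in> erlang_states k) \<longrightarrow>
       measure M {\<omega> \<in> space M. \<forall>m\<le>Suc n. Q (t m) \<omega> = i m} =
         measure M {\<omega> \<in> space M. \<forall>m\<le>n. Q (t m) \<omega> = i m} * pmf (P (t (Suc n) - t n) (i n)) (i (Suc n))"
    "\<forall>i\<in>erlang_states k. \<forall>j\<in>erlang_states k. i \<noteq> j \<longrightarrow>
       ((\<lambda>h. pmf (P h i) j / h) \<longlongrightarrow> erlang_rate lam mu k i j) (at_right 0)"
    "\<forall>i\<in>erlang_states k. ((\<lambda>h. (1 - pmf (P h i) i) / h) \<longlongrightarrow>
       (\<Sum>\<^sub>\<infinity>j\<in>erlang_states k - {i}. erlang_rate lam mu k i j)) (at_right 0)"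
    unfolding markov_chain_with_rates_def by blast
  interpret erlang_setup M D \<alpha>\<^sub>1 \<alpha>\<^sub>2 c\<^sub>1 c\<^sub>2 Q P lam mu k
  proof unfold_locales
    show "Q t \<in> measurable M (count_space (erlang_states k))" if "0 \<le> t" for t
      using Q that unfolding markov_chain_with_rates_def by blast
    show "AE \<omega> in M. Q 0 \<omega> = (0, 0)" "AE \<omega> in M. cadlag_step_path (\<lambda>t. Q t \<omega>)"
      using Q unfolding markov_chain_with_rates_def by blast+
    show "measure M {\<omega> \<in> space M. \<forall>m\<le>Suc n. Q (ts m) \<omega> = i m} =
        measure M {\<omega> \<in> space M. \<forall>m\<le>n. Q (ts m) \<omega> = i m} * pmf (P (ts (Suc n) - ts n) (i n)) (i (Suc n))"
      if "0 \<le> ts 0" "\<forall>m\<le>n. ts m < ts (Suc m)" "\<forall>m\<le>Suc n. i m \<in> erlang_states k" for ts n i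
      using P(1) that by blast
    show "((\<lambda>h. pmf (P h i') j / h) \<longlongrightarrow> erlang_rate lam mu k i' j) (at_right 0)"
      if "i' \<in> erlang_states k" "j \<in> erlang_states k" "i' \<noteq> j" for i' j
      using P(2) that by blast
    show "((\<lambda>h. (1 - pmf (P h i') i') / h) \<longlongrightarrow> erlang_exit_rate lam mu k i') (at_right 0)"
      if "i' \<in> erlang_states k" for i'
      using P(3) that erlang_exit_rate_infsum[OF \<open>k \<ge> 1\<close> that, of lam mu] by force
    show "0 < erlang_exit_rate lam mu k i'" for i'
      using assms by (simp add: erlang_exit_rate_def add_pos_nonneg)
    show "independent_processes M (count_space (erlang_states k)) Q borel (inverse_subordinator D)"
      using assms by simp
  qed (use assms in auto)
  have "laplace_transform (service_density \<alpha>\<^sub>1 \<alpha>\<^sub>2 c\<^sub>1 c\<^sub>2 mu k) z =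
      (real k * mu / (real k * mu + c\<^sub>1 * z powr \<alpha>\<^sub>1 + c\<^sub>2 * z powr \<alpha>\<^sub>2)) ^ k" if "z > 0" for z
    using laplace_transform_fS[of z] that by (simp add: phase_laplace_def laplace_exponent_def add.assoc)
  then show ?thesis
    using services_indep S_distributed X_distributed f_nonneg fS_nonneg f_terms
    unfolding has_pdf_def \<open>QY = time_changed Q Y\<close> \<open>Y = inverse_subordinator D\<close> by blast
qed

end
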